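(* Let $M=\mathbb R^m$ and let $(T_\alpha,\hbar)$ be a $C^2$-convergent matrix regularization of $(\Sigma,\omega)$. Then the matrix sequence $$\hat K_\alpha=\frac1{\hbar_\alpha^4}\sum_{j,k,l=1}^m\Bigg(\frac12(\hat\gamma_\alpha^\dagger)^{-2}\big[[X_\alpha^j,X_\alpha^k],X_\alpha^k\big]\big[[X_\alpha^j,X_\alpha^l],X_\alpha^l\big]\hat\gamma_\alpha^{-2}-\frac14(\hat\gamma_\alpha^\dagger)^{-2}\big[[X_\alpha^j,X_\alpha^k],X_\alpha^l\big]\big[[X_\alpha^j,X_\alpha^k],X_\alpha^l\big]\hat\gamma_\alpha^{-2}\Bigg)$$ converges to the Gaussian curvature of $\Sigma$.
   Context: $\Sigma$ is a compact surface embedded in Euclidean space $\mathbb R^m$ via embedding (Cartesian) coordinates $x^1,\dots,x^m\in C^\infty(\Sigma)$, with induced metric $g_{ab}$, $g=\det(g_{ab})$. $\omega$ is a symplectic form on $\Sigma$, $\omega=\rho(u^1,u^2)\,du^1\wedge du^2$ locally, with Poisson bracket $\{f,h\}=\frac1\rho\varepsilon^{ab}(\partial_af)(\partial_bh)$; $\gamma=\sqrt g/\rho$. Matrix regularization: let $N_1<N_2<\cdots$ be positive integers, $T_\alpha$ ($\alpha=1,2,\dots$) linear maps from $C^\infty(\Sigma,\mathbb R)$ to hermitian $N_\alpha\times N_\alpha$ matrices, $\hbar(N)$ a real-valued strictly positive decreasing function such that $\lim_{N\to\infty}N\hbar(N)<\infty$, and $\hbar_\alpha=\hbar(N_\alpha)$.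 Put $\partial^f(h)=\{h,f\}$, $\hat\partial^f_\alpha(X)=\frac1{i\hbar_\alpha}[X,T_\alpha(f)]$, $\partial^{f_1\cdots f_l}=\partial^{f_1}\cdots\partial^{f_l}$, $\hat\partial_\alpha^{f_1\cdots f_l}=\hat\partial_\alpha^{f_1}\cdots\hat\partial_\alpha^{f_l}$. $(T_\alpha,\hbar)$ is a $C^k$-convergent matrix regularization of $(\Sigma,\omega)$ if for all integers $1\le l\le k$ and all $f,h,f_1,\dots,f_l\in C^\infty(\Sigma)$: $\lim\|T_\alpha(f)\|<\infty$; $\lim\|T_\alpha(fh)-T_\alpha(f)T_\alpha(h)\|=0$; $\lim\|\hat\partial_\alpha^{f_1\cdots f_l}(T_\alpha(f))-T_\alpha(\partial^{f_1\cdots f_l}(f))\|=0$; $\lim2\pi\hbar_\alpha\operatorname{Tr}T_\alpha(f)=\int_\Sigma f\omega$ (limits as $\alpha\to\infty$, operator norm). A sequence $\{\hat f_\alpha\}$ of $N_\alpha\times N_\alpha$ matrices converges to $f$ if $\lim\|\hat f_\alpha-T_\alpha(f)\|=0$, and $C^k$-converges to $f$ if in addition $\lim\|\hat\partial_\alpha^{f_1\cdots f_l}(\hat f_\alpha)-T_\alpha(\partial^{f_1\cdots f_l}(f))\|=0$ for all $1\le l\le k$ and all $f_1,\dots,f_l$. Standing: $X_\alpha^i=T_\alpha(x^i)$; $\{\hat\gamma_\alpha\}$ is a $C^2$-convergent sequence converging to $\gamma$, and $\{\hat\gamma_\alpha^{-1}\}$ exists and converges to $1/\gamma$. *)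

theory Defs
  imports
    "HOL-Analysis.Analysis"
    "Jordan_Normal_Form.Schur_Decomposition"
    "Jordan_Normal_Form.Gauss_Jordan_Elimination"
begin

(* "$" is the component of a vector in real^'n, as in HOL-Analysis. *)
no_notation Matrix.vec_index (infixl \<open>$\<close> 100)

section \<open>Smooth functions and embedded surfaces\<close>

(* Meant for open U. *)
primrec Ck_on :: "nat \<Rightarrow> 'a::real_normed_vector set \<Rightarrow> ('a \<Rightarrow> 'b::real_normed_vector) \<Rightarrow> bool" where
  "Ck_on 0 U f \<longleftrightarrow> continuous_on U f"
| "Ck_on (Suc k) U f \<longleftrightarrow>
     (\<forall>x\<in>U. f differentiable (at x)) \<and> (\<forall>v. Ck_on k U (\<lambda>x. frechet_derivative f (at x) v))"

definition smooth_on :: "'a::real_normed_vector set \<Rightarrow> ('a \<Rightarrow> 'b::real_normed_vector) \<Rightarrow> bool" where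
  "smooth_on U f \<longleftrightarrow> (\<forall>k. Ck_on k U f)"

definition partial :: "2 \<Rightarrow> (real^2 \<Rightarrow> 'b::real_normed_vector) \<Rightarrow> real^2 \<Rightarrow> 'b" where
  "partial a f u = frechet_derivative f (at u) (axis a 1)"

(* Inverse of a coordinate chart of the subset S of Euclidean space: a smooth immersion that
   is a homeomorphism from an open set of the plane onto a relatively open piece of S. *)
definition local_chart :: "(real^'m) set \<Rightarrow> (real^2) set \<Rightarrow> (real^2 \<Rightarrow> real^'m) \<Rightarrow> bool" where
  "local_chart S U \<phi> \<longleftrightarrow>
     open U \<and> smooth_on U \<phi> \<and> (\<forall>u\<in>U. inj (frechet_derivative \<phi> (at u))) \<and>
     openin (top_of_set S) (\<phi> ` U) \<and> (\<exists>\<psi>. homeomorphism U (\<phi> ` U) \<phi> \<psi>)"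

definition embedded_surface :: "(real^'m) set \<Rightarrow> bool" where
  "embedded_surface S \<longleftrightarrow> (\<forall>p\<in>S. \<exists>U \<phi>. local_chart S U \<phi> \<and> p \<in> \<phi> ` U)"

(* Functions on S are represented by functions on the ambient space; their values off S are
   irrelevant. *)
definition Cinf :: "(real^'m) set \<Rightarrow> (real^'m \<Rightarrow> real) set" where
  "Cinf S = {f. \<forall>U \<phi>. local_chart S U \<phi> \<longrightarrow> smooth_on U (f \<circ> \<phi>)}"

definition tangent_space :: "(real^'m) set \<Rightarrow> real^'m \<Rightarrow> (real^'m) set" where
  "tangent_space S p =
     {v. \<exists>U \<phi> u. local_chart S U \<phi> \<and> u \<in> U \<and> \<phi> u = p \<and> v \<in> range (frechet_derivative \<phi> (at u))}"

(* The value at p of a chart-independent local expression F. *)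
definition chart_value ::
  "((real^2) set \<Rightarrow> (real^2 \<Rightarrow> real^'m) \<Rightarrow> bool) \<Rightarrow> ((real^2 \<Rightarrow> real^'m) \<Rightarrow> real^2 \<Rightarrow> real)
   \<Rightarrow> real^'m \<Rightarrow> real" where
  "chart_value C F p = (THE r. \<forall>U \<phi> u. C U \<phi> \<and> u \<in> U \<and> \<phi> u = p \<longrightarrow> F \<phi> u = r)"

section \<open>Induced metric and Gaussian curvature\<close>

definition metric :: "(real^2 \<Rightarrow> real^'m) \<Rightarrow> real^2 \<Rightarrow> real^2^2" where
  "metric \<phi> u = (\<chi> a b. inner (partial a \<phi> u) (partial b \<phi> u))"

definition metric_det :: "(real^2 \<Rightarrow> real^'m) \<Rightarrow> real^2 \<Rightarrow> real" where
  "metric_det \<phi> u = Determinants.det (metric \<phi> u)"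

(* christoffel \<phi> d a b is Gamma^d_{ab} of the Levi-Civita connection. *)
definition christoffel :: "(real^2 \<Rightarrow> real^'m) \<Rightarrow> 2 \<Rightarrow> 2 \<Rightarrow> 2 \<Rightarrow> real^2 \<Rightarrow> real" where
  "christoffel \<phi> d a b u = (\<Sum>e\<in>UNIV. matrix_inv (metric \<phi> u) $ d $ e / 2 *
     (partial a (\<lambda>w. metric \<phi> w $ e $ b) u + partial b (\<lambda>w. metric \<phi> w $ e $ a) u
        - partial e (\<lambda>w. metric \<phi> w $ a $ b) u))"

(* R^d_{cab}, the components of R(e_a, e_b) e_c. *)
definition riemann :: "(real^2 \<Rightarrow> real^'m) \<Rightarrow> 2 \<Rightarrow> 2 \<Rightarrow> 2 \<Rightarrow> 2 \<Rightarrow> real^2 \<Rightarrow> real" where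
  "riemann \<phi> d c a b u =
     partial a (christoffel \<phi> d b c) u - partial b (christoffel \<phi> d a c) u
     + (\<Sum>e\<in>UNIV. christoffel \<phi> d a e u * christoffel \<phi> e b c u
                 - christoffel \<phi> d b e u * christoffel \<phi> e a c u)"

(* R_{1212} / g, equal to 1 on the unit sphere. *)
definition gaussian_curvature :: "(real^'m) set \<Rightarrow> real^'m \<Rightarrow> real" where
  "gaussian_curvature S = chart_value (local_chart S)
     (\<lambda>\<phi> u. (\<Sum>d\<in>UNIV. metric \<phi> u $ 1 $ d * riemann \<phi> d 2 1 2 u) / metric_det \<phi> u)"

section \<open>Symplectic structure\<close>

(* \<rho> in the local expression \<rho> du^1 \<and> du^2 of \<omega>. *)
definition density ::
  "(real^'m \<Rightarrow> real^'m \<Rightarrow> real^'m \<Rightarrow> real) \<Rightarrow> (real^2 \<Rightarrow> real^'m) \<Rightarrow> real^2 \<Rightarrow> real" where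
  "density \<omega> \<phi> u = \<omega> (\<phi> u) (partial 1 \<phi> u) (partial 2 \<phi> u)"

(* Every 2-form on a surface is closed, so closedness is not listed. *)
definition symplectic_form :: "(real^'m) set \<Rightarrow> (real^'m \<Rightarrow> real^'m \<Rightarrow> real^'m \<Rightarrow> real) \<Rightarrow> bool" where
  "symplectic_form S \<omega> \<longleftrightarrow>
     (\<forall>p\<in>S. \<forall>v\<in>tangent_space S p.
        (\<forall>w\<in>tangent_space S p. \<forall>z\<in>tangent_space S p. \<forall>a b.
            \<omega> p (a *\<^sub>R v + b *\<^sub>R w) z = a * \<omega> p v z + b * \<omega> p w z \<and>
            \<omega> p z (a *\<^sub>R v + b *\<^sub>R w) = a * \<omega> p z v + b * \<omega> p z w) \<and>
        \<omega> p v v = 0 \<and>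
        (v \<noteq> 0 \<longrightarrow> (\<exists>w\<in>tangent_space S p. \<omega> p v w \<noteq> 0))) \<and>
     (\<forall>U \<phi>. local_chart S U \<phi> \<longrightarrow> smooth_on U (density \<omega> \<phi>))"

(* The surface carries the orientation determined by \<omega>. *)
definition oriented_chart ::
  "(real^'m) set \<Rightarrow> (real^'m \<Rightarrow> real^'m \<Rightarrow> real^'m \<Rightarrow> real) \<Rightarrow> (real^2) set
   \<Rightarrow> (real^2 \<Rightarrow> real^'m) \<Rightarrow> bool" where
  "oriented_chart S \<omega> U \<phi> \<longleftrightarrow> local_chart S U \<phi> \<and> (\<forall>u\<in>U. density \<omega> \<phi> u > 0)"

definition poisson ::
  "(real^'m) set \<Rightarrow> (real^'m \<Rightarrow> real^'m \<Rightarrow> real^'m \<Rightarrow> real)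
   \<Rightarrow> (real^'m \<Rightarrow> real) \<Rightarrow> (real^'m \<Rightarrow> real) \<Rightarrow> real^'m \<Rightarrow> real" where
  "poisson S \<omega> f h = chart_value (oriented_chart S \<omega>)
     (\<lambda>\<phi> u. (partial 1 (f \<circ> \<phi>) u * partial 2 (h \<circ> \<phi>) u
            - partial 2 (f \<circ> \<phi>) u * partial 1 (h \<circ> \<phi>) u) / density \<omega> \<phi> u)"

definition gamma_fun ::
  "(real^'m) set \<Rightarrow> (real^'m \<Rightarrow> real^'m \<Rightarrow> real^'m \<Rightarrow> real) \<Rightarrow> real^'m \<Rightarrow> real" where
  "gamma_fun S \<omega> = chart_value (oriented_chart S \<omega>)
     (\<lambda>\<phi> u. sqrt (metric_det \<phi> u) / density \<omega> \<phi> u)"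

(* The integral of the 2-form f \<omega> over the compact oriented surface S, by means of any finite
   smooth partition of unity subordinate to oriented charts. *)
definition surface_integral ::
  "(real^'m) set \<Rightarrow> (real^'m \<Rightarrow> real^'m \<Rightarrow> real^'m \<Rightarrow> real) \<Rightarrow> (real^'m \<Rightarrow> real) \<Rightarrow> real" where
  "surface_integral S \<omega> f = (THE I. \<exists>(n::nat) U \<phi> \<eta>.
     (\<forall>i<n. oriented_chart S \<omega> (U i) (\<phi> i) \<and> \<eta> i \<in> Cinf S \<and> (\<forall>p\<in>S. 0 \<le> \<eta> i p) \<and>
            closure {p\<in>S. \<eta> i p \<noteq> 0} \<subseteq> \<phi> i ` U i) \<and>
     (\<forall>p\<in>S. (\<Sum>i<n. \<eta> i p) = 1) \<and>
     I = (\<Sum>i<n. integral (U i) (\<lambda>u. \<eta> i (\<phi> i u) * f (\<phi> i u) * density \<omega> (\<phi> i) u)))"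

(* \<partial>^{f_1...f_l} (h), where \<partial>^f (h) = {h, f}; the operator of f_l acts first. *)
definition pderivs ::
  "(real^'m) set \<Rightarrow> (real^'m \<Rightarrow> real^'m \<Rightarrow> real^'m \<Rightarrow> real) \<Rightarrow> (real^'m \<Rightarrow> real) list
   \<Rightarrow> (real^'m \<Rightarrow> real) \<Rightarrow> real^'m \<Rightarrow> real" where
  "pderivs S \<omega> fs h = foldr (\<lambda>f h. poisson S \<omega> h f) fs h"

section \<open>Matrices\<close>

definition vnorm :: "complex Matrix.vec \<Rightarrow> real" where
  "vnorm v = sqrt (\<Sum>i<dim_vec v. (cmod (Matrix.vec_index v i))\<^sup>2)"

definition opnorm :: "complex Matrix.mat \<Rightarrow> real" where
  "opnorm A = (SUP v\<in>{v \<in> carrier_vec (dim_col A). vnorm v \<le> 1}. vnorm (A *\<^sub>v v))"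

definition mat_trace :: "'a::comm_monoid_add Matrix.mat \<Rightarrow> 'a" where
  "mat_trace A = (\<Sum>i<dim_row A. A $$ (i, i))"

definition commutator :: "'a::comm_ring_1 Matrix.mat \<Rightarrow> 'a Matrix.mat \<Rightarrow> 'a Matrix.mat" where
  "commutator A B = A * B - B * A"

(* Sum of a family of n x n matrices. *)
definition mat_sum :: "nat \<Rightarrow> 'i set \<Rightarrow> ('i \<Rightarrow> 'a::comm_monoid_add Matrix.mat) \<Rightarrow> 'a Matrix.mat" where
  "mat_sum n I F = Matrix.mat n n (\<lambda>(a, b). \<Sum>i\<in>I. F i $$ (a, b))"

(* Meaningful for invertible matrices only. *)
definition minv :: "'a::field Matrix.mat \<Rightarrow> 'a Matrix.mat" where
  "minv A = the (mat_inverse A)"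

section \<open>Matrix regularizations\<close>

(* The analogue of pderivs for matrices, with H = \<hbar>_\<alpha> and t = T_\<alpha>. *)
definition mderivs ::
  "real \<Rightarrow> ((real^'m \<Rightarrow> real) \<Rightarrow> complex Matrix.mat) \<Rightarrow> (real^'m \<Rightarrow> real) list
   \<Rightarrow> complex Matrix.mat \<Rightarrow> complex Matrix.mat" where
  "mderivs H t fs A =
     foldr (\<lambda>f X. (1 / (\<i> * complex_of_real H)) \<cdot>\<^sub>m commutator X (t f)) fs A"

(* Since functions on S are represented by functions on the ambient space, T \<alpha> is required to
   depend only on the values on S. *)
definition matrix_regularization ::
  "nat \<Rightarrow> (real^'m) set \<Rightarrow> (real^'m \<Rightarrow> real^'m \<Rightarrow> real^'m \<Rightarrow> real) \<Rightarrow> (nat \<Rightarrow> nat)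
   \<Rightarrow> (nat \<Rightarrow> (real^'m \<Rightarrow> real) \<Rightarrow> complex Matrix.mat) \<Rightarrow> (nat \<Rightarrow> real) \<Rightarrow> bool" where
  "matrix_regularization k S \<omega> N T h \<longleftrightarrow>
     strict_mono N \<and> (\<forall>\<alpha>. 0 < N \<alpha>) \<and>
     (\<forall>n\<ge>1. 0 < h n) \<and> (\<forall>n\<ge>1. \<forall>n'\<ge>n. h n' \<le> h n) \<and> convergent (\<lambda>n. real n * h n) \<and>
     (\<forall>\<alpha>. \<forall>f\<in>Cinf S. T \<alpha> f \<in> carrier_mat (N \<alpha>) (N \<alpha>) \<and> mat_adjoint (T \<alpha> f) = T \<alpha> f) \<and>
     (\<forall>\<alpha>. \<forall>f\<in>Cinf S. \<forall>f'\<in>Cinf S. (\<forall>p\<in>S. f p = f' p) \<longrightarrow> T \<alpha> f = T \<alpha> f') \<and>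
     (\<forall>\<alpha>. \<forall>f\<in>Cinf S. \<forall>f'\<in>Cinf S. T \<alpha> (\<lambda>p. f p + f' p) = T \<alpha> f + T \<alpha> f') \<and>
     (\<forall>\<alpha>. \<forall>f\<in>Cinf S. \<forall>c::real. T \<alpha> (\<lambda>p. c * f p) = complex_of_real c \<cdot>\<^sub>m T \<alpha> f) \<and>
     (\<forall>f\<in>Cinf S. convergent (\<lambda>\<alpha>. opnorm (T \<alpha> f))) \<and>
     (\<forall>f\<in>Cinf S. \<forall>f'\<in>Cinf S.
        (\<lambda>\<alpha>. opnorm (T \<alpha> (\<lambda>p. f p * f' p) - T \<alpha> f * T \<alpha> f')) \<longlonglongrightarrow> 0) \<and>
     (\<forall>f\<in>Cinf S. \<forall>fs. set fs \<subseteq> Cinf S \<and> 1 \<le> length fs \<and> length fs \<le> k \<longrightarrow>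
        (\<lambda>\<alpha>. opnorm (mderivs (h (N \<alpha>)) (T \<alpha>) fs (T \<alpha> f) - T \<alpha> (pderivs S \<omega> fs f))) \<longlonglongrightarrow> 0) \<and>
     (\<forall>f\<in>Cinf S. (\<lambda>\<alpha>. complex_of_real (2 * pi * h (N \<alpha>)) * mat_trace (T \<alpha> f))
        \<longlonglongrightarrow> complex_of_real (surface_integral S \<omega> f))"

definition mat_converges ::
  "(real^'m) set \<Rightarrow> (nat \<Rightarrow> nat) \<Rightarrow> (nat \<Rightarrow> (real^'m \<Rightarrow> real) \<Rightarrow> complex Matrix.mat)
   \<Rightarrow> (nat \<Rightarrow> complex Matrix.mat) \<Rightarrow> (real^'m \<Rightarrow> real) \<Rightarrow> bool" where
  "mat_converges S N T F f \<longleftrightarrow>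
     f \<in> Cinf S \<and> (\<forall>\<alpha>. F \<alpha> \<in> carrier_mat (N \<alpha>) (N \<alpha>)) \<and>
     (\<lambda>\<alpha>. opnorm (F \<alpha> - T \<alpha> f)) \<longlonglongrightarrow> 0"

definition mat_Ck_converges ::
  "nat \<Rightarrow> (real^'m) set \<Rightarrow> (real^'m \<Rightarrow> real^'m \<Rightarrow> real^'m \<Rightarrow> real) \<Rightarrow> (nat \<Rightarrow> nat)
   \<Rightarrow> (nat \<Rightarrow> (real^'m \<Rightarrow> real) \<Rightarrow> complex Matrix.mat) \<Rightarrow> (nat \<Rightarrow> real)
   \<Rightarrow> (nat \<Rightarrow> complex Matrix.mat) \<Rightarrow> (real^'m \<Rightarrow> real) \<Rightarrow> bool" where
  "mat_Ck_converges k S \<omega> N T h F f \<longleftrightarrow>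
     mat_converges S N T F f \<and>
     (\<forall>fs. set fs \<subseteq> Cinf S \<and> 1 \<le> length fs \<and> length fs \<le> k \<longrightarrow>
        (\<lambda>\<alpha>. opnorm (mderivs (h (N \<alpha>)) (T \<alpha>) fs (F \<alpha>) - T \<alpha> (pderivs S \<omega> fs f))) \<longlonglongrightarrow> 0)"

end

(* The double brackets {{x^j,x^k},x^l} are computed in a chart: with a, b the first derivatives of the
   embedding and rho the density of omega, {x^j,x^k} = (a_j b_k - b_j a_k) / rho, and summing over the
   indices turns the bracket expression into a polynomial in the inner products of the derivatives of the embedding.
   The terms with derivatives of rho cancel, and what remains is the right-hand side of the Gauss
   equation, so the bracket expression equals the Gaussian curvature in every chart.
   On the matrix side, convergence to functions is compatible with sums, products and adjoints, because
   T_alpha is asymptotically multiplicative, uniformly bounded and hermitian; the powers of hbar turn the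
   double commutators into the second derivations, which converge to the double brackets. *)
theory Submission
  imports Defs
begin

text \<open>The brackets, \<open>gamma_fun\<close> and the curvature are all definite descriptions
  over charts, so none of them can be evaluated before independence of the chart is established.
  Moreover the brackets range over oriented charts and the curvature over all charts, so the chart
  formulas must hold in either orientation. \<open>bracket_curvature\<close>, which is built from
  global functions, serves as the candidate value: agreement with it in each chart gives both the
  chart independence and the smoothness of the curvature.

  The constants 1/2 and 1/4 can be seen where a, b are orthonormal and the second derivatives p, q,
  r of the embedding are normal, with constant density 1. The first sum is then |p + r|^2, the
  second 2 (|p|^2 + 2 |q|^2 + |r|^2), the 2 coming from wedge products summed over ordered index
  pairs. In the combination |p|^2 and |r|^2 cancel and p.r - |q|^2 remains, the determinant of the
  second fundamental form. A double bracket carries rho^(-2), and a factor gamma^(-2) is rho^2 / g,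
  so the two factors exchange the density for the metric determinant.\<close>

section \<open>Calculus of smooth functions\<close>

lemma partial_eqI:
  assumes "(f has_derivative f') (at u)"
  shows "partial a f u = f' (axis a 1)"
  using frechet_derivative_at[OF assms] by (simp add: partial_def)

text \<open>Both functions have the same set of derivatives at \<open>x\<close>, so the choice
  operator inside \<open>frechet_derivative\<close> selects the same map for both, even if that set
  is empty.\<close>

lemma frechet_derivative_cong_open:
  assumes "open U" "x \<in> U" "\<And>y. y \<in> U \<Longrightarrow> f y = g y"
  shows "frechet_derivative f (at x) = frechet_derivative g (at x)"
proof -
  have "(f has_derivative D) (at x) \<longleftrightarrow> (g has_derivative D) (at x)" for D
    using has_derivative_transform_within_open[of f D x UNIV U g]
      has_derivative_transform_within_open[of g D x UNIV U f] assms by auto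
  then show ?thesis by (simp add: frechet_derivative_def)
qed

lemma differentiable_cong_open:
  assumes "open U" "x \<in> U" "\<And>y. y \<in> U \<Longrightarrow> f y = g y" "f differentiable (at x)"
  shows "g differentiable (at x)"
  using has_derivative_transform_within_open[of f _ x UNIV U g] assms
  unfolding differentiable_def by blast

lemma partial_cong_open:
  assumes "open U" "x \<in> U" "\<And>y. y \<in> U \<Longrightarrow> f y = g y"
  shows "partial a f x = partial a g x"
  using frechet_derivative_cong_open[OF assms] by (simp add: partial_def)

lemma Ck_on_cong:
  assumes "open U" "\<And>x. x \<in> U \<Longrightarrow> f x = g x" "Ck_on k U f"
  shows "Ck_on k U g"
  using assms(2,3)
proof (induction k arbitrary: f g)
  case 0
  then show ?case using continuous_on_cong[of U U f g] by simp
next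
  case (Suc k)
  have "frechet_derivative f (at x) v = frechet_derivative g (at x) v" if "x \<in> U" for x v
    using frechet_derivative_cong_open[OF assms(1) that Suc.prems(1)] by simp
  then have "Ck_on k U (\<lambda>x. frechet_derivative g (at x) v)" for v
    using Suc.IH[of "\<lambda>x. frechet_derivative f (at x) v" "\<lambda>x. frechet_derivative g (at x) v"] Suc.prems(2)
    by simp
  moreover have "g differentiable (at x)" if "x \<in> U" for x
    using differentiable_cong_open[OF assms(1) that Suc.prems(1)] Suc.prems(2) that by simp
  ultimately show ?case by simp
qed

lemma Ck_on_Suc_imp_Ck_on: "Ck_on (Suc k) U f \<Longrightarrow> Ck_on k U f"
proof (induction k arbitrary: f)
  case 0
  then show ?case
    by (auto intro!: continuous_at_imp_continuous_on differentiable_imp_continuous_within)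
next
  case (Suc k)
  then show ?case by (metis Ck_on.simps(2))
qed

text \<open>The closure rules are inductions on the order with an explicit formula \<open>D\<close>
  for the derivative; congruence on the open set trades the chosen \<open>frechet_derivative\<close>
  for that formula.\<close>

lemma Ck_on_SucI:
  assumes "open U" "\<And>x. x \<in> U \<Longrightarrow> (f has_derivative D x) (at x)" "\<And>v. Ck_on k U (\<lambda>x. D x v)"
  shows "Ck_on (Suc k) U f"
proof -
  have D: "D x = frechet_derivative f (at x)" if "x \<in> U" for x
    using frechet_derivative_at[OF assms(2)[OF that]] .
  have "Ck_on k U (\<lambda>x. frechet_derivative f (at x) v)" for v
    by (rule Ck_on_cong[OF assms(1) _ assms(3)[of v]]) (simp add: D)
  then show ?thesis using assms(2) by (auto simp: differentiable_def)
qed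

lemma Ck_on_has_derivative:
  assumes "Ck_on (Suc k) U f" "x \<in> U"
  shows "(f has_derivative frechet_derivative f (at x)) (at x)"
  using assms by (simp add: frechet_derivative_works)

lemma Ck_on_const: "open U \<Longrightarrow> Ck_on k U (\<lambda>x. c)"
proof (induction k arbitrary: c)
  case (Suc k)
  show ?case by (rule Ck_on_SucI[where D = "\<lambda>x v. 0"]) (use Suc in auto)
qed simp

lemma Ck_on_bounded_linear:
  assumes "open U" "bounded_linear L" "Ck_on k U f"
  shows "Ck_on k U (\<lambda>x. L (f x))"
  using assms(3)
proof (induction k arbitrary: f)
  case 0
  then show ?case using bounded_linear.continuous_on[OF assms(2)] by simp
next
  case (Suc k)
  show ?case
    by (rule Ck_on_SucI[OF assms(1), where D = "\<lambda>x v. L (frechet_derivative f (at x) v)"])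
      (use Suc Ck_on_has_derivative[OF Suc.prems]
        in \<open>auto intro!: bounded_linear.has_derivative[OF assms(2)]\<close>)
qed

lemma Ck_on_add:
  assumes "open U" "Ck_on k U f" "Ck_on k U g"
  shows "Ck_on k U (\<lambda>x. f x + g x)"
  using assms(2,3)
proof (induction k arbitrary: f g)
  case 0
  then show ?case by (simp add: continuous_on_add)
next
  case (Suc k)
  show ?case
    by (rule Ck_on_SucI[OF assms(1),
          where D = "\<lambda>x v. frechet_derivative f (at x) v + frechet_derivative g (at x) v"])
      (use Suc Ck_on_has_derivative[OF Suc.prems(1)] Ck_on_has_derivative[OF Suc.prems(2)]
        in \<open>auto intro!: has_derivative_add\<close>)
qed

text \<open>Treats products of reals and inner products at once. In the product rule a derivative
  meets an undifferentiated factor, which is lowered by one order to fit the induction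
  hypothesis.\<close>

lemma Ck_on_bounded_bilinear:
  assumes "open U" "bounded_bilinear B" "Ck_on k U f" "Ck_on k U g"
  shows "Ck_on k U (\<lambda>x. B (f x) (g x))"
  using assms(3,4)
proof (induction k arbitrary: f g)
  case 0
  then show ?case using bounded_bilinear.continuous_on[OF assms(2)] by simp
next
  case (Suc k)
  have d: "Ck_on k U (\<lambda>x. frechet_derivative f (at x) v)" "Ck_on k U (\<lambda>x. frechet_derivative g (at x) v)"
    for v using Suc.prems by auto
  note c = Suc.prems[THEN Ck_on_Suc_imp_Ck_on]
  show ?case
    by (rule Ck_on_SucI[OF assms(1), where D = "\<lambda>x v. B (f x) (frechet_derivative g (at x) v)
            + B (frechet_derivative f (at x) v) (g x)"])
      (intro Ck_on_add[OF assms(1)] bounded_bilinear.FDERIV[OF assms(2)] Suc.IH c d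
        Ck_on_has_derivative[OF Suc.prems(1)] Ck_on_has_derivative[OF Suc.prems(2)]; assumption)+
qed

lemma Ck_on_inverse:
  fixes f :: "'a::real_normed_vector \<Rightarrow> real"
  assumes "open U" "Ck_on k U f" "\<And>x. x \<in> U \<Longrightarrow> f x \<noteq> 0"
  shows "Ck_on k U (\<lambda>x. inverse (f x))"
  using assms(2,3)
proof (induction k arbitrary: f)
  case 0
  then show ?case by (auto intro!: continuous_on_inverse)
next
  case (Suc k)
  \<comment> \<open>The derivative of 1/f contains 1/f again, but only to order \<open>k\<close>,
    which is what the induction hypothesis gives.\<close>
  have inv: "Ck_on k U (\<lambda>x. inverse (f x))"
    using Suc.IH[OF Ck_on_Suc_imp_Ck_on[OF Suc.prems(1)] Suc.prems(2)] .
  have d: "Ck_on k U (\<lambda>x. - frechet_derivative f (at x) v)" for v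
    by (rule Ck_on_bounded_linear[OF assms(1) bounded_linear_minus[OF bounded_linear_ident]])
      (use Suc.prems in auto)
  show ?case
  proof (rule Ck_on_SucI[OF assms(1), where D = "\<lambda>x v. - frechet_derivative f (at x) v
            * (inverse (f x) * inverse (f x))"])
    fix x assume x: "x \<in> U"
    show "((\<lambda>x. inverse (f x)) has_derivative
         (\<lambda>v. - frechet_derivative f (at x) v * (inverse (f x) * inverse (f x)))) (at x)"
      using Deriv.has_derivative_inverse[OF Suc.prems(2)[OF x] Ck_on_has_derivative[OF Suc.prems(1) x]]
      by (simp add: mult_ac)
  next
    fix v
    show "Ck_on k U (\<lambda>x. - frechet_derivative f (at x) v * (inverse (f x) * inverse (f x)))"
      by (intro Ck_on_bounded_bilinear[OF assms(1) bounded_bilinear_mult] d inv)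
  qed
qed

text \<open>Serves the exchange of the two coordinates of a chart. Transition maps between charts
  enter only through their derivative at one point.\<close>

lemma Ck_on_compose_linear:
  assumes "open U" "bounded_linear L" "Ck_on k U f"
  shows "Ck_on k (L -` U) (\<lambda>x. f (L x))"
  using assms(3)
proof (induction k arbitrary: f)
  case 0
  then show ?case
    using continuous_on_compose2[of U f "L -` U" L] linear_continuous_on[OF assms(2)] by auto
next
  case (Suc k)
  have op: "open (L -` U)"
    using assms by (intro open_vimage linear_continuous_on) auto
  show ?case
  proof (rule Ck_on_SucI[OF op, where D = "\<lambda>x v. frechet_derivative f (at (L x)) (L v)"])
    fix x assume "x \<in> L -` U"
    then show "((\<lambda>x. f (L x)) has_derivative (\<lambda>v. frechet_derivative f (at (L x)) (L v))) (at x)"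
      using has_derivative_compose[OF bounded_linear_imp_has_derivative[OF assms(2)]
          Ck_on_has_derivative[OF Suc.prems, of "L x"]] by simp
  next
    fix v
    show "Ck_on k (L -` U) (\<lambda>x. frechet_derivative f (at (L x)) (L v))"
      using Suc.IH[of "\<lambda>x. frechet_derivative f (at x) (L v)"] Suc.prems by simp
  qed
qed

lemma Ck_on_subset: "Ck_on k U f \<Longrightarrow> V \<subseteq> U \<Longrightarrow> Ck_on k V f"
  by (induction k arbitrary: f) (auto intro: continuous_on_subset)

lemma smooth_on_cong:
  "open U \<Longrightarrow> (\<And>x. x \<in> U \<Longrightarrow> f x = g x) \<Longrightarrow> smooth_on U f \<Longrightarrow> smooth_on U g"
  using Ck_on_cong unfolding smooth_on_def by blast

lemma smooth_on_differentiable: "smooth_on U f \<Longrightarrow> x \<in> U \<Longrightarrow> f differentiable (at x)"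
  unfolding smooth_on_def by (metis Ck_on.simps(2))

lemma smooth_on_continuous_on: "smooth_on U f \<Longrightarrow> continuous_on U f"
  unfolding smooth_on_def by (metis Ck_on.simps(1))

lemma smooth_on_partial: "smooth_on U f \<Longrightarrow> smooth_on U (partial a f)"
  unfolding smooth_on_def partial_def by (metis Ck_on.simps(2))

lemma smooth_on_const: "open U \<Longrightarrow> smooth_on U (\<lambda>x. c)"
  by (simp add: smooth_on_def Ck_on_const)

lemma smooth_on_bounded_linear:
  "open U \<Longrightarrow> bounded_linear L \<Longrightarrow> smooth_on U f \<Longrightarrow> smooth_on U (\<lambda>x. L (f x))"
  by (simp add: smooth_on_def Ck_on_bounded_linear)

lemma smooth_on_add:
  "open U \<Longrightarrow> smooth_on U f \<Longrightarrow> smooth_on U g \<Longrightarrow> smooth_on U (\<lambda>x. f x + g x)"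
  by (simp add: smooth_on_def Ck_on_add)

lemma smooth_on_mult:
  fixes f g :: "'a::real_normed_vector \<Rightarrow> real"
  shows "open U \<Longrightarrow> smooth_on U f \<Longrightarrow> smooth_on U g \<Longrightarrow> smooth_on U (\<lambda>x. f x * g x)"
  by (simp add: smooth_on_def Ck_on_bounded_bilinear bounded_bilinear_mult)

lemma smooth_on_inner:
  "open U \<Longrightarrow> smooth_on U f \<Longrightarrow> smooth_on U g \<Longrightarrow> smooth_on U (\<lambda>x. inner (f x) (g x))"
  by (simp add: smooth_on_def Ck_on_bounded_bilinear bounded_bilinear_inner)

lemma smooth_on_diff:
  fixes f g :: "'a::real_normed_vector \<Rightarrow> real"
  assumes "open U" "smooth_on U f" "smooth_on U g"
  shows "smooth_on U (\<lambda>x. f x - g x)"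
  using smooth_on_add[OF assms(1,2)
      smooth_on_bounded_linear[OF assms(1) bounded_linear_minus[OF bounded_linear_ident] assms(3)]]
  by simp

lemma smooth_on_divide:
  fixes f g :: "'a::real_normed_vector \<Rightarrow> real"
  assumes "open U" "smooth_on U f" "smooth_on U g" "\<And>x. x \<in> U \<Longrightarrow> g x \<noteq> 0"
  shows "smooth_on U (\<lambda>x. f x / g x)"
proof -
  have "smooth_on U (\<lambda>x. inverse (g x))"
    using assms by (simp add: smooth_on_def Ck_on_inverse)
  then show ?thesis
    unfolding divide_inverse by (rule smooth_on_mult[OF assms(1,2)])
qed

lemma smooth_on_compose_linear:
  "open U \<Longrightarrow> bounded_linear L \<Longrightarrow> smooth_on U f \<Longrightarrow> smooth_on (L -` U) (\<lambda>x. f (L x))"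
  by (simp add: smooth_on_def Ck_on_compose_linear)

lemma smooth_on_subset: "smooth_on U f \<Longrightarrow> V \<subseteq> U \<Longrightarrow> smooth_on V f"
  by (auto simp: smooth_on_def intro: Ck_on_subset)

section \<open>Partial derivatives in the plane\<close>

lemma frechet_derivative_axis:
  fixes f :: "real^2 \<Rightarrow> 'b::real_normed_vector"
  assumes "f differentiable (at u)"
  shows "frechet_derivative f (at u) v = (v $ 1) *\<^sub>R partial 1 f u + (v $ 2) *\<^sub>R partial 2 f u"
proof -
  interpret linear "frechet_derivative f (at u)"
    using assms linear_frechet_derivative by blast
  have v: "v = (v $ 1) *\<^sub>R axis 1 1 + (v $ 2) *\<^sub>R axis 2 1"
    by (simp add: Finite_Cartesian_Product.vec_eq_iff axis_def forall_2)
  show ?thesis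
    by (subst v) (simp only: add scaleR partial_def)
qed

lemma partial_add:
  assumes "f differentiable (at u)" "g differentiable (at u)"
  shows "partial a (\<lambda>x. f x + g x) u = partial a f u + partial a g u"
  using partial_eqI[OF has_derivative_add[OF assms[unfolded frechet_derivative_works]]]
  by (simp add: partial_def)

lemma partial_diff:
  assumes "f differentiable (at u)" "g differentiable (at u)"
  shows "partial a (\<lambda>x. f x - g x) u = partial a f u - partial a g u"
  using partial_eqI[OF has_derivative_diff[OF assms[unfolded frechet_derivative_works]]]
  by (simp add: partial_def)

lemma partial_mult:
  fixes f g :: "real^2 \<Rightarrow> real"
  assumes "f differentiable (at u)" "g differentiable (at u)"
  shows "partial a (\<lambda>x. f x * g x) u = partial a f u * g u + f u * partial a g u"
  using partial_eqI[OF has_derivative_mult[OF assms[unfolded frechet_derivative_works]]]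
  by (simp add: partial_def)

lemma partial_inner:
  assumes "f differentiable (at u)" "g differentiable (at u)"
  shows "partial a (\<lambda>x. inner (f x) (g x)) u = inner (partial a f u) (g u) + inner (f u) (partial a g u)"
  using partial_eqI[OF has_derivative_inner[OF assms[unfolded frechet_derivative_works]]]
  by (simp add: partial_def)

lemma partial_bounded_linear:
  assumes "bounded_linear L" "f differentiable (at u)"
  shows "partial a (\<lambda>x. L (f x)) u = L (partial a f u)"
  using partial_eqI[OF bounded_linear.has_derivative[OF assms(1) assms(2)[unfolded frechet_derivative_works]]]
  by (simp add: partial_def)

lemma partial_divide:
  fixes f g :: "real^2 \<Rightarrow> real"
  assumes "f differentiable (at u)" "g differentiable (at u)" "g u \<noteq> 0"
  shows "partial a (\<lambda>x. f x / g x) u = (partial a f u * g u - f u * partial a g u) / (g u * g u)"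
  using partial_eqI[OF has_derivative_divide'[OF assms(1,2)[unfolded frechet_derivative_works] assms(3)]]
  by (simp add: partial_def)

text \<open>The mean value theorem is used twice: in direction \<open>a\<close> for the difference
  \<open>g\<close> of \<open>f\<close> along two parallel segments, then in direction
  \<open>b\<close> for \<open>partial a f\<close>. The second difference itself is symmetric in
  \<open>a\<close> and \<open>b\<close>, and this symmetry is what makes mixed derivatives
  comparable.\<close>

lemma second_difference_mean_value:
  fixes f :: "real^2 \<Rightarrow> real" and s :: real
  assumes "s > 0"
    and "\<And>x y. 0 \<le> x \<Longrightarrow> x \<le> s \<Longrightarrow> 0 \<le> y \<Longrightarrow> y \<le> s \<Longrightarrow> u + x *\<^sub>R axis a 1 + y *\<^sub>R axis b 1 \<in> U"
    and "smooth_on U f"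
  shows "\<exists>x y. 0 < x \<and> x < s \<and> 0 < y \<and> y < s \<and>
    f (u + s *\<^sub>R axis a 1 + s *\<^sub>R axis b 1) - f (u + s *\<^sub>R axis a 1) - f (u + s *\<^sub>R axis b 1) + f u
      = s * (s * partial b (partial a f) (u + x *\<^sub>R axis a 1 + y *\<^sub>R axis b 1))"
proof -
  have D: "((\<lambda>t. F (w + t *\<^sub>R axis c 1)) has_real_derivative partial c F (w + t *\<^sub>R axis c 1)) (at t)"
    if "F differentiable (at (w + t *\<^sub>R axis c 1))" for F :: "real^2 \<Rightarrow> real" and w t c
  proof -
    let ?D = "frechet_derivative F (at (w + t *\<^sub>R axis c 1))"
    have 1: "((\<lambda>t. w + t *\<^sub>R axis c 1) has_derivative (\<lambda>h. h *\<^sub>R axis c 1)) (at t)"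
      by (auto intro!: derivative_eq_intros)
    have "linear ?D" using that linear_frechet_derivative by blast
    then have "(\<lambda>h. ?D (h *\<^sub>R axis c 1)) = (*) (partial c F (w + t *\<^sub>R axis c 1))"
      by (simp add: fun_eq_iff partial_def linear_cmul)
    then show ?thesis
      using has_derivative_compose[OF 1 that[unfolded frechet_derivative_works]]
      by (simp add: has_field_derivative_def)
  qed
  define g where "g t = f ((u + s *\<^sub>R axis b 1) + t *\<^sub>R axis a 1) - f (u + t *\<^sub>R axis a 1)" for t
  have in1: "(u + s *\<^sub>R axis b 1) + t *\<^sub>R axis a 1 \<in> U" if "0 \<le> t" "t \<le> s" for t
    using assms(2)[of t s] that assms(1) by (simp add: add_ac)
  have in2: "u + t *\<^sub>R axis a 1 \<in> U" if "0 \<le> t" "t \<le> s" for t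
    using assms(2)[of t 0] that assms(1) by simp
  have "\<exists>x. 0 < x \<and> x < s \<and> g s - g 0 = (s - 0) *
     (partial a f ((u + s *\<^sub>R axis b 1) + x *\<^sub>R axis a 1) - partial a f (u + x *\<^sub>R axis a 1))"
    unfolding g_def
    by (intro MVT2[OF assms(1)] DERIV_diff D smooth_on_differentiable[OF assms(3)] in1 in2) auto
  then obtain x where x: "0 < x" "x < s" "g s - g 0 = s *
     (partial a f ((u + s *\<^sub>R axis b 1) + x *\<^sub>R axis a 1) - partial a f (u + x *\<^sub>R axis a 1))"
    by auto
  have "\<exists>y. 0 < y \<and> y < s \<and> partial a f ((u + x *\<^sub>R axis a 1) + s *\<^sub>R axis b 1) -
       partial a f ((u + x *\<^sub>R axis a 1) + 0 *\<^sub>R axis b 1)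
     = (s - 0) * partial b (partial a f) ((u + x *\<^sub>R axis a 1) + y *\<^sub>R axis b 1)"
    using x assms(2)
    by (intro MVT2[OF assms(1)] D smooth_on_differentiable[OF smooth_on_partial[OF assms(3)]]) auto
  then obtain y where y: "0 < y" "y < s" "partial a f ((u + x *\<^sub>R axis a 1) + s *\<^sub>R axis b 1) -
       partial a f (u + x *\<^sub>R axis a 1)
     = s * partial b (partial a f) ((u + x *\<^sub>R axis a 1) + y *\<^sub>R axis b 1)"
    by auto
  show ?thesis
    using x y by (intro exI[of _ x] exI[of _ y]) (auto simp: g_def add_ac)
qed

text \<open>If the mixed derivatives differed at \<open>u\<close>, continuity would separate them on
  a small square at \<open>u\<close>; but the second difference over that square, read in the two
  orders, equates a value of one with a value of the other.\<close>

lemma partial_commute_real: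
  fixes f :: "real^2 \<Rightarrow> real"
  assumes "open U" "smooth_on U f" "u \<in> U"
  shows "partial a (partial b f) u = partial b (partial a f) u"
proof (rule ccontr)
  define A where "A = partial a (partial b f)"
  define B where "B = partial b (partial a f)"
  assume "partial a (partial b f) u \<noteq> partial b (partial a f) u"
  then have ne: "A u \<noteq> B u" by (simp add: A_def B_def)
  \<comment> \<open>Half the gap: the balls of radius \<open>e\<close> about \<open>A u\<close> and
    \<open>B u\<close> are disjoint.\<close>
  define e where "e = \<bar>A u - B u\<bar> / 2"
  have e: "e > 0" using ne by (simp add: e_def)
  have "isCont A u" "isCont B u"
    using assms smooth_on_continuous_on[OF smooth_on_partial[OF smooth_on_partial[OF assms(2)]]]
    by (simp_all add: A_def B_def continuous_on_eq_continuous_at)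
  then obtain d1 d2 where d: "d1 > 0" "\<And>x. dist x u < d1 \<Longrightarrow> dist (A x) (A u) < e"
    "d2 > 0" "\<And>x. dist x u < d2 \<Longrightarrow> dist (B x) (B u) < e"
    using e unfolding continuous_at_eps_delta by metis
  obtain d3 where d3: "d3 > 0" "ball u d3 \<subseteq> U"
    using assms(1,3) open_contains_ball by blast
  \<comment> \<open>Points of the square of side \<open>s\<close> lie within \<open>2 * s\<close> of
    \<open>u\<close>, so a third of the smallest radius keeps them strictly inside all three
    balls.\<close>
  define s where "s = min d1 (min d2 d3) / 3"
  have s: "s > 0" "2 * s < d1" "2 * s < d2" "2 * s < d3" using d d3 by (auto simp: s_def)
  have near: "dist (u + x *\<^sub>R axis i 1 + y *\<^sub>R axis j 1) u \<le> 2 * s"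
    if "0 \<le> x" "x \<le> s" "0 \<le> y" "y \<le> s" for x y :: real and i j :: 2
    using norm_triangle_ineq[of "x *\<^sub>R axis i (1::real)" "y *\<^sub>R axis j 1"] that
    by (simp add: dist_norm add.assoc norm_axis_1)
  have inU: "u + x *\<^sub>R axis i 1 + y *\<^sub>R axis j 1 \<in> U"
    if "0 \<le> x" "x \<le> s" "0 \<le> y" "y \<le> s" for x y :: real and i j :: 2
    using near[OF that, of i j] s d3 by (auto simp: dist_commute subset_iff)
  obtain x y where xy: "0 < x" "x < s" "0 < y" "y < s"
    "f (u + s *\<^sub>R axis a 1 + s *\<^sub>R axis b 1) - f (u + s *\<^sub>R axis a 1) - f (u + s *\<^sub>R axis b 1) + f u
      = s * (s * B (u + x *\<^sub>R axis a 1 + y *\<^sub>R axis b 1))"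
    using second_difference_mean_value[OF s(1) inU assms(2), of a b] unfolding B_def by blast
  obtain z w where zw: "0 < z" "z < s" "0 < w" "w < s"
    "f (u + s *\<^sub>R axis b 1 + s *\<^sub>R axis a 1) - f (u + s *\<^sub>R axis b 1) - f (u + s *\<^sub>R axis a 1) + f u
      = s * (s * A (u + z *\<^sub>R axis b 1 + w *\<^sub>R axis a 1))"
    using second_difference_mean_value[OF s(1) inU assms(2), of b a] unfolding A_def by blast
  have swap: "u + s *\<^sub>R axis b 1 + s *\<^sub>R axis a 1 = u + s *\<^sub>R axis a 1 + s *\<^sub>R axis b 1"
    by (simp add: add_ac)
  have "s * (s * B (u + x *\<^sub>R axis a 1 + y *\<^sub>R axis b 1)) = s * (s * A (u + z *\<^sub>R axis b 1 + w *\<^sub>R axis a 1))"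
    using xy(5) zw(5)[unfolded swap] by linarith
  then have eq: "B (u + x *\<^sub>R axis a 1 + y *\<^sub>R axis b 1) = A (u + z *\<^sub>R axis b 1 + w *\<^sub>R axis a 1)"
    using s(1) by simp
  have "dist (B (u + x *\<^sub>R axis a 1 + y *\<^sub>R axis b 1)) (B u) < e"
    using d(4) near[of x y a b] xy s by fastforce
  moreover have "dist (A (u + z *\<^sub>R axis b 1 + w *\<^sub>R axis a 1)) (A u) < e"
    using d(2) near[of z w b a] zw s by fastforce
  ultimately show False using eq unfolding e_def dist_real_def by argo
qed

lemma partial_component:
  fixes f :: "real^2 \<Rightarrow> real^'m"
  assumes "f differentiable (at u)"
  shows "partial a (\<lambda>x. f x $ i) u = partial a f u $ i"
  by (rule partial_bounded_linear[OF bounded_linear_vec_nth assms])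

lemma partial_commute:
  fixes f :: "real^2 \<Rightarrow> real^'m"
  assumes "open U" "smooth_on U f" "u \<in> U"
  shows "partial a (partial b f) u = partial b (partial a f) u"
proof -
  have "partial c (partial d f) u $ i = partial c (partial d (\<lambda>x. f x $ i)) u" for c d i
  proof -
    have "partial c (partial d f) u $ i = partial c (\<lambda>x. partial d f x $ i) u"
      using partial_component[OF smooth_on_differentiable[OF smooth_on_partial[OF assms(2)] assms(3)]]
      by metis
    also have "\<dots> = partial c (partial d (\<lambda>x. f x $ i)) u"
      by (rule partial_cong_open[OF assms(1,3)])
        (simp add: partial_component smooth_on_differentiable[OF assms(2)])
    finally show ?thesis .
  qed
  moreover have "smooth_on U (\<lambda>x. f x $ i)" for i
    by (rule smooth_on_bounded_linear[OF assms(1) bounded_linear_vec_nth assms(2)])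
  ultimately show ?thesis
    by (simp add: Finite_Cartesian_Product.vec_eq_iff partial_commute_real[OF assms(1) _ assms(3), of _ a b])
qed

section \<open>Change of charts\<close>

text \<open>Near \<open>\<tau> v\<close> the map \<open>G\<close> displaces points almost as the
  identity does, so the increment of \<open>\<tau>\<close> is close to that of \<open>G\<close>
  after \<open>\<tau>\<close>, which has the derivative \<open>H\<close>. Continuity of
  \<open>\<tau>\<close> keeps it in the region where this holds.\<close>

lemma has_derivative_of_section:
  fixes \<tau> :: "'a::real_normed_vector \<Rightarrow> 'b::real_normed_vector"
  assumes G: "(G has_derivative id) (at (\<tau> v))" and cont: "isCont \<tau> v"
    and H: "((\<lambda>w. G (\<tau> w)) has_derivative H) (at v)"
  shows "(\<tau> has_derivative H) (at v)"
  unfolding has_derivative_at_alt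
proof (intro conjI allI impI)
  have Halt: "bounded_linear H" "\<And>e. e > 0 \<Longrightarrow> \<exists>d>0. \<forall>w. norm (w - v) < d \<longrightarrow>
      norm (G (\<tau> w) - G (\<tau> v) - H (w - v)) \<le> e * norm (w - v)"
    using H unfolding has_derivative_at_alt by auto
  show "bounded_linear H" by fact
  obtain B where B: "B > 0" "\<And>x. norm (H x) \<le> norm x * B"
    using bounded_linear.pos_bounded[OF Halt(1)] by blast
  fix e :: real assume "e > 0"
  \<comment> \<open>The bound 1/2 lets \<open>r * norm t\<close> be absorbed, giving
    \<open>norm t \<le> 2 * norm g\<close>. The other bound is fitted to the final estimate, whose
    constant is \<open>r * (2 * B + 2)\<close>.\<close>
  define r where "r = min (1/2) (e / (2 * B + 2))"
  have "r > 0" using \<open>e > 0\<close> B(1) by (simp add: r_def)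
  have "r * (2 * B + 2) \<le> e / (2 * B + 2) * (2 * B + 2)"
    using B(1) by (intro mult_right_mono) (auto simp: r_def)
  then have re: "r * (2 * B + 2) \<le> e" using B(1) by simp
  have r2: "r \<le> 1/2" unfolding r_def by (rule min.cobounded1)
  obtain d1 where d1: "d1 > 0" "\<And>y. norm (y - \<tau> v) < d1 \<Longrightarrow>
      norm (G y - G (\<tau> v) - (y - \<tau> v)) \<le> r * norm (y - \<tau> v)"
    using G \<open>r > 0\<close> unfolding has_derivative_at_alt id_def by meson
  obtain d2 where d2: "d2 > 0" "\<And>w. norm (w - v) < d2 \<Longrightarrow> norm (\<tau> w - \<tau> v) < d1"
    using cont d1(1) unfolding continuous_at_eps_delta dist_norm by meson
  obtain d3 where d3: "d3 > 0" "\<And>w. norm (w - v) < d3 \<Longrightarrow>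
      norm (G (\<tau> w) - G (\<tau> v) - H (w - v)) \<le> r * norm (w - v)"
    using Halt(2)[OF \<open>r > 0\<close>] by blast
  show "\<exists>d>0. \<forall>w. norm (w - v) < d \<longrightarrow> norm (\<tau> w - \<tau> v - H (w - v)) \<le> e * norm (w - v)"
  proof (intro exI[of _ "min d2 d3"] conjI allI impI)
    show "min d2 d3 > 0" using d2 d3 by simp
    fix w assume w: "norm (w - v) < min d2 d3"
    define t g l n where "t = \<tau> w - \<tau> v" and "g = G (\<tau> w) - G (\<tau> v)" and "l = H (w - v)"
      and "n = norm (w - v)"
    have 1: "norm (g - t) \<le> r * norm t" using d1(2) d2(2) w by (simp add: g_def t_def)
    have 2: "norm (g - l) \<le> r * n" using d3(2) w by (simp add: g_def l_def n_def)
    have 3: "norm l \<le> n * B" using B(2) by (simp add: l_def n_def)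
    have n: "n \<ge> 0" by (simp add: n_def)
    have "norm t \<le> norm g + norm (g - t)" by norm
    also have "r * norm t \<le> 1/2 * norm t" using r2 by (intro mult_right_mono) auto
    then have "norm g + norm (g - t) \<le> norm g + norm t / 2" using 1 by simp
    finally have "norm t \<le> 2 * norm g" by simp
    moreover have "norm g \<le> norm l + norm (g - l)" by norm
    moreover have "r * n \<le> 1/2 * n" using r2 n by (intro mult_right_mono) auto
    ultimately have t: "norm t \<le> 2 * (n * B) + n" using 2 3 by linarith
    have "norm (t - l) \<le> norm (g - t) + norm (g - l)" by norm
    also have "\<dots> \<le> r * (2 * (n * B) + n) + r * n"
      using 1 2 t mult_left_mono[OF t, of r] \<open>r > 0\<close> by linarith
    also have "\<dots> = r * (2 * B + 2) * n" by (simp add: algebra_simps)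
    also have "\<dots> \<le> e * n" using re n by (intro mult_right_mono)
    finally show "norm (\<tau> w - \<tau> v - H (w - v)) \<le> e * norm (w - v)"
      by (simp add: t_def l_def n_def)
  qed
qed

lemma local_chartD:
  assumes "local_chart S U \<phi>"
  shows "open U" "smooth_on U \<phi>" "\<And>u. u \<in> U \<Longrightarrow> inj (frechet_derivative \<phi> (at u))"
    "openin (top_of_set S) (\<phi> ` U)" "\<exists>\<psi>. homeomorphism U (\<phi> ` U) \<phi> \<psi>" "\<And>u. u \<in> U \<Longrightarrow> \<phi> u \<in> S"
  using assms openin_imp_subset unfolding local_chart_def by blast+

(* Differentiability of the transition map at the single point v suffices below, so a linear left inverse
   of the derivative of phi replaces the inverse function theorem. *)
lemma chart_transition:
  fixes \<phi> \<psi> :: "real^2 \<Rightarrow> real^'m"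
  assumes \<phi>: "local_chart S U \<phi>" and \<psi>: "local_chart S V \<psi>"
    and u: "u \<in> U" and v: "v \<in> V" and eq: "\<phi> u = \<psi> v"
  shows "\<exists>\<tau> W. open W \<and> v \<in> W \<and> \<tau> v = u \<and> (\<forall>w\<in>W. \<phi> (\<tau> w) = \<psi> w) \<and> \<tau> differentiable (at v)"
proof -
  obtain \<phi>' where \<phi>': "homeomorphism U (\<phi> ` U) \<phi> \<phi>'" using local_chartD(5)[OF \<phi>] by blast
  obtain O' where O': "open O'" "\<phi> ` U = S \<inter> O'"
    using local_chartD(4)[OF \<phi>] unfolding openin_open by blast
  have cont\<psi>: "continuous_on V \<psi>"
    using smooth_on_continuous_on local_chartD(2)[OF \<psi>] by blast
  \<comment> \<open>Relative openness of the image of \<open>\<phi>\<close> makes this an open set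
    which \<open>\<psi>\<close> maps into that image, where the inverse \<open>\<phi>'\<close> of
    the chart is available.\<close>
  define W where "W = V \<inter> \<psi> -` O'"
  have W: "open W" unfolding W_def
    using continuous_open_preimage[OF cont\<psi> local_chartD(1)[OF \<psi>] O'(1)] .
  have \<psi>W: "\<psi> ` W \<subseteq> \<phi> ` U" using O'(2) local_chartD(6)[OF \<psi>] by (auto simp: W_def)
  have "\<psi> v \<in> \<phi> ` U" using u eq by force
  then have vW: "v \<in> W" using v O'(2) by (auto simp: W_def)
  define \<tau> where "\<tau> w = \<phi>' (\<psi> w)" for w
  have \<tau>v: "\<tau> v = u" using \<phi>' u eq by (metis \<tau>_def homeomorphism_apply1)
  have \<tau>: "\<phi> (\<tau> w) = \<psi> w" if "w \<in> W" for w
    using \<phi>' \<psi>W that by (metis \<tau>_def homeomorphism_apply2 image_subset_iff)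
  have "continuous_on W \<tau>" unfolding \<tau>_def
    by (rule continuous_on_compose2[OF homeomorphism_cont2[OF \<phi>'] continuous_on_subset[OF cont\<psi>]])
      (use \<psi>W in \<open>auto simp: W_def\<close>)
  then have cont: "isCont \<tau> v" using W vW by (simp add: continuous_on_eq_continuous_at)
  have d\<phi>: "(\<phi> has_derivative frechet_derivative \<phi> (at u)) (at u)"
    using smooth_on_differentiable[OF local_chartD(2)[OF \<phi>] u] by (simp add: frechet_derivative_works)
  have d\<psi>: "(\<psi> has_derivative frechet_derivative \<psi> (at v)) (at v)"
    using smooth_on_differentiable[OF local_chartD(2)[OF \<psi>] v] by (simp add: frechet_derivative_works)
  obtain L where L: "linear L" "L \<circ> frechet_derivative \<phi> (at u) = id"
    using linear_injective_left_inverse[OF has_derivative_linear[OF d\<phi>] local_chartD(3)[OF \<phi> u]] by blast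
  have bL: "bounded_linear L" using L(1) by (simp add: linear_conv_bounded_linear)
  have G: "((\<lambda>x. L (\<phi> x)) has_derivative id) (at (\<tau> v))"
    using bounded_linear.has_derivative[OF bL d\<phi>] L(2) by (simp add: \<tau>v o_def id_def)
  \<comment> \<open>On \<open>W\<close>, \<open>L\<close> after \<open>\<psi>\<close> is the same as
    \<open>L\<close> after \<open>\<phi>\<close> after \<open>\<tau>\<close>; so the latter
    composite has a known derivative before \<open>\<tau>\<close> is known to be
    differentiable.\<close>
  have "((\<lambda>w. L (\<psi> w)) has_derivative (\<lambda>x. L (frechet_derivative \<psi> (at v) x))) (at v)"
    by (rule bounded_linear.has_derivative[OF bL d\<psi>])
  then have "((\<lambda>w. L (\<phi> (\<tau> w))) has_derivative (\<lambda>x. L (frechet_derivative \<psi> (at v) x))) (at v)"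
    by (rule has_derivative_transform_within_open[OF _ W vW]) (simp add: \<tau>)
  then have "\<tau> differentiable (at v)"
    using has_derivative_of_section[OF G cont] unfolding differentiable_def by blast
  then show ?thesis using W vW \<tau>v \<tau> by blast
qed

lemma Cinf_smooth_on: "f \<in> Cinf S \<Longrightarrow> local_chart S U \<phi> \<Longrightarrow> smooth_on U (f \<circ> \<phi>)"
  by (simp add: Cinf_def)

text \<open>\<open>c\<close> is the Jacobian matrix of the transition map at \<open>v\<close>. That
  one matrix serves the embedding and all smooth functions simultaneously is what allows the
  quotients defining brackets to be compared between charts.\<close>

lemma chart_change:
  fixes \<phi> \<psi> :: "real^2 \<Rightarrow> real^'m"
  assumes \<phi>: "local_chart S U \<phi>" and \<psi>: "local_chart S V \<psi>"
    and u: "u \<in> U" and v: "v \<in> V" and eq: "\<phi> u = \<psi> v"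
  shows "\<exists>c :: 2 \<Rightarrow> 2 \<Rightarrow> real.
    (\<forall>a. partial a \<psi> v = c a 1 *\<^sub>R partial 1 \<phi> u + c a 2 *\<^sub>R partial 2 \<phi> u) \<and>
    (\<forall>f\<in>Cinf S. \<forall>a.
      partial a (f \<circ> \<psi>) v = c a 1 * partial 1 (f \<circ> \<phi>) u + c a 2 * partial 2 (f \<circ> \<phi>) u)"
proof -
  obtain \<tau> W where W: "open W" "v \<in> W" "\<tau> v = u" "\<And>w. w \<in> W \<Longrightarrow> \<phi> (\<tau> w) = \<psi> w"
    "\<tau> differentiable (at v)"
    using chart_transition[OF assms] by blast
  have chain: "partial a F' v = (partial a \<tau> v $ 1) *\<^sub>R partial 1 F u + (partial a \<tau> v $ 2) *\<^sub>R partial 2 F u"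
    if F: "F differentiable (at u)" and F': "\<And>w. w \<in> W \<Longrightarrow> F (\<tau> w) = F' w"
    for F F' :: "real^2 \<Rightarrow> 'b::real_normed_vector" and a
  proof -
    have "((\<lambda>w. F (\<tau> w)) has_derivative
        (\<lambda>x. frechet_derivative F (at u) (frechet_derivative \<tau> (at v) x))) (at v)"
      using has_derivative_compose[OF W(5)[unfolded frechet_derivative_works]] F W(3)
      by (simp add: frechet_derivative_works)
    then have "(F' has_derivative
        (\<lambda>x. frechet_derivative F (at u) (frechet_derivative \<tau> (at v) x))) (at v)"
      by (rule has_derivative_transform_within_open[OF _ W(1,2)]) (simp add: F')
    then show ?thesis
      using partial_eqI frechet_derivative_axis[OF F] by (metis partial_def)
  qed
  show ?thesis
  proof (intro exI[of _ "\<lambda>a b. partial a \<tau> v $ b"] conjI ballI allI)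
    fix a show "partial a \<psi> v = (partial a \<tau> v $ 1) *\<^sub>R partial 1 \<phi> u + (partial a \<tau> v $ 2) *\<^sub>R partial 2 \<phi> u"
      using chain[OF smooth_on_differentiable[OF local_chartD(2)[OF \<phi>] u] W(4)] .
  next
    fix f :: "real^'m \<Rightarrow> real" and a assume "f \<in> Cinf S"
    show "partial a (f \<circ> \<psi>) v = (partial a \<tau> v $ 1) * partial 1 (f \<circ> \<phi>) u
        + (partial a \<tau> v $ 2) * partial 2 (f \<circ> \<phi>) u"
      using chain[OF smooth_on_differentiable[OF Cinf_smooth_on[OF \<open>f \<in> Cinf S\<close> \<phi>] u], of "f \<circ> \<psi>" a] W(4)
      by simp
  qed
qed

lemma partial_in_tangent_space:
  assumes "local_chart S U \<phi>" "u \<in> U"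
  shows "x *\<^sub>R partial 1 \<phi> u + y *\<^sub>R partial 2 \<phi> u \<in> tangent_space S (\<phi> u)"
proof -
  have "x *\<^sub>R partial 1 \<phi> u + y *\<^sub>R partial 2 \<phi> u
      = frechet_derivative \<phi> (at u) (x *\<^sub>R axis 1 1 + y *\<^sub>R axis 2 1)"
    using frechet_derivative_axis[OF smooth_on_differentiable[OF local_chartD(2)[OF assms(1)] assms(2)]]
    by (simp add: axis_def)
  then show ?thesis using assms unfolding tangent_space_def by blast
qed

text \<open>\<open>tangent_space\<close> collects vectors from all charts through the point; the
  change of charts expresses each of them in the frame of the given one.\<close>

lemma tangent_spaceE:
  assumes \<phi>: "local_chart S U \<phi>" "u \<in> U" and w: "w \<in> tangent_space S (\<phi> u)"
  obtains x y where "w = x *\<^sub>R partial 1 \<phi> u + y *\<^sub>R partial 2 \<phi> u"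
proof -
  obtain V \<psi> v z where \<psi>: "local_chart S V \<psi>" "v \<in> V" "\<psi> v = \<phi> u"
    and w: "w = frechet_derivative \<psi> (at v) z"
    using w unfolding tangent_space_def by blast
  obtain c :: "2 \<Rightarrow> 2 \<Rightarrow> real" where c: "\<And>a. partial a \<psi> v = c a 1 *\<^sub>R partial 1 \<phi> u + c a 2 *\<^sub>R partial 2 \<phi> u"
    using chart_change[OF \<phi>(1) \<psi>(1) \<phi>(2) \<psi>(2) \<psi>(3)[symmetric]] by blast
  have "w = (z $ 1 * c 1 1 + z $ 2 * c 2 1) *\<^sub>R partial 1 \<phi> u
          + (z $ 1 * c 1 2 + z $ 2 * c 2 2) *\<^sub>R partial 2 \<phi> u"
    unfolding w frechet_derivative_axis[OF smooth_on_differentiable[OF local_chartD(2)[OF \<psi>(1)] \<psi>(2)]] c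
    by (simp add: algebra_simps)
  then show ?thesis by (rule that)
qed

lemma partial_independent:
  assumes "local_chart S U \<phi>" "u \<in> U" "x *\<^sub>R partial 1 \<phi> u + y *\<^sub>R partial 2 \<phi> u = 0"
  shows "x = 0" "y = 0"
proof -
  have "linear (frechet_derivative \<phi> (at u))"
    using smooth_on_differentiable[OF local_chartD(2)[OF assms(1)] assms(2)] linear_frechet_derivative
    by blast
  moreover have "frechet_derivative \<phi> (at u) (x *\<^sub>R axis 1 1 + y *\<^sub>R axis 2 1) = 0"
    using frechet_derivative_axis[OF smooth_on_differentiable[OF local_chartD(2)[OF assms(1)] assms(2)]]
      assms(3) by (simp add: axis_def)
  ultimately have "x *\<^sub>R axis 1 1 + y *\<^sub>R axis 2 1 = (0 :: real^2)"
    using local_chartD(3)[OF assms(1,2)] by (metis linear_0 injD)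
  then have "(x *\<^sub>R axis 1 1 + y *\<^sub>R axis 2 1 :: real^2) $ i = 0" for i by simp
  from this[of 1] this[of 2] show "x = 0" "y = 0" by (simp_all add: axis_def)
qed

section \<open>The symplectic form and the metric in the frame of a chart\<close>

lemma symplectic_form_combination:
  assumes \<omega>: "symplectic_form S \<omega>" and \<phi>: "local_chart S U \<phi>" "u \<in> U"
  shows "\<omega> (\<phi> u) (a *\<^sub>R partial 1 \<phi> u + b *\<^sub>R partial 2 \<phi> u) (x *\<^sub>R partial 1 \<phi> u + y *\<^sub>R partial 2 \<phi> u)
    = (a * y - b * x) * density \<omega> \<phi> u"
proof -
  let ?p = "\<phi> u" and ?A = "partial 1 \<phi> u" and ?B = "partial 2 \<phi> u"
  have T: "?A \<in> tangent_space S ?p" "?B \<in> tangent_space S ?p"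
    "\<And>x y. x *\<^sub>R ?A + y *\<^sub>R ?B \<in> tangent_space S ?p"
    using partial_in_tangent_space[OF \<phi>, of 1 0] partial_in_tangent_space[OF \<phi>, of 0 1]
      partial_in_tangent_space[OF \<phi>] by simp_all
  have "?p \<in> S" using local_chartD(6) \<phi> by blast
  note sf = bspec[OF conjunct1[OF \<omega>[unfolded symplectic_form_def]] this]
  have bilin: "\<omega> ?p (a *\<^sub>R v + b *\<^sub>R w) z = a * \<omega> ?p v z + b * \<omega> ?p w z"
    "\<omega> ?p z (a *\<^sub>R v + b *\<^sub>R w) = a * \<omega> ?p z v + b * \<omega> ?p z w"
    if "v \<in> tangent_space S ?p" "w \<in> tangent_space S ?p" "z \<in> tangent_space S ?p" for v w z a b
    using bspec[OF bspec[OF conjunct1[OF bspec[OF sf that(1)]] that(2)] that(3)] by simp_all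
  have alt: "\<omega> ?p v v = 0" if "v \<in> tangent_space S ?p" for v
    using bspec[OF sf that] by simp
  \<comment> \<open>Polarization: vanishing on the sum of the frame vectors gives antisymmetry. The
    factors 1 put the arguments into the shape that \<open>bilin\<close> rewrites.\<close>
  have "\<omega> ?p (1 *\<^sub>R ?A + 1 *\<^sub>R ?B) (1 *\<^sub>R ?A + 1 *\<^sub>R ?B) = 0"
    by (rule alt[OF T(3)])
  moreover have "\<omega> ?p (1 *\<^sub>R ?A + 1 *\<^sub>R ?B) (1 *\<^sub>R ?A + 1 *\<^sub>R ?B) = \<omega> ?p ?A ?B + \<omega> ?p ?B ?A"
    using T by (simp only: bilin) (simp add: alt)
  ultimately have "\<omega> ?p ?B ?A = - density \<omega> \<phi> u"
    by (simp add: density_def)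
  then show ?thesis
    using T by (simp only: bilin alt) (simp add: density_def algebra_simps)
qed

lemma smooth_on_density:
  assumes "symplectic_form S \<omega>" "local_chart S U \<phi>"
  shows "smooth_on U (density \<omega> \<phi>)"
  using conjunct2[OF assms(1)[unfolded symplectic_form_def]] assms(2) by blast

text \<open>With zero density the first frame vector would pair to zero with the whole tangent
  plane, against nondegeneracy.\<close>

lemma density_nonzero:
  assumes \<omega>: "symplectic_form S \<omega>" and \<phi>: "local_chart S U \<phi>" "u \<in> U"
  shows "density \<omega> \<phi> u \<noteq> 0"
proof
  assume 0: "density \<omega> \<phi> u = 0"
  have "partial 1 \<phi> u \<noteq> 0" using partial_independent(1)[OF \<phi>, of 1 0] by auto
  moreover have "partial 1 \<phi> u \<in> tangent_space S (\<phi> u)"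
    using partial_in_tangent_space[OF \<phi>, of 1 0] by simp
  ultimately obtain w where w: "w \<in> tangent_space S (\<phi> u)" "\<omega> (\<phi> u) (partial 1 \<phi> u) w \<noteq> 0"
    using bspec[OF bspec[OF conjunct1[OF \<omega>[unfolded symplectic_form_def]] local_chartD(6)[OF \<phi>]]]
    by blast
  obtain x y where "w = x *\<^sub>R partial 1 \<phi> u + y *\<^sub>R partial 2 \<phi> u"
    using tangent_spaceE[OF \<phi> w(1)] by blast
  then show False
    using symplectic_form_combination[OF \<omega> \<phi>, of 1 0 x y] 0 w(2) by simp
qed

lemma density_change:
  fixes c :: "2 \<Rightarrow> 2 \<Rightarrow> real"
  assumes \<omega>: "symplectic_form S \<omega>" and \<phi>: "local_chart S U \<phi>" "u \<in> U"
    and eq: "\<phi> u = \<psi> v"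
    and c: "\<And>a. partial a \<psi> v = c a 1 *\<^sub>R partial 1 \<phi> u + c a 2 *\<^sub>R partial 2 \<phi> u"
  shows "density \<omega> \<psi> v = (c 1 1 * c 2 2 - c 1 2 * c 2 1) * density \<omega> \<phi> u"
  unfolding density_def[of \<omega> \<psi>] c eq[symmetric] by (rule symplectic_form_combination[OF \<omega> \<phi>])

lemma metric_det_eq:
  "metric_det \<phi> u = inner (partial 1 \<phi> u) (partial 1 \<phi> u) * inner (partial 2 \<phi> u) (partial 2 \<phi> u)
    - inner (partial 1 \<phi> u) (partial 2 \<phi> u) * inner (partial 1 \<phi> u) (partial 2 \<phi> u)"
  by (simp add: metric_det_def det_2 metric_def inner_commute[of "partial 2 \<phi> u" "partial 1 \<phi> u"])

text \<open>The vector \<open>inner A A *\<^sub>R B - inner A B *\<^sub>R A\<close> is a positive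
  multiple of the component of \<open>B\<close> orthogonal to \<open>A\<close>. It is nonzero by
  linear independence, and its squared norm is \<open>inner A A\<close> times the
  determinant.\<close>

lemma metric_det_pos:
  assumes "local_chart S U \<phi>" "u \<in> U"
  shows "metric_det \<phi> u > 0"
proof -
  define A B where "A = partial 1 \<phi> u" and "B = partial 2 \<phi> u"
  have "A \<noteq> 0" using partial_independent(1)[OF assms, of 1 0] by (auto simp: A_def)
  then have E: "inner A A > 0" by simp
  have "inner A A *\<^sub>R B - inner A B *\<^sub>R A \<noteq> 0"
    using partial_independent(2)[OF assms, of "- inner A B" "inner A A"] E
    by (auto simp: A_def B_def)
  then have "inner (inner A A *\<^sub>R B - inner A B *\<^sub>R A) (inner A A *\<^sub>R B - inner A B *\<^sub>R A) > 0"
    by simp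
  also have "inner (inner A A *\<^sub>R B - inner A B *\<^sub>R A) (inner A A *\<^sub>R B - inner A B *\<^sub>R A)
     = inner A A * metric_det \<phi> u"
    unfolding metric_det_eq A_def[symmetric] B_def[symmetric]
    by (simp add: inner_diff_left inner_diff_right inner_commute[of B A] right_diff_distrib)
  finally show ?thesis using E by (simp add: zero_less_mult_iff)
qed

text \<open>This is det (C M C^T) = (det C)^2 det M, where C has rows a, b and c, d and M is the
  symmetric matrix of E, F, G.\<close>

lemma gram_determinant_change:
  fixes a b c d E F G :: real
  shows "(a * a * E + (a * b + b * a) * F + b * b * G) * (c * c * E + (c * d + d * c) * F + d * d * G)
    - (a * c * E + (a * d + b * c) * F + b * d * G) * (a * c * E + (a * d + b * c) * F + b * d * G)
    = (a * d - b * c)\<^sup>2 * (E * G - F * F)"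
  by (simp add: power2_eq_square algebra_simps)

lemma metric_det_change:
  fixes c :: "2 \<Rightarrow> 2 \<Rightarrow> real"
  assumes "\<And>a. partial a \<psi> v = c a 1 *\<^sub>R partial 1 \<phi> u + c a 2 *\<^sub>R partial 2 \<phi> u"
  shows "metric_det \<psi> v = (c 1 1 * c 2 2 - c 1 2 * c 2 1)\<^sup>2 * metric_det \<phi> u"
proof -
  define E F G where "E = inner (partial 1 \<phi> u) (partial 1 \<phi> u)"
    and "F = inner (partial 1 \<phi> u) (partial 2 \<phi> u)" and "G = inner (partial 2 \<phi> u) (partial 2 \<phi> u)"
  have i: "inner (partial a \<psi> v) (partial b \<psi> v)
      = c a 1 * c b 1 * E + (c a 1 * c b 2 + c a 2 * c b 1) * F + c a 2 * c b 2 * G" for a b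
    unfolding assms inner_add_left inner_add_right inner_scaleR_left inner_scaleR_right
      inner_commute[of "partial 2 \<phi> u" "partial 1 \<phi> u"] E_def[symmetric] F_def[symmetric] G_def[symmetric]
    by (simp only: algebra_simps)
  show ?thesis
    unfolding metric_det_eq i E_def[symmetric] F_def[symmetric] G_def[symmetric]
    by (rule gram_determinant_change)
qed

section \<open>Oriented charts and Poisson brackets\<close>

lemma local_chart_subset:
  assumes "local_chart S U \<phi>" "open V" "V \<subseteq> U"
  shows "local_chart S V \<phi>"
proof -
  obtain \<phi>' where \<phi>': "homeomorphism U (\<phi> ` U) \<phi> \<phi>'" using local_chartD(5)[OF assms(1)] by blast
  have "openin (top_of_set U) V" using assms by (simp add: openin_open_eq local_chartD(1))
  then have "openin (top_of_set (\<phi> ` U)) (\<phi> ` V)"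
    by (rule homeomorphism_imp_open_map[OF \<phi>'])
  then have "openin (top_of_set S) (\<phi> ` V)"
    by (rule openin_trans[OF _ local_chartD(4)[OF assms(1)]])
  moreover have "homeomorphism V (\<phi> ` V) \<phi> \<phi>'"
    by (rule homeomorphism_of_subsets[OF \<phi>' assms(3)]) auto
  ultimately show ?thesis
    using assms smooth_on_subset[OF local_chartD(2)[OF assms(1)] assms(3)] local_chartD(3)[OF assms(1)]
    unfolding local_chart_def by (meson subsetD)
qed

text \<open>Composition with this reflection reverses the orientation of a chart, which produces an
  oriented chart at points of negative density.\<close>

definition swap_coords :: "real^2 \<Rightarrow> real^2" where
  "swap_coords w = (\<chi> i. if i = 1 then w $ 2 else w $ 1)"

lemma swap_coords_swap_coords [simp]: "swap_coords (swap_coords w) = w"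
  by (simp add: swap_coords_def Finite_Cartesian_Product.vec_eq_iff forall_2)

lemma bounded_linear_swap_coords: "bounded_linear swap_coords"
proof -
  have "linear swap_coords"
    by (rule linearI) (auto simp: swap_coords_def Finite_Cartesian_Product.vec_eq_iff)
  then show ?thesis by (simp add: linear_conv_bounded_linear)
qed

lemma swap_coords_axis: "swap_coords (axis 1 1) = axis 2 1" "swap_coords (axis 2 1) = axis 1 1"
  by (simp_all add: swap_coords_def axis_def Finite_Cartesian_Product.vec_eq_iff forall_2)

lemma local_chart_swap_coords:
  assumes \<phi>: "local_chart S U \<phi>"
  shows "local_chart S (swap_coords -` U) (\<lambda>w. \<phi> (swap_coords w))"
    and "u \<in> U \<Longrightarrow> density \<omega> (\<lambda>w. \<phi> (swap_coords w)) (swap_coords u) = \<omega> (\<phi> u) (partial 2 \<phi> u) (partial 1 \<phi> u)"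
proof -
  have d: "((\<lambda>w. \<phi> (swap_coords w)) has_derivative (\<lambda>x. frechet_derivative \<phi> (at (swap_coords w)) (swap_coords x))) (at w)"
    if "swap_coords w \<in> U" for w
    using has_derivative_compose[OF bounded_linear_imp_has_derivative[OF bounded_linear_swap_coords]
      smooth_on_differentiable[OF local_chartD(2)[OF \<phi>] that, unfolded frechet_derivative_works]] .
  have inj: "inj swap_coords" by (metis injI swap_coords_swap_coords)
  have image: "(\<lambda>w. \<phi> (swap_coords w)) ` (swap_coords -` U) = \<phi> ` U"
    using surj_image_vimage_eq[of swap_coords U] swap_coords_swap_coords
    by (metis image_image surjI)
  obtain \<phi>' where \<phi>': "homeomorphism U (\<phi> ` U) \<phi> \<phi>'" using local_chartD(5)[OF \<phi>] by blast
  have "homeomorphism (swap_coords -` U) U swap_coords swap_coords"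
    by (rule homeomorphismI) (auto intro: linear_continuous_on[OF bounded_linear_swap_coords])
  then have "homeomorphism (swap_coords -` U) (\<phi> ` U) (\<phi> \<circ> swap_coords) (swap_coords \<circ> \<phi>')"
    by (rule homeomorphism_compose[OF _ \<phi>'])
  then have hom: "\<exists>\<psi>. homeomorphism (swap_coords -` U) (\<phi> ` U) (\<lambda>w. \<phi> (swap_coords w)) \<psi>"
    by (auto simp: o_def)
  have "open (swap_coords -` U)"
    using local_chartD(1)[OF \<phi>] by (intro open_vimage linear_continuous_on bounded_linear_swap_coords)
  moreover have "inj (frechet_derivative (\<lambda>w. \<phi> (swap_coords w)) (at w))" if "swap_coords w \<in> U" for w
    using inj_compose[OF local_chartD(3)[OF \<phi> that] inj] frechet_derivative_at[OF d[OF that]]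
    by (simp add: o_def)
  ultimately show "local_chart S (swap_coords -` U) (\<lambda>w. \<phi> (swap_coords w))"
    using smooth_on_compose_linear[OF local_chartD(1)[OF \<phi>] bounded_linear_swap_coords local_chartD(2)[OF \<phi>]]
      local_chartD(4)[OF \<phi>] hom unfolding local_chart_def image by blast
  show "density \<omega> (\<lambda>w. \<phi> (swap_coords w)) (swap_coords u) = \<omega> (\<phi> u) (partial 2 \<phi> u) (partial 1 \<phi> u)"
    if "u \<in> U"
    using partial_eqI[OF d[of "swap_coords u"]] that
    by (simp add: density_def swap_coords_axis partial_def)
qed

text \<open>The domain of a chart may be disconnected and the density may change sign between
  components, so the chart is cut down to the set of positive density, open by continuity.\<close>

lemma oriented_chart_subset:
  assumes \<omega>: "symplectic_form S \<omega>" and \<phi>: "local_chart S U \<phi>"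
  shows "oriented_chart S \<omega> {u\<in>U. density \<omega> \<phi> u > 0} \<phi>"
proof -
  have "open (U \<inter> density \<omega> \<phi> -` {0<..})"
    by (rule continuous_open_preimage[OF smooth_on_continuous_on[OF smooth_on_density[OF \<omega> \<phi>]]
          local_chartD(1)[OF \<phi>] open_greaterThan])
  moreover have "U \<inter> density \<omega> \<phi> -` {0<..} = {u\<in>U. density \<omega> \<phi> u > 0}" by auto
  ultimately have "open {u\<in>U. density \<omega> \<phi> u > 0}" by simp
  then show ?thesis
    unfolding oriented_chart_def using local_chart_subset[OF \<phi>] by auto
qed

text \<open>Provides the witness that \<open>chart_value_eqI\<close> asks for when a description
  ranges over oriented charts.\<close>

lemma ex_oriented_chart:
  assumes \<omega>: "symplectic_form S \<omega>" and \<phi>: "local_chart S U \<phi>" "u \<in> U"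
  shows "\<exists>V \<psi> v. oriented_chart S \<omega> V \<psi> \<and> v \<in> V \<and> \<psi> v = \<phi> u"
proof (cases "density \<omega> \<phi> u > 0")
  case True
  then show ?thesis
    by (intro exI[of _ "{u\<in>U. density \<omega> \<phi> u > 0}"] exI[of _ \<phi>] exI[of _ u])
      (simp add: oriented_chart_subset[OF \<omega> \<phi>(1)] \<phi>(2))
next
  case False
  then have neg: "density \<omega> \<phi> u < 0" using density_nonzero[OF \<omega> \<phi>] by simp
  have "\<omega> (\<phi> u) (partial 2 \<phi> u) (partial 1 \<phi> u) = - density \<omega> \<phi> u"
    using symplectic_form_combination[OF \<omega> \<phi>, of 0 1 1 0] by simp
  then have "density \<omega> (\<lambda>w. \<phi> (swap_coords w)) (swap_coords u) > 0"
    using local_chart_swap_coords(2)[OF \<phi>] neg by simp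
  then show ?thesis
    using oriented_chart_subset[OF \<omega> local_chart_swap_coords(1)[OF \<phi>(1)]] \<phi>(2)
    by (intro exI[of _ "{w\<in>swap_coords -` U. density \<omega> (\<lambda>w. \<phi> (swap_coords w)) w > 0}"]
          exI[of _ "\<lambda>w. \<phi> (swap_coords w)"] exI[of _ "swap_coords u"])
      simp
qed

text \<open>The chart \<open>\<psi>\<close> through \<open>p\<close> gives uniqueness; if no chart
  reached \<open>p\<close>, every \<open>r\<close> would satisfy the description vacuously.\<close>

lemma chart_value_eqI:
  assumes "\<And>U \<phi> u. C U \<phi> \<Longrightarrow> u \<in> U \<Longrightarrow> \<phi> u = p \<Longrightarrow> F \<phi> u = r"
    and "C V \<psi>" "v \<in> V" "\<psi> v = p"
  shows "chart_value C F p = r"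
  unfolding chart_value_def by (rule the_equality) (use assms in blast)+

text \<open>Numerator and density are both multiplied by the Jacobian determinant of a change of
  charts. The quotient is therefore insensitive to its sign, and the formula extends from oriented
  charts to all charts.\<close>

lemma poisson_chart:
  assumes \<omega>: "symplectic_form S \<omega>" and \<phi>: "local_chart S U \<phi>" "u \<in> U"
    and f: "f \<in> Cinf S" and h: "h \<in> Cinf S"
  shows "poisson S \<omega> f h (\<phi> u) = (partial 1 (f \<circ> \<phi>) u * partial 2 (h \<circ> \<phi>) u
            - partial 2 (f \<circ> \<phi>) u * partial 1 (h \<circ> \<phi>) u) / density \<omega> \<phi> u"
proof -
  obtain V \<psi> v where o: "oriented_chart S \<omega> V \<psi>" "v \<in> V" "\<psi> v = \<phi> u"
    using ex_oriented_chart[OF \<omega> \<phi>] by blast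
  show ?thesis unfolding poisson_def
  proof (rule chart_value_eqI[where C = "oriented_chart S \<omega>" and V = V and \<psi> = \<psi> and v = v, OF _ o])
    fix V \<psi> v assume o: "oriented_chart S \<omega> V \<psi>" and v: "v \<in> V" and eq: "\<psi> v = \<phi> u"
    then have \<psi>: "local_chart S V \<psi>" by (simp add: oriented_chart_def)
    obtain c :: "2 \<Rightarrow> 2 \<Rightarrow> real" where c: "\<And>a. partial a \<psi> v = c a 1 *\<^sub>R partial 1 \<phi> u + c a 2 *\<^sub>R partial 2 \<phi> u"
      and cf: "\<And>f a. f \<in> Cinf S \<Longrightarrow>
        partial a (f \<circ> \<psi>) v = c a 1 * partial 1 (f \<circ> \<phi>) u + c a 2 * partial 2 (f \<circ> \<phi>) u"
      using chart_change[OF \<phi>(1) \<psi> \<phi>(2) v eq[symmetric]] by metis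
    have "density \<omega> \<psi> v = (c 1 1 * c 2 2 - c 1 2 * c 2 1) * density \<omega> \<phi> u"
      by (rule density_change[OF \<omega> \<phi> eq[symmetric] c])
    moreover have "density \<omega> \<psi> v \<noteq> 0" "density \<omega> \<phi> u \<noteq> 0"
      using density_nonzero[OF \<omega>] \<psi> v \<phi> by blast+
    ultimately show "(partial 1 (f \<circ> \<psi>) v * partial 2 (h \<circ> \<psi>) v
            - partial 2 (f \<circ> \<psi>) v * partial 1 (h \<circ> \<psi>) v) / density \<omega> \<psi> v =
         (partial 1 (f \<circ> \<phi>) u * partial 2 (h \<circ> \<phi>) u
            - partial 2 (f \<circ> \<phi>) u * partial 1 (h \<circ> \<phi>) u) / density \<omega> \<phi> u"
      by (simp add: cf f h frac_eq_eq) (simp add: algebra_simps)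
  qed
qed

(* Unlike the defining quotient, the right-hand side does not change sign with the orientation, so it
   is valid in every chart. *)
lemma gamma_fun_chart:
  assumes \<omega>: "symplectic_form S \<omega>" and \<phi>: "local_chart S U \<phi>" "u \<in> U"
  shows "gamma_fun S \<omega> (\<phi> u) = sqrt (metric_det \<phi> u / (density \<omega> \<phi> u)\<^sup>2)"
proof -
  obtain V \<psi> v where o: "oriented_chart S \<omega> V \<psi>" "v \<in> V" "\<psi> v = \<phi> u"
    using ex_oriented_chart[OF \<omega> \<phi>] by blast
  show ?thesis unfolding gamma_fun_def
  proof (rule chart_value_eqI[where C = "oriented_chart S \<omega>" and V = V and \<psi> = \<psi> and v = v, OF _ o])
    fix V \<psi> v assume o: "oriented_chart S \<omega> V \<psi>" and v: "v \<in> V" and eq: "\<psi> v = \<phi> u"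
    then have \<psi>: "local_chart S V \<psi>" and pos: "density \<omega> \<psi> v > 0" by (simp_all add: oriented_chart_def)
    obtain c :: "2 \<Rightarrow> 2 \<Rightarrow> real" where c: "\<And>a. partial a \<psi> v = c a 1 *\<^sub>R partial 1 \<phi> u + c a 2 *\<^sub>R partial 2 \<phi> u"
      using chart_change[OF \<phi>(1) \<psi> \<phi>(2) v eq[symmetric]] by metis
    let ?d = "c 1 1 * c 2 2 - c 1 2 * c 2 1"
    have d: "density \<omega> \<psi> v = ?d * density \<omega> \<phi> u"
      by (rule density_change[OF \<omega> \<phi> eq[symmetric] c])
    then have "?d \<noteq> 0" using pos by auto
    have "sqrt (metric_det \<psi> v) / density \<omega> \<psi> v = sqrt (metric_det \<psi> v / (density \<omega> \<psi> v)\<^sup>2)"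
      using pos by (simp add: real_sqrt_divide)
    also have "metric_det \<psi> v / (density \<omega> \<psi> v)\<^sup>2 = metric_det \<phi> u / (density \<omega> \<phi> u)\<^sup>2"
      unfolding d metric_det_change[OF c] using \<open>?d \<noteq> 0\<close> by (simp add: power_mult_distrib)
    finally show "sqrt (metric_det \<psi> v) / density \<omega> \<psi> v = sqrt (metric_det \<phi> u / (density \<omega> \<phi> u)\<^sup>2)" .
  qed
qed

section \<open>The algebra of smooth functions on the surface\<close>

lemma CinfI: "(\<And>U \<phi>. local_chart S U \<phi> \<Longrightarrow> smooth_on U (\<lambda>u. f (\<phi> u))) \<Longrightarrow> f \<in> Cinf S"
  by (simp add: Cinf_def o_def)

lemma CinfD: "f \<in> Cinf S \<Longrightarrow> local_chart S U \<phi> \<Longrightarrow> smooth_on U (\<lambda>u. f (\<phi> u))"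
  using Cinf_smooth_on by (simp add: o_def)

lemma Cinf_add: "f \<in> Cinf S \<Longrightarrow> h \<in> Cinf S \<Longrightarrow> (\<lambda>p. f p + h p) \<in> Cinf S"
  by (rule CinfI, rule smooth_on_add[OF local_chartD(1)]) (simp_all add: CinfD)

lemma Cinf_mult: "f \<in> Cinf S \<Longrightarrow> h \<in> Cinf S \<Longrightarrow> (\<lambda>p. f p * h p) \<in> Cinf S"
  by (rule CinfI, rule smooth_on_mult[OF local_chartD(1)]) (simp_all add: CinfD)

lemma Cinf_const: "(\<lambda>p. c) \<in> Cinf S"
  by (rule CinfI, rule smooth_on_const[OF local_chartD(1)])

lemma Cinf_component: "(\<lambda>p. p $ i) \<in> Cinf S"
  by (rule CinfI, rule smooth_on_bounded_linear[OF local_chartD(1) bounded_linear_vec_nth local_chartD(2)])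

lemma Cinf_cong:
  assumes "f \<in> Cinf S" "\<And>p. p \<in> S \<Longrightarrow> f p = h p"
  shows "h \<in> Cinf S"
proof (rule CinfI)
  fix U \<phi> assume \<phi>: "local_chart S U \<phi>"
  show "smooth_on U (\<lambda>u. h (\<phi> u))"
    by (rule smooth_on_cong[OF local_chartD(1)[OF \<phi>] _ CinfD[OF assms(1) \<phi>]])
      (simp add: assms(2) local_chartD(6)[OF \<phi>])
qed

lemma Cinf_poisson:
  assumes \<omega>: "symplectic_form S \<omega>" and f: "f \<in> Cinf S" and h: "h \<in> Cinf S"
  shows "poisson S \<omega> f h \<in> Cinf S"
proof (rule CinfI)
  fix U \<phi> assume \<phi>: "local_chart S U \<phi>"
  have o: "open U" by (rule local_chartD(1)[OF \<phi>])
  have "smooth_on U (\<lambda>u. (partial 1 (f \<circ> \<phi>) u * partial 2 (h \<circ> \<phi>) u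
            - partial 2 (f \<circ> \<phi>) u * partial 1 (h \<circ> \<phi>) u) / density \<omega> \<phi> u)"
    using density_nonzero[OF \<omega> \<phi>] smooth_on_density[OF \<omega> \<phi>]
    by (intro smooth_on_divide smooth_on_diff smooth_on_mult smooth_on_partial
        Cinf_smooth_on[OF f \<phi>] Cinf_smooth_on[OF h \<phi>] o) auto
  then show "smooth_on U (\<lambda>u. poisson S \<omega> f h (\<phi> u))"
    by (rule smooth_on_cong[OF o, rotated]) (simp add: poisson_chart[OF \<omega> \<phi> _ f h])
qed

section \<open>The Gauss equation in a chart\<close>

text \<open>\<open>matrix_inv\<close> is a choice, so its entries are solved by Cramer's rule from
  the four scalar equations in \<open>B ** A = 1\<close>.\<close>

lemma matrix_inv_2:
  fixes A :: "real^2^2"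
  assumes "Determinants.det A \<noteq> 0"
  shows "matrix_inv A $ 1 $ 1 = A $ 2 $ 2 / Determinants.det A"
    "matrix_inv A $ 1 $ 2 = - A $ 1 $ 2 / Determinants.det A"
    "matrix_inv A $ 2 $ 1 = - A $ 2 $ 1 / Determinants.det A"
    "matrix_inv A $ 2 $ 2 = A $ 1 $ 1 / Determinants.det A"
proof -
  have inv: "invertible A" using assms by (simp add: invertible_det_nz)
  define d where "d = Determinants.det A"
  have d: "d = A $ 1 $ 1 * A $ 2 $ 2 - A $ 1 $ 2 * A $ 2 $ 1" "d \<noteq> 0"
    using assms by (simp_all add: d_def det_2)
  define B where "B = matrix_inv A"
  have "B ** A = Finite_Cartesian_Product.mat 1"
    using inv someI_ex[of "\<lambda>B. A ** B = Finite_Cartesian_Product.mat 1 \<and> B ** A = Finite_Cartesian_Product.mat 1"]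
    unfolding B_def matrix_inv_def invertible_def by blast
  then have e: "(B ** A) $ i $ j = Finite_Cartesian_Product.mat 1 $ i $ j" for i j by simp
  have "B $ i $ 1 * A $ 1 $ j + B $ i $ 2 * A $ 2 $ j = (if i = j then 1 else 0)" for i j
    using e[of i j] by (simp add: matrix_matrix_mult_def sum_2 Finite_Cartesian_Product.mat_def)
  from this[of 1 1] this[of 1 2] this[of 2 1] this[of 2 2]
  have s: "B $ 1 $ 1 * A $ 1 $ 1 + B $ 1 $ 2 * A $ 2 $ 1 = 1"
    "B $ 1 $ 1 * A $ 1 $ 2 + B $ 1 $ 2 * A $ 2 $ 2 = 0"
    "B $ 2 $ 1 * A $ 1 $ 1 + B $ 2 $ 2 * A $ 2 $ 1 = 0"
    "B $ 2 $ 1 * A $ 1 $ 2 + B $ 2 $ 2 * A $ 2 $ 2 = 1" by simp_all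
  have "B $ 1 $ 1 * d = (B $ 1 $ 1 * A $ 1 $ 1 + B $ 1 $ 2 * A $ 2 $ 1) * A $ 2 $ 2
      - (B $ 1 $ 1 * A $ 1 $ 2 + B $ 1 $ 2 * A $ 2 $ 2) * A $ 2 $ 1"
    "B $ 1 $ 2 * d = (B $ 1 $ 1 * A $ 1 $ 2 + B $ 1 $ 2 * A $ 2 $ 2) * A $ 1 $ 1
      - (B $ 1 $ 1 * A $ 1 $ 1 + B $ 1 $ 2 * A $ 2 $ 1) * A $ 1 $ 2"
    "B $ 2 $ 1 * d = (B $ 2 $ 1 * A $ 1 $ 1 + B $ 2 $ 2 * A $ 2 $ 1) * A $ 2 $ 2
      - (B $ 2 $ 1 * A $ 1 $ 2 + B $ 2 $ 2 * A $ 2 $ 2) * A $ 2 $ 1"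
    "B $ 2 $ 2 * d = (B $ 2 $ 1 * A $ 1 $ 2 + B $ 2 $ 2 * A $ 2 $ 2) * A $ 1 $ 1
      - (B $ 2 $ 1 * A $ 1 $ 1 + B $ 2 $ 2 * A $ 2 $ 1) * A $ 1 $ 2"
    unfolding d(1) by (simp_all only: algebra_simps)
  then have "B $ 1 $ 1 * d = A $ 2 $ 2" "B $ 1 $ 2 * d = - A $ 1 $ 2"
    "B $ 2 $ 1 * d = - A $ 2 $ 1" "B $ 2 $ 2 * d = A $ 1 $ 1"
    unfolding s by simp_all
  then show "matrix_inv A $ 1 $ 1 = A $ 2 $ 2 / Determinants.det A"
    "matrix_inv A $ 1 $ 2 = - A $ 1 $ 2 / Determinants.det A"
    "matrix_inv A $ 2 $ 1 = - A $ 2 $ 1 / Determinants.det A"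
    "matrix_inv A $ 2 $ 2 = A $ 1 $ 1 / Determinants.det A"
    using d(2) unfolding B_def[symmetric] d_def[symmetric] by (simp_all only: nonzero_eq_divide_eq[OF d(2)])
qed

lemma metric_derivative:
  fixes \<phi> :: "real^2 \<Rightarrow> real^'m"
  assumes "smooth_on U \<phi>" "u \<in> U"
  shows "partial c (\<lambda>w. metric \<phi> w $ a $ b) u
    = inner (partial c (partial a \<phi>) u) (partial b \<phi> u) + inner (partial a \<phi> u) (partial c (partial b \<phi>) u)"
  by (simp add: metric_def partial_inner[OF smooth_on_differentiable[OF smooth_on_partial[OF assms(1)] assms(2)]
        smooth_on_differentiable[OF smooth_on_partial[OF assms(1)] assms(2)]])

text \<open>For a metric induced by an embedding, the product rule and the symmetry of second
  derivatives collapse the three metric derivatives to a single inner product, so that each symbol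
  is a projection of a second derivative onto the frame.\<close>

lemma christoffel_eq:
  fixes \<phi> :: "real^2 \<Rightarrow> real^'m"
  assumes U: "open U" and \<phi>: "smooth_on U \<phi>" and u: "u \<in> U"
  shows "christoffel \<phi> d a b u =
    (\<Sum>e\<in>UNIV. matrix_inv (metric \<phi> u) $ d $ e * inner (partial e \<phi> u) (partial a (partial b \<phi>) u))"
proof -
  have "partial a (\<lambda>w. metric \<phi> w $ e $ b) u + partial b (\<lambda>w. metric \<phi> w $ e $ a) u
        - partial e (\<lambda>w. metric \<phi> w $ a $ b) u
     = 2 * inner (partial e \<phi> u) (partial a (partial b \<phi>) u)" for e
    unfolding metric_derivative[OF \<phi> u] partial_commute[OF U \<phi> u, of b a]
      partial_commute[OF U \<phi> u, of e a] partial_commute[OF U \<phi> u, of e b]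
    by (simp add: inner_commute)
  then show ?thesis unfolding christoffel_def by simp
qed

lemma christoffel_components:
  fixes \<phi> :: "real^2 \<Rightarrow> real^'m"
  assumes U: "open U" and \<phi>: "smooth_on U \<phi>" and u: "u \<in> U" and D: "metric_det \<phi> u \<noteq> 0"
  defines "A \<equiv> partial 1 \<phi> u" and "B \<equiv> partial 2 \<phi> u"
  shows "christoffel \<phi> 1 a b u = (inner B B * inner A (partial a (partial b \<phi>) u)
            - inner A B * inner B (partial a (partial b \<phi>) u)) / metric_det \<phi> u"
    and "christoffel \<phi> 2 a b u = (inner A A * inner B (partial a (partial b \<phi>) u)
            - inner A B * inner A (partial a (partial b \<phi>) u)) / metric_det \<phi> u"
  using matrix_inv_2[OF D[unfolded metric_det_def], folded metric_det_def]
  by (simp_all add: christoffel_eq[OF U \<phi> u] sum_2 metric_def A_def B_def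
      inner_commute[of "partial 2 \<phi> u" "partial 1 \<phi> u"] diff_divide_distrib)

text \<open>The right-hand side is the metric determinant times the determinant of the second
  fundamental form, with the tangential parts of p, q, r subtracted and denominators cleared. The
  index of the Christoffel symbols is lowered before differentiating, which avoids derivatives of
  the inverse metric: the lowered symbols are inner products with
  \<open>partial 1 \<phi>\<close>.\<close>

lemma gauss_equation:
  fixes \<phi> :: "real^2 \<Rightarrow> real^'m"
  assumes U: "open U" and \<phi>: "smooth_on U \<phi>" and u: "u \<in> U"
    and D: "\<And>w. w \<in> U \<Longrightarrow> metric_det \<phi> w \<noteq> 0"
  defines "a \<equiv> partial 1 \<phi> u" and "b \<equiv> partial 2 \<phi> u"
    and "p \<equiv> partial 1 (partial 1 \<phi>) u" and "q \<equiv> partial 1 (partial 2 \<phi>) u"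
    and "r \<equiv> partial 2 (partial 2 \<phi>) u"
  shows "(\<Sum>d\<in>UNIV. metric \<phi> u $ 1 $ d * riemann \<phi> d 2 1 2 u) * metric_det \<phi> u
    = metric_det \<phi> u * (inner p r - inner q q)
      - inner a p * (inner b b * inner a r - inner a b * inner b r)
      - inner b p * (inner a a * inner b r - inner a b * inner a r)
      + inner a q * (inner b b * inner a q - inner a b * inner b q)
      + inner b q * (inner a a * inner b q - inner a b * inner a q)"
proof -
  note diff = smooth_on_differentiable[OF _ u]
  have s1: "smooth_on U (partial i \<phi>)" for i by (rule smooth_on_partial[OF \<phi>])
  have s2: "smooth_on U (partial i (partial j \<phi>))" for i j by (rule smooth_on_partial[OF s1])
  have sD: "smooth_on U (metric_det \<phi>)"
    unfolding metric_det_eq by (intro smooth_on_diff smooth_on_mult smooth_on_inner s1 U)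
  \<comment> \<open>Smoothness is read off the explicit quotients; the definition contains
    \<open>matrix_inv\<close>, which has no ready smoothness rule here.\<close>
  have sG: "smooth_on U (christoffel \<phi> d i j)" for d i j
  proof -
    have "smooth_on U (christoffel \<phi> 1 i j)"
      by (rule smooth_on_cong[OF U christoffel_components(1)[OF U \<phi> _ D, symmetric]])
        (auto intro!: smooth_on_divide smooth_on_diff smooth_on_mult smooth_on_inner s1 s2 sD U D)
    moreover have "smooth_on U (christoffel \<phi> 2 i j)"
      by (rule smooth_on_cong[OF U christoffel_components(2)[OF U \<phi> _ D, symmetric]])
        (auto intro!: smooth_on_divide smooth_on_diff smooth_on_mult smooth_on_inner s1 s2 sD U D)
    ultimately show ?thesis using exhaust_2[of d] by auto
  qed
  have low: "metric \<phi> w $ 1 $ 1 * christoffel \<phi> 1 i j w + metric \<phi> w $ 1 $ 2 * christoffel \<phi> 2 i j w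
     = inner (partial 1 \<phi> w) (partial i (partial j \<phi>) w)" if w: "w \<in> U" for i j w
  proof -
    let ?A = "partial 1 \<phi> w" and ?B = "partial 2 \<phi> w" and ?R = "partial i (partial j \<phi>) w"
    have "inner ?A ?A * (inner ?B ?B * inner ?A ?R - inner ?A ?B * inner ?B ?R)
        + inner ?A ?B * (inner ?A ?A * inner ?B ?R - inner ?A ?B * inner ?A ?R)
        = metric_det \<phi> w * inner ?A ?R"
      unfolding metric_det_eq by (simp add: algebra_simps)
    then show ?thesis
      using D[OF w] unfolding christoffel_components[OF U \<phi> w D[OF w]]
      by (simp add: metric_def add_divide_distrib[symmetric])
  qed
  define E F where "E = inner a a" and "F = inner a b"
  have EF: "metric \<phi> u $ 1 $ 1 = E" "metric \<phi> u $ 1 $ 2 = F"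
    by (simp_all add: metric_def E_def F_def a_def b_def)
  have sm: "smooth_on U (\<lambda>w. metric \<phi> w $ i $ j)" for i j
    unfolding metric_def by (simp add: smooth_on_inner[OF U s1 s1])
  have dlow: "partial c (\<lambda>w. metric \<phi> w $ 1 $ 1) u * christoffel \<phi> 1 i j u + E * partial c (christoffel \<phi> 1 i j) u
      + (partial c (\<lambda>w. metric \<phi> w $ 1 $ 2) u * christoffel \<phi> 2 i j u + F * partial c (christoffel \<phi> 2 i j) u)
     = inner (partial c (partial 1 \<phi>) u) (partial i (partial j \<phi>) u)
       + inner a (partial c (partial i (partial j \<phi>)) u)" for c i j
  proof -
    have "partial c (\<lambda>w. metric \<phi> w $ 1 $ 1 * christoffel \<phi> 1 i j w + metric \<phi> w $ 1 $ 2 * christoffel \<phi> 2 i j w) u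
       = partial c (\<lambda>w. inner (partial 1 \<phi> w) (partial i (partial j \<phi>) w)) u"
      by (rule partial_cong_open[OF U u low])
    moreover have "partial c (\<lambda>w. metric \<phi> w $ 1 $ 1 * christoffel \<phi> 1 i j w + metric \<phi> w $ 1 $ 2 * christoffel \<phi> 2 i j w) u
      = partial c (\<lambda>w. metric \<phi> w $ 1 $ 1 * christoffel \<phi> 1 i j w) u
        + partial c (\<lambda>w. metric \<phi> w $ 1 $ 2 * christoffel \<phi> 2 i j w) u"
      by (rule partial_add; rule diff; rule smooth_on_mult[OF U sm sG])
    ultimately show ?thesis
      by (simp add: partial_mult[OF diff[OF sm] diff[OF sG]] partial_inner[OF diff[OF s1] diff[OF s2]]
          EF a_def)
  qed
  have c21: "partial 2 (partial 1 \<phi>) u = q"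
    unfolding q_def by (rule partial_commute[OF U \<phi> u])
  \<comment> \<open>The third derivatives of \<open>\<phi>\<close> enter the curvature only through
    these two vectors; their equality makes \<open>t\<close> common to \<open>d1\<close> and
    \<open>d2\<close>, where it cancels.\<close>
  have c3: "partial 1 (partial 2 (partial 2 \<phi>)) u = partial 2 (partial 1 (partial 2 \<phi>)) u"
    by (rule partial_commute[OF U s1 u])
  define X1 X2 Y1 Y2 Z1 Z2 where "X1 = christoffel \<phi> 1 2 2 u" and "X2 = christoffel \<phi> 2 2 2 u"
    and "Y1 = christoffel \<phi> 1 1 2 u" and "Y2 = christoffel \<phi> 2 1 2 u"
    and "Z1 = christoffel \<phi> 1 1 1 u" and "Z2 = christoffel \<phi> 2 1 1 u"
  note XYZ = X1_def[symmetric] X2_def[symmetric] Y1_def[symmetric] Y2_def[symmetric]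
    Z1_def[symmetric] Z2_def[symmetric]
  have Y': "christoffel \<phi> d 2 1 u = christoffel \<phi> d 1 2 u" for d
    using c21 by (simp add: christoffel_eq[OF U \<phi> u] q_def)
  define x1 x2 y1 y2 where "x1 = partial 1 (christoffel \<phi> 1 2 2) u"
    and "x2 = partial 1 (christoffel \<phi> 2 2 2) u" and "y1 = partial 2 (christoffel \<phi> 1 1 2) u"
    and "y2 = partial 2 (christoffel \<phi> 2 1 2) u"
  define t where "t = inner a (partial 2 (partial 1 (partial 2 \<phi>)) u)"
  define m where "m = metric_det \<phi> u"
  have m: "m \<noteq> 0" using D[OF u] by (simp add: m_def)
  have d1: "2 * inner a p * X1 + E * x1 + ((inner b p + inner a q) * X2 + F * x2) = inner p r + t"
    using dlow[of 1 2 2] unfolding metric_derivative[OF \<phi> u]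
    by (simp add: X1_def X2_def x1_def x2_def p_def q_def r_def a_def b_def t_def c3 inner_commute)
  have d2: "2 * inner a q * Y1 + E * y1 + ((inner b q + inner a r) * Y2 + F * y2) = inner q q + t"
    using dlow[of 2 1 2] unfolding metric_derivative[OF \<phi> u] c21
    by (simp add: Y1_def Y2_def y1_def y2_def q_def r_def a_def b_def t_def inner_commute)
  have l: "E * X1 + F * X2 = inner a r" "E * Y1 + F * Y2 = inner a q" "E * Z1 + F * Z2 = inner a p"
    using low[OF u, of 2 2] low[OF u, of 1 2] low[OF u, of 1 1]
    by (simp_all add: EF X1_def X2_def Y1_def Y2_def Z1_def Z2_def a_def p_def q_def r_def)
  have "(\<Sum>d\<in>UNIV. metric \<phi> u $ 1 $ d * riemann \<phi> d 2 1 2 u)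
     = E * (x1 - y1 + (Z1 * X1 - X1 * Y2 + Y1 * X2 - Y1 * Y1) + 0)
     + F * (x2 - y2 + (Z2 * X1 - Y2 * Y1 + Y2 * X2 - X2 * Y2))"
    unfolding riemann_def sum_2 EF Y' XYZ x1_def x2_def y1_def y2_def
    by (simp add: algebra_simps)
  \<comment> \<open>Grouped so that every pair of upper-index quantities appears in a lowered
    combination, known from \<open>d1\<close>, \<open>d2\<close> or \<open>l\<close>.\<close>
  also have "\<dots> = (E * x1 + F * x2) - (E * y1 + F * y2) + (E * Z1 + F * Z2) * X1
      - (E * X1 + F * X2) * Y2 + (E * Y1 + F * Y2) * X2 - (E * Y1 + F * Y2) * Y1"
    by (simp add: algebra_simps)
  also have "\<dots> = (inner p r - inner q q) - inner a p * X1 - inner b p * X2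
      + inner a q * Y1 + inner b q * Y2"
  proof -
    have "E * x1 + F * x2 = inner p r + t - 2 * inner a p * X1 - (inner b p + inner a q) * X2"
      using d1 by simp
    moreover have "E * y1 + F * y2 = inner q q + t - 2 * inner a q * Y1 - (inner b q + inner a r) * Y2"
      using d2 by simp
    ultimately show ?thesis unfolding l by (simp add: algebra_simps)
  qed
  finally have R: "(\<Sum>d\<in>UNIV. metric \<phi> u $ 1 $ d * riemann \<phi> d 2 1 2 u)
     = (inner p r - inner q q) - inner a p * X1 - inner b p * X2 + inner a q * Y1 + inner b q * Y2" .
  have Rm: "(\<Sum>d\<in>UNIV. metric \<phi> u $ 1 $ d * riemann \<phi> d 2 1 2 u) * m
     = m * (inner p r - inner q q) - inner a p * (X1 * m) - inner b p * (X2 * m)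
      + inner a q * (Y1 * m) + inner b q * (Y2 * m)"
    unfolding R by (simp add: algebra_simps)
  have "X1 * m = inner b b * inner a r - inner a b * inner b r"
    "X2 * m = inner a a * inner b r - inner a b * inner a r"
    "Y1 * m = inner b b * inner a q - inner a b * inner b q"
    "Y2 * m = inner a a * inner b q - inner a b * inner a q"
    using m unfolding X1_def X2_def Y1_def Y2_def christoffel_components[OF U \<phi> u D[OF u]]
    by (simp_all add: m_def a_def b_def q_def r_def)
  then show ?thesis using Rm unfolding m_def[symmetric] by simp
qed

section \<open>The double brackets of the coordinates\<close>

text \<open>The inner product of the 2-vectors of x, y and of z, w. All ordered index pairs are
  counted, hence the factor 2.\<close>

lemma inner_wedge:
  fixes x y z w :: "real^'m"
  shows "(\<Sum>j\<in>UNIV. \<Sum>k\<in>UNIV. (x $ j * y $ k - y $ j * x $ k) * (z $ j * w $ k - w $ j * z $ k))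
    = 2 * (inner x z * inner y w - inner x w * inner y z)"
proof -
  have p: "(\<Sum>j\<in>UNIV. \<Sum>k\<in>UNIV. (f $ j * g $ j) * (h $ k * i $ k)) = inner f g * inner h i"
    for f g h i :: "real^'m"
    by (simp add: inner_vec_def sum_product)
  have "(x $ j * y $ k - y $ j * x $ k) * (z $ j * w $ k - w $ j * z $ k)
     = (x $ j * z $ j) * (y $ k * w $ k) - (x $ j * w $ j) * (y $ k * z $ k)
     - ((y $ j * z $ j) * (x $ k * w $ k) - (y $ j * w $ j) * (x $ k * z $ k))" for j k
    by (simp add: algebra_simps)
  then show ?thesis by (simp only: sum_subtractf p) (simp add: algebra_simps)
qed

text \<open>Contraction of the 2-vector of x, y with the vector z.\<close>

lemma sum_wedge_mult:
  fixes x y z :: "real^'m"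
  shows "(\<Sum>k\<in>UNIV. (x $ j * y $ k - y $ j * x $ k) * z $ k) = inner y z * x $ j - inner x z * y $ j"
proof -
  have "(x $ j * y $ k - y $ j * x $ k) * z $ k = (y $ k * z $ k) * x $ j - (x $ k * z $ k) * y $ j" for k
    by (simp add: algebra_simps)
  then show ?thesis
    by (simp only: inner_vec_def inner_real_def sum_subtractf sum_distrib_right)
qed

text \<open>\<open>B1\<close> and \<open>B2\<close> are the two partial derivatives of the 2-vector
  of a, b, corrected by the logarithmic derivatives \<open>s\<close>, \<open>t\<close> of the
  density, and \<open>Q\<close> is the double bracket times the squared density. As wedge sums and
  contractions are inner products, the claim becomes a polynomial identity, in which
  \<open>s\<close> and \<open>t\<close> cancel.\<close>

lemma double_bracket_sum:
  fixes a b p q r :: "real^'m" and s t :: real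
  defines "B1 \<equiv> \<lambda>j k. p $ j * b $ k + a $ j * q $ k - q $ j * a $ k - b $ j * p $ k
      - s * (a $ j * b $ k - b $ j * a $ k)"
    and "B2 \<equiv> \<lambda>j k. q $ j * b $ k + a $ j * r $ k - r $ j * a $ k - b $ j * q $ k
      - t * (a $ j * b $ k - b $ j * a $ k)"
  defines "Q \<equiv> \<lambda>j k l. B1 j k * b $ l - B2 j k * a $ l"
  shows "(\<Sum>j\<in>UNIV. \<Sum>k\<in>UNIV. \<Sum>l\<in>UNIV. 1/2 * (Q j k k * Q j l l) - 1/4 * (Q j k l * Q j k l))
    = (inner a a * inner b b - inner a b * inner a b) * (inner p r - inner q q)
      - inner a p * (inner b b * inner a r - inner a b * inner b r)
      - inner b p * (inner a a * inner b r - inner a b * inner a r)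
      + inner a q * (inner b b * inner a q - inner a b * inner b q)
      + inner b q * (inner a a * inner b q - inner a b * inner a q)"
proof -
  (* Absorbing s and t into y1 and y2 makes B1 and B2 sums of two wedge products. *)
  define y1 y2 where "y1 = q - s *\<^sub>R b" and "y2 = r - t *\<^sub>R b"
  have B1: "B1 j k = (p $ j * b $ k - b $ j * p $ k) + (a $ j * y1 $ k - y1 $ j * a $ k)" for j k
    by (simp add: B1_def y1_def algebra_simps)
  have B2: "B2 j k = (q $ j * b $ k - b $ j * q $ k) + (a $ j * y2 $ k - y2 $ j * a $ k)" for j k
    by (simp add: B2_def y2_def algebra_simps)
  define V where "V = (inner b b *\<^sub>R p - inner p b *\<^sub>R b + (inner y1 b *\<^sub>R a - inner a b *\<^sub>R y1))
     - (inner b a *\<^sub>R q - inner q a *\<^sub>R b + (inner y2 a *\<^sub>R a - inner a a *\<^sub>R y2))"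
  have "(\<Sum>k\<in>UNIV. Q j k k) = V $ j" for j
    unfolding Q_def B1 B2 sum_subtractf
    by (simp only: distrib_right sum.distrib sum_wedge_mult) (simp add: V_def)
  then have 1: "(\<Sum>j\<in>UNIV. \<Sum>k\<in>UNIV. \<Sum>l\<in>UNIV. Q j k k * Q j l l) = inner V V"
    by (simp add: sum_product[symmetric] inner_vec_def)
  \<comment> \<open>The pairing of two-index arrays: it reduces the sum of squares of
    \<open>Q\<close> to three numbers, each evaluated by \<open>inner_wedge\<close>.\<close>
  define W where "W C C' = (\<Sum>j\<in>UNIV. \<Sum>k\<in>UNIV. C j k * C' j k)" for C C' :: "'m \<Rightarrow> 'm \<Rightarrow> real"
  have "(\<Sum>l\<in>UNIV. Q j k l * Q j k l)
     = B1 j k * B1 j k * inner b b - 2 * (B1 j k * B2 j k * inner a b) + B2 j k * B2 j k * inner a a" for j k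
  proof -
    have "Q j k l * Q j k l = B1 j k * B1 j k * (b $ l * b $ l) - 2 * (B1 j k * B2 j k * (a $ l * b $ l))
        + B2 j k * B2 j k * (a $ l * a $ l)" for l
      by (simp add: Q_def algebra_simps)
    then show ?thesis
      by (simp add: inner_vec_def sum.distrib sum_subtractf sum_distrib_left)
  qed
  then have 2: "(\<Sum>j\<in>UNIV. \<Sum>k\<in>UNIV. \<Sum>l\<in>UNIV. Q j k l * Q j k l)
     = W B1 B1 * inner b b - 2 * (W B1 B2 * inner a b) + W B2 B2 * inner a a"
    by (simp add: W_def sum.distrib sum_subtractf sum_distrib_left sum_distrib_right)
  have W: "W (\<lambda>j k. (x $ j * y $ k - y $ j * x $ k) + (z $ j * w $ k - w $ j * z $ k))
      (\<lambda>j k. (x' $ j * y' $ k - y' $ j * x' $ k) + (z' $ j * w' $ k - w' $ j * z' $ k))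
     = 2 * (inner x x' * inner y y' - inner x y' * inner y x') + 2 * (inner x z' * inner y w' - inner x w' * inner y z')
      + (2 * (inner z x' * inner w y' - inner z y' * inner w x') + 2 * (inner z z' * inner w w' - inner z w' * inner w z'))"
    for x y z w x' y' z' w'
    unfolding W_def by (simp only: distrib_left distrib_right sum.distrib inner_wedge)
  have W': "W B1 B1 = 2 * (inner p p * inner b b - inner p b * inner b p) + 2 * (inner p a * inner b y1 - inner p y1 * inner b a)
      + (2 * (inner a p * inner y1 b - inner a b * inner y1 p) + 2 * (inner a a * inner y1 y1 - inner a y1 * inner y1 a))"
    "W B1 B2 = 2 * (inner p q * inner b b - inner p b * inner b q) + 2 * (inner p a * inner b y2 - inner p y2 * inner b a)
      + (2 * (inner a q * inner y1 b - inner a b * inner y1 q) + 2 * (inner a a * inner y1 y2 - inner a y2 * inner y1 a))"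
    "W B2 B2 = 2 * (inner q q * inner b b - inner q b * inner b q) + 2 * (inner q a * inner b y2 - inner q y2 * inner b a)
      + (2 * (inner a q * inner y2 b - inner a b * inner y2 q) + 2 * (inner a a * inner y2 y2 - inner a y2 * inner y2 a))"
    using W[of p b a y1 p b a y1] W[of p b a y1 q b a y2] W[of q b a y2 q b a y2]
    unfolding B1[symmetric, abs_def] B2[symmetric, abs_def] by simp_all
  \<comment> \<open>The fifteen inner products of the five vectors become real variables, and
    \<open>i\<close> removes the symmetry of \<open>inner\<close>; what remains is algebra in these
    variables and \<open>s\<close>, \<open>t\<close>.\<close>
  define E F G ap aq ar bp bq br pp pq pr qq qr rr where
    "E = inner a a" and "F = inner a b" and "G = inner b b" and "ap = inner a p" and "aq = inner a q"
    and "ar = inner a r" and "bp = inner b p" and "bq = inner b q" and "br = inner b r"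
    and "pp = inner p p" and "pq = inner p q" and "pr = inner p r" and "qq = inner q q"
    and "qr = inner q r" and "rr = inner r r"
  have i: "inner a a = E" "inner a b = F" "inner b a = F" "inner b b = G" "inner a p = ap" "inner p a = ap"
    "inner a q = aq" "inner q a = aq" "inner a r = ar" "inner r a = ar" "inner b p = bp" "inner p b = bp"
    "inner b q = bq" "inner q b = bq" "inner b r = br" "inner r b = br" "inner p p = pp"
    "inner p q = pq" "inner q p = pq" "inner p r = pr" "inner r p = pr" "inner q q = qq"
    "inner q r = qr" "inner r q = qr" "inner r r = rr"
    by (simp_all add: E_def F_def G_def ap_def aq_def ar_def bp_def bq_def br_def pp_def pq_def
        pr_def qq_def qr_def rr_def inner_commute)
  note iy = y1_def y2_def inner_diff_left inner_diff_right inner_add_left inner_add_right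
    inner_scaleR_left inner_scaleR_right i
  \<comment> \<open>The density terms of \<open>V\<close> are tangential and are collected in these
    two coefficients. The normal component of the rest is the metric determinant times the trace of
    the second fundamental form.\<close>
  define ca cb where "ca = bq - s * G - ar + t * F" and "cb = aq - bp + s * F - t * E"
  have V: "V = G *\<^sub>R p - (2 * F) *\<^sub>R q + E *\<^sub>R r + ca *\<^sub>R a + cb *\<^sub>R b"
    unfolding V_def iy
    by (simp add: Finite_Cartesian_Product.vec_eq_iff ca_def cb_def algebra_simps)
  have VV: "inner V V = G * (G * pp - 2 * F * pq + E * pr + ca * ap + cb * bp)
     - 2 * F * (G * pq - 2 * F * qq + E * qr + ca * aq + cb * bq)
     + E * (G * pr - 2 * F * qr + E * rr + ca * ar + cb * br)
     + ca * (G * ap - 2 * F * aq + E * ar + ca * E + cb * F)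
     + cb * (G * bp - 2 * F * bq + E * br + ca * F + cb * G)"
    unfolding V iy by (simp add: algebra_simps)
  have "(\<Sum>j\<in>UNIV. \<Sum>k\<in>UNIV. \<Sum>l\<in>UNIV. 1/2 * (Q j k k * Q j l l) - 1/4 * (Q j k l * Q j k l))
     = 1/2 * inner V V - 1/4 * (W B1 B1 * inner b b - 2 * (W B1 B2 * inner a b) + W B2 B2 * inner a a)"
    unfolding 1[symmetric] 2[symmetric] by (simp add: sum_subtractf sum_distrib_left sum_divide_distrib)
  also have "\<dots> = (E * G - F * F) * (pr - qq)
      - ap * (G * ar - F * br) - bp * (E * br - F * ar) + aq * (G * aq - F * bq) + bq * (E * bq - F * aq)"
    unfolding W' VV iy ca_def cb_def by (simp add: field_simps)
  finally show ?thesis unfolding i .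
qed


definition double_bracket ::
  "(real^'m) set \<Rightarrow> (real^'m \<Rightarrow> real^'m \<Rightarrow> real^'m \<Rightarrow> real) \<Rightarrow> 'm \<Rightarrow> 'm \<Rightarrow> 'm \<Rightarrow> real^'m \<Rightarrow> real" where
  "double_bracket S \<omega> j k l = poisson S \<omega> (poisson S \<omega> (\<lambda>x. x $ j) (\<lambda>x. x $ k)) (\<lambda>x. x $ l)"

text \<open>Copies the matrix expression factor by factor, in the same order and over the same index
  triples, so that the convergence rules for products and sums apply to it directly.\<close>

definition bracket_curvature ::
  "(real^'m) set \<Rightarrow> (real^'m \<Rightarrow> real^'m \<Rightarrow> real^'m \<Rightarrow> real) \<Rightarrow> real^'m \<Rightarrow> real" where
  "bracket_curvature S \<omega> p = (\<Sum>(j, k, l)\<in>UNIV.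
     1/2 * ((1 / gamma_fun S \<omega> p)^2 * double_bracket S \<omega> j k k p * double_bracket S \<omega> j l l p
        * (1 / gamma_fun S \<omega> p)^2)
     - 1/4 * ((1 / gamma_fun S \<omega> p)^2 * double_bracket S \<omega> j k l p * double_bracket S \<omega> j k l p
        * (1 / gamma_fun S \<omega> p)^2))"

lemma Cinf_double_bracket: "symplectic_form S \<omega> \<Longrightarrow> double_bracket S \<omega> j k l \<in> Cinf S"
  unfolding double_bracket_def by (intro Cinf_poisson Cinf_component)

text \<open>The inner bracket is a component of the 2-vector of the frame divided by the density.
  The quotient rule leaves the logarithmic derivatives of the density in the places that
  \<open>double_bracket_sum\<close> calls \<open>s\<close> and \<open>t\<close>.\<close>

lemma double_bracket_chart:
  assumes \<omega>: "symplectic_form S \<omega>" and \<phi>: "local_chart S U \<phi>" and u: "u \<in> U"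
  defines "a \<equiv> partial 1 \<phi> u" and "b \<equiv> partial 2 \<phi> u"
    and "p \<equiv> partial 1 (partial 1 \<phi>) u" and "q \<equiv> partial 1 (partial 2 \<phi>) u"
    and "r \<equiv> partial 2 (partial 2 \<phi>) u" and "\<rho> \<equiv> density \<omega> \<phi> u"
  shows "double_bracket S \<omega> j k l (\<phi> u) =
    ((p $ j * b $ k + a $ j * q $ k - q $ j * a $ k - b $ j * p $ k
      - partial 1 (density \<omega> \<phi>) u / \<rho> * (a $ j * b $ k - b $ j * a $ k)) * b $ l
    - (q $ j * b $ k + a $ j * r $ k - r $ j * a $ k - b $ j * q $ k
      - partial 2 (density \<omega> \<phi>) u / \<rho> * (a $ j * b $ k - b $ j * a $ k)) * a $ l) / \<rho>\<^sup>2"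
proof -
  note U = local_chartD(1)[OF \<phi>] and sm = local_chartD(2)[OF \<phi>]
  have s1: "smooth_on U (partial i \<phi>)" for i by (rule smooth_on_partial[OF sm])
  have sc: "smooth_on U (\<lambda>w. partial i \<phi> w $ n)" for i n
    by (rule smooth_on_bounded_linear[OF U bounded_linear_vec_nth s1])
  have s\<rho>: "smooth_on U (density \<omega> \<phi>)" by (rule smooth_on_density[OF \<omega> \<phi>])
  note diff = smooth_on_differentiable[OF _ u]
  have \<rho>: "\<rho> \<noteq> 0" using density_nonzero[OF \<omega> \<phi> u] by (simp add: \<rho>_def)
  have coord: "partial i ((\<lambda>x. x $ n) \<circ> \<phi>) w = partial i \<phi> w $ n" if "w \<in> U" for i n w
    using partial_component[OF smooth_on_differentiable[OF sm that]] by (simp add: o_def)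
  define P where "P = poisson S \<omega> (\<lambda>x. x $ j) (\<lambda>x. x $ k)"
  have P: "P \<in> Cinf S" unfolding P_def by (intro Cinf_poisson[OF \<omega>] Cinf_component)
  define A where "A w = partial 1 \<phi> w $ j * partial 2 \<phi> w $ k - partial 2 \<phi> w $ j * partial 1 \<phi> w $ k" for w
  have P\<phi>: "(P \<circ> \<phi>) w = A w / density \<omega> \<phi> w" if "w \<in> U" for w
    using poisson_chart[OF \<omega> \<phi> that Cinf_component Cinf_component, of j k]
    by (simp add: P_def A_def coord[OF that])
  have sA: "smooth_on U A" unfolding A_def by (intro smooth_on_diff smooth_on_mult sc U)
  have dA: "partial c A u = (partial c (partial 1 \<phi>) u $ j * b $ k + a $ j * partial c (partial 2 \<phi>) u $ k)
     - (partial c (partial 2 \<phi>) u $ j * a $ k + b $ j * partial c (partial 1 \<phi>) u $ k)" for c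
    unfolding A_def
    by (simp add: partial_diff[OF diff[OF smooth_on_mult[OF U sc sc]] diff[OF smooth_on_mult[OF U sc sc]]]
        partial_mult[OF diff[OF sc] diff[OF sc]] partial_component[OF diff[OF s1]] a_def b_def)
  have dP: "partial c (P \<circ> \<phi>) u = (partial c A u - partial c (density \<omega> \<phi>) u / \<rho> * A u) / \<rho>" for c
  proof -
    have "partial c (P \<circ> \<phi>) u = partial c (\<lambda>w. A w / density \<omega> \<phi> w) u"
      by (rule partial_cong_open[OF U u P\<phi>])
    also have "\<dots> = (partial c A u * \<rho> - A u * partial c (density \<omega> \<phi>) u) / (\<rho> * \<rho>)"
      unfolding \<rho>_def by (rule partial_divide[OF diff[OF sA] diff[OF s\<rho>] density_nonzero[OF \<omega> \<phi> u]])
    also have "\<dots> = (partial c A u - partial c (density \<omega> \<phi>) u / \<rho> * A u) / \<rho>"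
      using \<rho> by (simp add: field_simps)
    finally show ?thesis .
  qed
  have c21: "partial 2 (partial 1 \<phi>) u = q"
    unfolding q_def by (rule partial_commute[OF U sm u])
  have "double_bracket S \<omega> j k l (\<phi> u) = (partial 1 (P \<circ> \<phi>) u * b $ l - partial 2 (P \<circ> \<phi>) u * a $ l) / \<rho>"
    using poisson_chart[OF \<omega> \<phi> u P Cinf_component, of l]
    by (simp add: double_bracket_def P_def[symmetric] coord[OF u] a_def b_def \<rho>_def)
  also have "\<dots> = ((partial 1 A u - partial 1 (density \<omega> \<phi>) u / \<rho> * A u) * b $ l
      - (partial 2 A u - partial 2 (density \<omega> \<phi>) u / \<rho> * A u) * a $ l) / \<rho>\<^sup>2"
    unfolding dP using \<rho> by (simp add: field_simps power2_eq_square)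
  finally show ?thesis
    unfolding dA c21 by (simp add: A_def a_def b_def p_def q_def r_def diff_diff_eq)
qed

lemma sum_UNIV_triple:
  fixes f :: "'a::finite \<Rightarrow> 'b::finite \<Rightarrow> 'c::finite \<Rightarrow> 'd::comm_monoid_add"
  shows "(\<Sum>(j, k, l)\<in>UNIV. f j k l) = (\<Sum>j\<in>UNIV. \<Sum>k\<in>UNIV. \<Sum>l\<in>UNIV. f j k l)"
  by (simp add: sum.cartesian_product split_def)

text \<open>The two factors \<open>g\<close>, each equal to \<open>\<rho>\<^sup>2 / D\<close>,
  cancel the density in a product of two double brackets and leave \<open>D\<^sup>2\<close> below;
  one \<open>D\<close> of it cancels against the factor \<open>metric_det\<close> in
  \<open>gauss_equation\<close>.\<close>

lemma bracket_curvature_chart: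
  assumes \<omega>: "symplectic_form S \<omega>" and \<phi>: "local_chart S U \<phi>" and u: "u \<in> U"
  shows "(\<Sum>d\<in>UNIV. metric \<phi> u $ 1 $ d * riemann \<phi> d 2 1 2 u) / metric_det \<phi> u
    = bracket_curvature S \<omega> (\<phi> u)"
proof -
  define D \<rho> where "D = metric_det \<phi> u" and "\<rho> = density \<omega> \<phi> u"
  have D: "D > 0" using metric_det_pos[OF \<phi> u] by (simp add: D_def)
  have \<rho>: "\<rho> \<noteq> 0" using density_nonzero[OF \<omega> \<phi> u] by (simp add: \<rho>_def)
  define g where "g = (1 / gamma_fun S \<omega> (\<phi> u))^2"
  have g: "g = \<rho>\<^sup>2 / D"
    using D by (simp add: g_def gamma_fun_chart[OF \<omega> \<phi> u] D_def[symmetric] \<rho>_def[symmetric] power_divide)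
  define a b p q r where "a = partial 1 \<phi> u" and "b = partial 2 \<phi> u"
    and "p = partial 1 (partial 1 \<phi>) u" and "q = partial 1 (partial 2 \<phi>) u"
    and "r = partial 2 (partial 2 \<phi>) u"
  define s t where "s = partial 1 (density \<omega> \<phi>) u / \<rho>" and "t = partial 2 (density \<omega> \<phi>) u / \<rho>"
  define Q where "Q j k l = (p $ j * b $ k + a $ j * q $ k - q $ j * a $ k - b $ j * p $ k
      - s * (a $ j * b $ k - b $ j * a $ k)) * b $ l
    - (q $ j * b $ k + a $ j * r $ k - r $ j * a $ k - b $ j * q $ k
      - t * (a $ j * b $ k - b $ j * a $ k)) * a $ l" for j k l
  have db: "double_bracket S \<omega> j k l (\<phi> u) = Q j k l / \<rho>\<^sup>2" for j k l
    unfolding Q_def s_def t_def a_def b_def p_def q_def r_def \<rho>_def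
    by (rule double_bracket_chart[OF \<omega> \<phi> u])
  have scaled: "g * (x / \<rho>\<^sup>2) * (y / \<rho>\<^sup>2) * g = x * y / D\<^sup>2" for x y
    unfolding g using D \<rho> by (simp add: power2_eq_square field_simps)
  have "bracket_curvature S \<omega> (\<phi> u)
      = (\<Sum>j\<in>UNIV. \<Sum>k\<in>UNIV. \<Sum>l\<in>UNIV. 1/2 * (Q j k k * Q j l l) - 1/4 * (Q j k l * Q j k l)) / D\<^sup>2"
    unfolding bracket_curvature_def sum_UNIV_triple g_def[symmetric] db scaled
    by (simp add: sum_divide_distrib diff_divide_distrib)
  also have "(\<Sum>j\<in>UNIV. \<Sum>k\<in>UNIV. \<Sum>l\<in>UNIV. 1/2 * (Q j k k * Q j l l) - 1/4 * (Q j k l * Q j k l))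
      = (inner a a * inner b b - inner a b * inner a b) * (inner p r - inner q q)
      - inner a p * (inner b b * inner a r - inner a b * inner b r)
      - inner b p * (inner a a * inner b r - inner a b * inner a r)
      + inner a q * (inner b b * inner a q - inner a b * inner b q)
      + inner b q * (inner a a * inner b q - inner a b * inner a q)"
    unfolding Q_def by (rule double_bracket_sum)
  also have "\<dots> = (\<Sum>d\<in>UNIV. metric \<phi> u $ 1 $ d * riemann \<phi> d 2 1 2 u) * metric_det \<phi> u"
    using gauss_equation[OF local_chartD(1,2)[OF \<phi>] u] metric_det_pos[OF \<phi>]
    by (simp add: a_def b_def p_def q_def r_def metric_det_eq[of \<phi> u] less_le)
  finally show ?thesis
    using D by (simp add: D_def power2_eq_square)
qed

text \<open>\<open>bracket_curvature\<close> depends on the point alone, so equality in every chart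
  is the uniqueness that the description requires. This takes the place of a transformation law for
  the Riemann tensor.\<close>

lemma gaussian_curvature_eq_bracket_curvature:
  assumes S: "embedded_surface S" and \<omega>: "symplectic_form S \<omega>" and p: "p \<in> S"
  shows "gaussian_curvature S p = bracket_curvature S \<omega> p"
proof -
  obtain U \<phi> where \<phi>: "local_chart S U \<phi>" "p \<in> \<phi> ` U"
    using S[unfolded embedded_surface_def, rule_format, OF p] by (elim exE conjE)
  then obtain u where u: "u \<in> U" "\<phi> u = p" by (metis imageE)
  show ?thesis unfolding gaussian_curvature_def
  proof (rule chart_value_eqI[where C = "local_chart S" and V = U and \<psi> = \<phi> and v = u, OF _ \<phi>(1) u])
    fix V \<psi> v assume \<psi>: "local_chart S V \<psi>" "v \<in> V" "\<psi> v = p"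
    show "(\<Sum>d\<in>UNIV. metric \<psi> v $ 1 $ d * riemann \<psi> d 2 1 2 v) / metric_det \<psi> v = bracket_curvature S \<omega> p"
      using bracket_curvature_chart[OF \<omega> \<psi>(1,2)] \<psi>(3) by simp
  qed
qed

section \<open>The operator norm\<close>

lemma vnorm_L2_set: "vnorm v = L2_set (\<lambda>i. cmod (vec_index v i)) {..<dim_vec v}"
  by (simp add: vnorm_def L2_set_def)

lemma vnorm_nonneg [simp]: "vnorm v \<ge> 0"
  by (simp add: vnorm_L2_set L2_set_nonneg)

lemma vnorm_smult: "vnorm (c \<cdot>\<^sub>v v) = cmod c * vnorm v"
proof -
  have "L2_set (\<lambda>i. cmod (vec_index (c \<cdot>\<^sub>v v) i)) {..<dim_vec v}
      = L2_set (\<lambda>i. cmod c * cmod (vec_index v i)) {..<dim_vec v}"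
    by (rule L2_set_cong) (simp_all add: norm_mult)
  then show ?thesis by (simp add: vnorm_L2_set L2_set_right_distrib)
qed

lemma vnorm_add:
  assumes "v \<in> carrier_vec n" "w \<in> carrier_vec n"
  shows "vnorm (v + w) \<le> vnorm v + vnorm w"
proof -
  have "vnorm (v + w) \<le> L2_set (\<lambda>i. cmod (vec_index v i) + cmod (vec_index w i)) {..<n}"
    using assms by (auto simp: vnorm_L2_set intro!: L2_set_mono norm_triangle_ineq)
  also have "\<dots> \<le> vnorm v + vnorm w"
    using assms L2_set_triangle_ineq[of "\<lambda>i. cmod (vec_index v i)" "\<lambda>i. cmod (vec_index w i)" "{..<n}"]
    by (simp add: vnorm_L2_set)
  finally show ?thesis .
qed

lemma vnorm_zero [simp]: "vnorm (0\<^sub>v n) = 0"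
  by (simp add: vnorm_def)

lemma mult_mat_vec_nth:
  assumes "A \<in> carrier_mat n m" "v \<in> carrier_vec m" "i < n"
  shows "vec_index (A *\<^sub>v v) i = (\<Sum>j<m. A $$ (i, j) * vec_index v j)"
  using assms by (auto simp: scalar_prod_def atLeast0LessThan intro!: sum.cong)

text \<open>Bounds the set whose supremum is \<open>opnorm\<close>; the sum of the moduli of all
  entries is constant enough.\<close>

lemma vnorm_mult_mat_vec_bounded:
  assumes A: "A \<in> carrier_mat n m"
  shows "\<exists>C. \<forall>v\<in>carrier_vec m. vnorm (A *\<^sub>v v) \<le> C * vnorm v"
proof (intro exI ballI)
  fix v :: "complex Matrix.vec" assume v: "v \<in> carrier_vec m"
  have c: "cmod (vec_index v j) \<le> vnorm v" if "j < m" for j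
    using v that member_le_L2_set[of "{..<m}" j "\<lambda>i. cmod (vec_index v i)"] by (simp add: vnorm_L2_set)
  have "vnorm (A *\<^sub>v v) \<le> (\<Sum>i<n. cmod (vec_index (A *\<^sub>v v) i))"
    using A L2_set_le_sum[of "{..<n}" "\<lambda>i. cmod (vec_index (A *\<^sub>v v) i)"] by (simp add: vnorm_L2_set)
  also have "\<dots> \<le> (\<Sum>i<n. \<Sum>j<m. cmod (A $$ (i, j)) * vnorm v)"
    by (auto simp: mult_mat_vec_nth[OF A v] norm_mult intro!: sum_mono order_trans[OF norm_sum] mult_left_mono c)
  also have "\<dots> = (\<Sum>i<n. \<Sum>j<m. cmod (A $$ (i, j))) * vnorm v"
    by (simp add: sum_distrib_right)
  finally show "vnorm (A *\<^sub>v v) \<le> (\<Sum>i<n. \<Sum>j<m. cmod (A $$ (i, j))) * vnorm v" .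
qed

lemma opnorm_upper_unit:
  assumes A: "A \<in> carrier_mat n m" and w: "w \<in> carrier_vec m" "vnorm w \<le> 1"
  shows "vnorm (A *\<^sub>v w) \<le> opnorm A"
proof -
  obtain C where C: "\<And>v. v \<in> carrier_vec m \<Longrightarrow> vnorm (A *\<^sub>v v) \<le> C * vnorm v"
    using vnorm_mult_mat_vec_bounded[OF A] by blast
  have "bdd_above ((\<lambda>v. vnorm (A *\<^sub>v v)) ` {v \<in> carrier_vec (dim_col A). vnorm v \<le> 1})"
  proof (rule bdd_aboveI2)
    fix v :: "complex Matrix.vec" assume v: "v \<in> {v \<in> carrier_vec (dim_col A). vnorm v \<le> 1}"
    then have "vnorm (A *\<^sub>v v) \<le> C * vnorm v" using C A by auto
    also have "\<dots> \<le> \<bar>C\<bar> * 1" using v by (intro mult_mono) auto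
    finally show "vnorm (A *\<^sub>v v) \<le> \<bar>C\<bar>" by simp
  qed
  then show ?thesis
    unfolding opnorm_def using w A by (intro cSUP_upper) auto
qed

lemma opnorm_nonneg:
  assumes A: "A \<in> carrier_mat n m"
  shows "opnorm A \<ge> 0"
  by (rule order_trans[OF vnorm_nonneg opnorm_upper_unit[OF A zero_carrier_vec]]) simp

lemma opnorm_upper:
  assumes A: "A \<in> carrier_mat n m" and v: "v \<in> carrier_vec m"
  shows "vnorm (A *\<^sub>v v) \<le> opnorm A * vnorm v"
proof (cases "vnorm v = 0")
  case True
  \<comment> \<open>A vector of norm 0 cannot be normalized; the crude bound gives its image norm 0
    as well.\<close>
  obtain C where "\<And>v. v \<in> carrier_vec m \<Longrightarrow> vnorm (A *\<^sub>v v) \<le> C * vnorm v"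
    using vnorm_mult_mat_vec_bounded[OF A] by blast
  from this[OF v] show ?thesis using True by simp
next
  case False
  then have pos: "vnorm v > 0" using vnorm_nonneg[of v] by linarith
  define w where "w = complex_of_real (1 / vnorm v) \<cdot>\<^sub>v v"
  have "vnorm (A *\<^sub>v w) \<le> opnorm A"
    using v pos by (intro opnorm_upper_unit[OF A]) (auto simp: w_def vnorm_smult norm_divide)
  moreover have "A *\<^sub>v w = complex_of_real (1 / vnorm v) \<cdot>\<^sub>v (A *\<^sub>v v)"
    unfolding w_def by (rule mult_mat_vec[OF A v])
  ultimately have "vnorm (A *\<^sub>v v) / vnorm v \<le> opnorm A"
    using pos by (simp add: vnorm_smult norm_divide)
  then show ?thesis using pos by (simp add: divide_le_eq)
qed

lemma opnorm_least:
  assumes A: "A \<in> carrier_mat n m" and C: "C \<ge> 0"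
    and "\<And>v. v \<in> carrier_vec m \<Longrightarrow> vnorm (A *\<^sub>v v) \<le> C * vnorm v"
  shows "opnorm A \<le> C"
  unfolding opnorm_def
proof (rule cSUP_least)
  show "{v \<in> carrier_vec (dim_col A). vnorm v \<le> 1} \<noteq> {}"
    using vnorm_zero[of "dim_col A"] zero_carrier_vec[of "dim_col A"]
    by (metis (mono_tags, lifting) empty_Collect_eq zero_le_one)
next
  fix v :: "complex Matrix.vec" assume v: "v \<in> {v \<in> carrier_vec (dim_col A). vnorm v \<le> 1}"
  then have "vnorm (A *\<^sub>v v) \<le> C * vnorm v" using assms(3) A by auto
  also have "\<dots> \<le> C * 1" using v C by (intro mult_left_mono) auto
  finally show "vnorm (A *\<^sub>v v) \<le> C" by simp
qed

lemma opnorm_add: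
  assumes A: "A \<in> carrier_mat n m" and B: "B \<in> carrier_mat n m"
  shows "opnorm (A + B) \<le> opnorm A + opnorm B"
proof (rule opnorm_least)
  show "A + B \<in> carrier_mat n m" "opnorm A + opnorm B \<ge> 0"
    using A B opnorm_nonneg[OF A] opnorm_nonneg[OF B] by auto
  fix v :: "complex Matrix.vec" assume v: "v \<in> carrier_vec m"
  have "vnorm ((A + B) *\<^sub>v v) \<le> vnorm (A *\<^sub>v v) + vnorm (B *\<^sub>v v)"
    using A B v by (simp add: add_mult_distrib_mat_vec[OF A B v] vnorm_add[of _ n])
  also have "\<dots> \<le> (opnorm A + opnorm B) * vnorm v"
    using opnorm_upper[OF A v] opnorm_upper[OF B v] by (simp add: distrib_right)
  finally show "vnorm ((A + B) *\<^sub>v v) \<le> (opnorm A + opnorm B) * vnorm v" .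
qed

lemma opnorm_mult:
  assumes A: "A \<in> carrier_mat n m" and B: "B \<in> carrier_mat m k"
  shows "opnorm (A * B) \<le> opnorm A * opnorm B"
proof (rule opnorm_least)
  show "A * B \<in> carrier_mat n k" "opnorm A * opnorm B \<ge> 0"
    using A B opnorm_nonneg[OF A] opnorm_nonneg[OF B] by auto
  fix v :: "complex Matrix.vec" assume v: "v \<in> carrier_vec k"
  have "vnorm ((A * B) *\<^sub>v v) = vnorm (A *\<^sub>v (B *\<^sub>v v))"
    by (simp add: assoc_mult_mat_vec[OF A B v])
  also have "\<dots> \<le> opnorm A * vnorm (B *\<^sub>v v)"
    using B v by (intro opnorm_upper[OF A]) auto
  also have "\<dots> \<le> opnorm A * (opnorm B * vnorm v)"
    by (intro mult_left_mono opnorm_upper[OF B v] opnorm_nonneg[OF A])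
  finally show "vnorm ((A * B) *\<^sub>v v) \<le> opnorm A * opnorm B * vnorm v" by (simp add: mult_ac)
qed

lemma opnorm_smult:
  assumes A: "A \<in> carrier_mat n m"
  shows "opnorm (c \<cdot>\<^sub>m A) \<le> cmod c * opnorm A"
proof (rule opnorm_least)
  show "c \<cdot>\<^sub>m A \<in> carrier_mat n m" "cmod c * opnorm A \<ge> 0"
    using A opnorm_nonneg[OF A] by auto
  fix v :: "complex Matrix.vec" assume v: "v \<in> carrier_vec m"
  have "(c \<cdot>\<^sub>m A) *\<^sub>v v = c \<cdot>\<^sub>v (A *\<^sub>v v)"
    using A v by (intro eq_vecI) auto
  then have "vnorm ((c \<cdot>\<^sub>m A) *\<^sub>v v) = cmod c * vnorm (A *\<^sub>v v)" by (simp add: vnorm_smult)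
  also have "\<dots> \<le> cmod c * (opnorm A * vnorm v)"
    by (intro mult_left_mono opnorm_upper[OF A v]) auto
  finally show "vnorm ((c \<cdot>\<^sub>m A) *\<^sub>v v) \<le> cmod c * opnorm A * vnorm v" by (simp add: mult_ac)
qed

section \<open>Adjoint matrices\<close>

lemma mat_adjoint_carrier:
  fixes A :: "complex Matrix.mat"
  assumes "A \<in> carrier_mat n m"
  shows "mat_adjoint A \<in> carrier_mat m n"
proof -
  have "mat_adjoint A \<in> carrier_mat (length (map conjugate (cols A))) (dim_row A)"
    unfolding mat_adjoint_def by (rule mat_of_rows_carrier(1))
  moreover have "length (map conjugate (cols A)) = m" "dim_row A = n" using assms by auto
  ultimately show ?thesis by simp
qed

lemma mat_adjoint_index:
  fixes A :: "complex Matrix.mat"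
  assumes "A \<in> carrier_mat n m" "i < m" "j < n"
  shows "mat_adjoint A $$ (i, j) = cnj (A $$ (j, i))"
proof -
  have "mat_adjoint A $$ (i, j) = vec_index (map conjugate (cols A) ! i) j"
    unfolding mat_adjoint_def using assms by (intro mat_of_rows_index) auto
  then show ?thesis using assms by simp
qed

lemma mat_adjoint_minus:
  fixes A B :: "complex Matrix.mat"
  assumes "A \<in> carrier_mat n m" "B \<in> carrier_mat n m"
  shows "mat_adjoint (A - B) = mat_adjoint A - mat_adjoint B"
proof (rule eq_matI)
  have AB: "A - B \<in> carrier_mat n m" using assms(2) by (rule minus_carrier_mat)
  note d = mat_adjoint_carrier[OF assms(1)] mat_adjoint_carrier[OF assms(2)] mat_adjoint_carrier[OF AB]
  show "dim_row (mat_adjoint (A - B)) = dim_row (mat_adjoint A - mat_adjoint B)"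
    "dim_col (mat_adjoint (A - B)) = dim_col (mat_adjoint A - mat_adjoint B)"
    using d by auto
  fix i j assume "i < dim_row (mat_adjoint A - mat_adjoint B)" "j < dim_col (mat_adjoint A - mat_adjoint B)"
  then have ij: "i < m" "j < n" using d by auto
  then show "mat_adjoint (A - B) $$ (i, j) = (mat_adjoint A - mat_adjoint B) $$ (i, j)"
    using d assms by (simp add: mat_adjoint_index[OF AB] mat_adjoint_index[OF assms(1)] mat_adjoint_index[OF assms(2)])
qed

lemma mat_adjoint_mult:
  fixes A B :: "complex Matrix.mat"
  assumes "A \<in> carrier_mat n m" "B \<in> carrier_mat m k"
  shows "mat_adjoint (A * B) = mat_adjoint B * mat_adjoint A"
proof (rule eq_matI)
  have AB: "A * B \<in> carrier_mat n k" using assms by (rule mult_carrier_mat)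
  note d = mat_adjoint_carrier[OF assms(1)] mat_adjoint_carrier[OF assms(2)] mat_adjoint_carrier[OF AB]
  show "dim_row (mat_adjoint (A * B)) = dim_row (mat_adjoint B * mat_adjoint A)"
    "dim_col (mat_adjoint (A * B)) = dim_col (mat_adjoint B * mat_adjoint A)"
    using d by auto
  fix i j assume "i < dim_row (mat_adjoint B * mat_adjoint A)" "j < dim_col (mat_adjoint B * mat_adjoint A)"
  then have ij: "i < k" "j < n" using d by auto
  then have "mat_adjoint (A * B) $$ (i, j) = cnj (\<Sum>l = 0..<m. A $$ (j, l) * B $$ (l, i))"
    using assms by (simp add: mat_adjoint_index[OF AB] scalar_prod_def)
  also have "\<dots> = (\<Sum>l = 0..<m. mat_adjoint B $$ (i, l) * mat_adjoint A $$ (l, j))"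
    using ij assms by (simp add: mat_adjoint_index[OF assms(1)] mat_adjoint_index[OF assms(2)] mult.commute)
  also have "\<dots> = (mat_adjoint B * mat_adjoint A) $$ (i, j)"
    using ij d by (simp add: scalar_prod_def)
  finally show "mat_adjoint (A * B) $$ (i, j) = (mat_adjoint B * mat_adjoint A) $$ (i, j)" .
qed

lemma mat_adjoint_one: "mat_adjoint (1\<^sub>m n :: complex Matrix.mat) = 1\<^sub>m n"
proof (rule eq_matI)
  have 1: "(1\<^sub>m n :: complex Matrix.mat) \<in> carrier_mat n n" by simp
  note d = mat_adjoint_carrier[OF 1]
  show "dim_row (mat_adjoint (1\<^sub>m n :: complex Matrix.mat)) = dim_row (1\<^sub>m n :: complex Matrix.mat)"
    "dim_col (mat_adjoint (1\<^sub>m n :: complex Matrix.mat)) = dim_col (1\<^sub>m n :: complex Matrix.mat)"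
    using d by auto
  show "mat_adjoint (1\<^sub>m n :: complex Matrix.mat) $$ (i, j) = 1\<^sub>m n $$ (i, j)"
    if "i < dim_row (1\<^sub>m n :: complex Matrix.mat)" "j < dim_col (1\<^sub>m n :: complex Matrix.mat)" for i j
    using that by (simp add: mat_adjoint_index[OF 1])
qed

text \<open>For w = A* v one has |w|^2 = <v, A w>, at most |v| ||A|| |w| by Cauchy-Schwarz, and a
  nonzero |w| cancels.\<close>

lemma opnorm_mat_adjoint_le:
  assumes A: "A \<in> carrier_mat n m"
  shows "opnorm (mat_adjoint A) \<le> opnorm A"
proof (rule opnorm_least[OF mat_adjoint_carrier[OF A] opnorm_nonneg[OF A]])
  fix v :: "complex Matrix.vec" assume v: "v \<in> carrier_vec n"
  define w where "w = mat_adjoint A *\<^sub>v v"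
  have w: "w \<in> carrier_vec m" using mat_adjoint_carrier[OF A] v by (simp add: w_def)
  have Aw: "A *\<^sub>v w \<in> carrier_vec n" using A w by simp
  have "complex_of_real ((vnorm w)\<^sup>2) = (\<Sum>j<m. vec_index w j * cnj (vec_index w j))"
    using w by (simp add: vnorm_def sum_nonneg complex_norm_square[symmetric])
  also have "\<dots> = (\<Sum>j<m. \<Sum>i<n. cnj (A $$ (i, j)) * vec_index v i * cnj (vec_index w j))"
    unfolding w_def
    by (intro sum.cong refl, subst mult_mat_vec_nth[OF mat_adjoint_carrier[OF A] v])
      (auto simp: mat_adjoint_index[OF A] sum_distrib_right intro!: sum.cong)
  also have "\<dots> = (\<Sum>i<n. \<Sum>j<m. cnj (A $$ (i, j)) * vec_index v i * cnj (vec_index w j))"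
    by (rule sum.swap)
  also have "\<dots> = (\<Sum>i<n. vec_index v i * cnj (vec_index (A *\<^sub>v w) i))"
    by (intro sum.cong refl) (simp add: mult_mat_vec_nth[OF A w] sum_distrib_left mult_ac)
  finally have "(vnorm w)\<^sup>2 = cmod (\<Sum>i<n. vec_index v i * cnj (vec_index (A *\<^sub>v w) i))"
    by (metis abs_of_nonneg norm_of_real zero_le_power2)
  also have "\<dots> \<le> (\<Sum>i<n. \<bar>cmod (vec_index v i)\<bar> * \<bar>cmod (vec_index (A *\<^sub>v w) i)\<bar>)"
    by (rule order_trans[OF norm_sum]) (simp add: norm_mult)
  also have "\<dots> \<le> vnorm v * vnorm (A *\<^sub>v w)"
    using L2_set_mult_ineq[of "\<lambda>i. cmod (vec_index v i)" "\<lambda>i. cmod (vec_index (A *\<^sub>v w) i)" "{..<n}"] v A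
    by (simp add: vnorm_L2_set)
  also have "\<dots> \<le> vnorm v * (opnorm A * vnorm w)"
    by (intro mult_left_mono opnorm_upper[OF A w]) simp
  finally have "vnorm w * vnorm w \<le> (opnorm A * vnorm v) * vnorm w"
    by (simp add: power2_eq_square mult_ac)
  moreover have "opnorm A * vnorm v \<ge> 0" using opnorm_nonneg[OF A] by simp
  ultimately have "vnorm w \<le> opnorm A * vnorm v"
    using vnorm_nonneg[of w] by (metis less_eq_real_def mult_right_le_imp_le)
  then show "vnorm (mat_adjoint A *\<^sub>v v) \<le> opnorm A * vnorm v" by (simp add: w_def)
qed

section \<open>Inverse matrices\<close>

lemma minv_carrier_and_inverse:
  fixes A :: "'a::field Matrix.mat"
  assumes A: "A \<in> carrier_mat n n" and inv: "invertible_mat A"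
  shows "minv A \<in> carrier_mat n n" "A * minv A = 1\<^sub>m n" "minv A * A = 1\<^sub>m n"
proof -
  obtain B where B: "A * B = 1\<^sub>m (dim_row A)" "B * A = 1\<^sub>m (dim_row B)"
    using inv unfolding invertible_mat_def inverts_mat_def by blast
  \<comment> \<open>\<open>invertible_mat\<close> leaves the shape of \<open>B\<close> open;
    comparing column counts in the two identities fixes both dimensions.\<close>
  have "dim_row B = n"
    using arg_cong[OF B(2), of dim_col] A by simp
  moreover have "dim_col B = n"
    using arg_cong[OF B(1), of dim_col] A by simp
  ultimately have "B \<in> carrier_mat n n" by auto
  then have "A \<in> Units (ring_mat TYPE('a) n ())"
    using A B by (auto simp: Units_def ring_mat_def intro!: bexI[of _ B])
  then have "mat_inverse A \<noteq> None" using mat_inverse(1)[OF A, of "()"] by blast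
  then have "mat_inverse A = Some (minv A)" by (auto simp: minv_def)
  then show "minv A \<in> carrier_mat n n" "A * minv A = 1\<^sub>m n" "minv A * A = 1\<^sub>m n"
    using mat_inverse(2)[OF A] by blast+
qed

text \<open>Convergence is assumed for the inverse, while the curvature formula inverts the adjoint;
  this identity leads from one to the other.\<close>

lemma minv_mat_adjoint:
  fixes A :: "complex Matrix.mat"
  assumes A: "A \<in> carrier_mat n n" and inv: "invertible_mat A"
  shows "minv (mat_adjoint A) = mat_adjoint (minv A)"
proof -
  note I = minv_carrier_and_inverse[OF A inv]
  note c = mat_adjoint_carrier[OF A] mat_adjoint_carrier[OF I(1)]
  have r: "mat_adjoint A * mat_adjoint (minv A) = 1\<^sub>m n"
    using mat_adjoint_mult[OF I(1) A] I(3) by (simp add: mat_adjoint_one)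
  have l: "mat_adjoint (minv A) * mat_adjoint A = 1\<^sub>m n"
    using mat_adjoint_mult[OF A I(1)] I(2) by (simp add: mat_adjoint_one)
  have "invertible_mat (mat_adjoint A)"
    unfolding invertible_mat_def inverts_mat_def using r l c by (auto intro!: exI[of _ "mat_adjoint (minv A)"])
  note J = minv_carrier_and_inverse[OF c(1) this]
  have "minv (mat_adjoint A) = minv (mat_adjoint A) * (mat_adjoint A * mat_adjoint (minv A))"
    using J(1) by (simp add: r)
  also have "\<dots> = mat_adjoint (minv A)"
    using c by (simp add: assoc_mult_mat[OF J(1) c(1) c(2), symmetric] J(3))
  finally show ?thesis .
qed


section \<open>Convergence of matrix sequences\<close>

lemma matrix_regularizationD:
  assumes "matrix_regularization k S \<omega> N T h"
  shows matrix_regularization_dim: "0 < N \<alpha>"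
    and matrix_regularization_hbar: "n \<ge> 1 \<Longrightarrow> 0 < h n"
    and matrix_regularization_carrier: "f \<in> Cinf S \<Longrightarrow> T \<alpha> f \<in> carrier_mat (N \<alpha>) (N \<alpha>)"
    and matrix_regularization_hermitian: "f \<in> Cinf S \<Longrightarrow> mat_adjoint (T \<alpha> f) = T \<alpha> f"
    and matrix_regularization_cong: "f \<in> Cinf S \<Longrightarrow> f' \<in> Cinf S \<Longrightarrow> (\<And>p. p \<in> S \<Longrightarrow> f p = f' p) \<Longrightarrow> T \<alpha> f = T \<alpha> f'"
    and matrix_regularization_add: "f \<in> Cinf S \<Longrightarrow> f' \<in> Cinf S \<Longrightarrow> T \<alpha> (\<lambda>p. f p + f' p) = T \<alpha> f + T \<alpha> f'"
    and matrix_regularization_scale: "f \<in> Cinf S \<Longrightarrow> T \<alpha> (\<lambda>p. c * f p) = complex_of_real c \<cdot>\<^sub>m T \<alpha> f"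
    and matrix_regularization_convergent: "f \<in> Cinf S \<Longrightarrow> convergent (\<lambda>\<alpha>. opnorm (T \<alpha> f))"
    and matrix_regularization_mult: "f \<in> Cinf S \<Longrightarrow> f' \<in> Cinf S \<Longrightarrow>
        (\<lambda>\<alpha>. opnorm (T \<alpha> (\<lambda>p. f p * f' p) - T \<alpha> f * T \<alpha> f')) \<longlonglongrightarrow> 0"
    and matrix_regularization_mderivs: "f \<in> Cinf S \<Longrightarrow> set fs \<subseteq> Cinf S \<Longrightarrow> 1 \<le> length fs \<Longrightarrow> length fs \<le> k \<Longrightarrow>
        (\<lambda>\<alpha>. opnorm (mderivs (h (N \<alpha>)) (T \<alpha>) fs (T \<alpha> f) - T \<alpha> (pderivs S \<omega> fs f))) \<longlonglongrightarrow> 0"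
proof -
  note c2 = assms[unfolded matrix_regularization_def, THEN conjunct2]
  note c3 = c2[THEN conjunct2]
  note c4 = c3[THEN conjunct2]
  note c5 = c4[THEN conjunct2]
  note c6 = c5[THEN conjunct2]
  note c7 = c6[THEN conjunct2]
  note c8 = c7[THEN conjunct2]
  note c9 = c8[THEN conjunct2]
  note c10 = c9[THEN conjunct2]
  note c11 = c10[THEN conjunct2]
  note c12 = c11[THEN conjunct2]
  show "0 < N \<alpha>" by (rule c2[THEN conjunct1, rule_format])
  show "0 < h n" if "n \<ge> 1" by (rule c3[THEN conjunct1, rule_format, OF that])
  show "T \<alpha> f \<in> carrier_mat (N \<alpha>) (N \<alpha>)" if "f \<in> Cinf S"
    by (rule c6[THEN conjunct1, rule_format, OF that, THEN conjunct1])
  show "mat_adjoint (T \<alpha> f) = T \<alpha> f" if "f \<in> Cinf S"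
    by (rule c6[THEN conjunct1, rule_format, OF that, THEN conjunct2])
  show "T \<alpha> f = T \<alpha> f'" if "f \<in> Cinf S" "f' \<in> Cinf S" "\<And>p. p \<in> S \<Longrightarrow> f p = f' p"
    by (rule c7[THEN conjunct1, rule_format, OF that])
  show "T \<alpha> (\<lambda>p. f p + f' p) = T \<alpha> f + T \<alpha> f'" if "f \<in> Cinf S" "f' \<in> Cinf S"
    by (rule c8[THEN conjunct1, rule_format, OF that])
  show "T \<alpha> (\<lambda>p. c * f p) = complex_of_real c \<cdot>\<^sub>m T \<alpha> f" if "f \<in> Cinf S"
    by (rule c9[THEN conjunct1, rule_format, OF that])
  show "convergent (\<lambda>\<alpha>. opnorm (T \<alpha> f))" if "f \<in> Cinf S"
    by (rule c10[THEN conjunct1, rule_format, OF that])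
  show "(\<lambda>\<alpha>. opnorm (T \<alpha> (\<lambda>p. f p * f' p) - T \<alpha> f * T \<alpha> f')) \<longlonglongrightarrow> 0"
    if "f \<in> Cinf S" "f' \<in> Cinf S"
    by (rule c11[THEN conjunct1, rule_format, OF that])
  show "(\<lambda>\<alpha>. opnorm (mderivs (h (N \<alpha>)) (T \<alpha>) fs (T \<alpha> f) - T \<alpha> (pderivs S \<omega> fs f))) \<longlonglongrightarrow> 0"
    if "f \<in> Cinf S" "set fs \<subseteq> Cinf S" "1 \<le> length fs" "length fs \<le> k"
    by (rule c12[THEN conjunct1, rule_format, OF that(1)]) (use that in simp)
qed

lemma tendsto_zero_upper:
  fixes x y :: "nat \<Rightarrow> real"
  assumes "\<And>n. 0 \<le> x n" "\<And>n. x n \<le> y n" "y \<longlonglongrightarrow> 0"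
  shows "x \<longlonglongrightarrow> 0"
  by (rule real_tendsto_sandwich[OF _ _ tendsto_const assms(3)]) (simp_all add: assms)

lemma mat_convergesD:
  assumes "mat_converges S N T F f"
  shows "f \<in> Cinf S" "F \<alpha> \<in> carrier_mat (N \<alpha>) (N \<alpha>)" "(\<lambda>\<alpha>. opnorm (F \<alpha> - T \<alpha> f)) \<longlonglongrightarrow> 0"
  using assms unfolding mat_converges_def by simp_all

lemma mat_convergesI:
  assumes R: "matrix_regularization k S \<omega> N T h" and f: "f \<in> Cinf S"
    and F: "\<And>\<alpha>. F \<alpha> \<in> carrier_mat (N \<alpha>) (N \<alpha>)"
    and le: "\<And>\<alpha>. opnorm (F \<alpha> - T \<alpha> f) \<le> y \<alpha>" and y: "y \<longlonglongrightarrow> 0"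
  shows "mat_converges S N T F f"
proof -
  have "0 \<le> opnorm (F \<alpha> - T \<alpha> f)" for \<alpha>
    by (rule opnorm_nonneg[OF minus_carrier_mat[OF matrix_regularization_carrier[OF R f]]])
  then show ?thesis
    using tendsto_zero_upper[OF _ le y] f F by (simp add: mat_converges_def)
qed

text \<open>Limits matter only through their values on the surface. The rule also transfers
  smoothness, and in this way the curvature acquires it from
  \<open>bracket_curvature\<close>.\<close>

lemma mat_converges_cong:
  assumes R: "matrix_regularization k S \<omega> N T h" and F: "mat_converges S N T F f"
    and eq: "\<And>p. p \<in> S \<Longrightarrow> f p = g p"
  shows "mat_converges S N T F g"
proof -
  note f = mat_convergesD(1)[OF F]
  have g: "g \<in> Cinf S" by (rule Cinf_cong[OF f eq])
  have "T \<alpha> f = T \<alpha> g" for \<alpha> by (rule matrix_regularization_cong[OF R f g eq])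
  then show ?thesis using F g by (simp add: mat_converges_def)
qed

lemma mat_converges_add:
  assumes R: "matrix_regularization k S \<omega> N T h"
    and F: "mat_converges S N T F f" and G: "mat_converges S N T G g"
  shows "mat_converges S N T (\<lambda>\<alpha>. F \<alpha> + G \<alpha>) (\<lambda>p. f p + g p)"
proof (rule mat_convergesI[OF R])
  note f = mat_convergesD(1)[OF F] and g = mat_convergesD(1)[OF G]
  show "(\<lambda>p. f p + g p) \<in> Cinf S" by (rule Cinf_add[OF f g])
  show "F \<alpha> + G \<alpha> \<in> carrier_mat (N \<alpha>) (N \<alpha>)" for \<alpha>
    using mat_convergesD(2)[OF F] mat_convergesD(2)[OF G] by simp
  show "opnorm (F \<alpha> + G \<alpha> - T \<alpha> (\<lambda>p. f p + g p)) \<le> opnorm (F \<alpha> - T \<alpha> f) + opnorm (G \<alpha> - T \<alpha> g)" for \<alpha>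
  proof -
    note c = mat_convergesD(2)[OF F, of \<alpha>] mat_convergesD(2)[OF G, of \<alpha>]
      matrix_regularization_carrier[OF R f, of \<alpha>] matrix_regularization_carrier[OF R g, of \<alpha>]
    have "F \<alpha> + G \<alpha> - T \<alpha> (\<lambda>p. f p + g p) = (F \<alpha> - T \<alpha> f) + (G \<alpha> - T \<alpha> g)"
      unfolding matrix_regularization_add[OF R f g] using c by (intro eq_matI) auto
    then show ?thesis
      using opnorm_add[OF minus_carrier_mat[OF c(3)] minus_carrier_mat[OF c(4)]] by simp
  qed
  show "(\<lambda>\<alpha>. opnorm (F \<alpha> - T \<alpha> f) + opnorm (G \<alpha> - T \<alpha> g)) \<longlonglongrightarrow> 0"
    using tendsto_add[OF mat_convergesD(3)[OF F] mat_convergesD(3)[OF G]] by simp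
qed

lemma mat_converges_scale:
  assumes R: "matrix_regularization k S \<omega> N T h" and F: "mat_converges S N T F f"
  shows "mat_converges S N T (\<lambda>\<alpha>. complex_of_real c \<cdot>\<^sub>m F \<alpha>) (\<lambda>p. c * f p)"
proof (rule mat_convergesI[OF R])
  note f = mat_convergesD(1)[OF F]
  show "(\<lambda>p. c * f p) \<in> Cinf S" by (rule Cinf_mult[OF Cinf_const f])
  show "complex_of_real c \<cdot>\<^sub>m F \<alpha> \<in> carrier_mat (N \<alpha>) (N \<alpha>)" for \<alpha>
    using mat_convergesD(2)[OF F] by simp
  show "opnorm (complex_of_real c \<cdot>\<^sub>m F \<alpha> - T \<alpha> (\<lambda>p. c * f p)) \<le> \<bar>c\<bar> * opnorm (F \<alpha> - T \<alpha> f)" for \<alpha>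
  proof -
    note c = mat_convergesD(2)[OF F, of \<alpha>] matrix_regularization_carrier[OF R f, of \<alpha>]
    have "complex_of_real c \<cdot>\<^sub>m F \<alpha> - T \<alpha> (\<lambda>p. c * f p) = complex_of_real c \<cdot>\<^sub>m (F \<alpha> - T \<alpha> f)"
      unfolding matrix_regularization_scale[OF R f] using c
      by (intro eq_matI) (auto simp: right_diff_distrib)
    then show ?thesis
      using opnorm_smult[OF minus_carrier_mat[OF c(2)], of "complex_of_real c" "F \<alpha>"] by simp
  qed
  show "(\<lambda>\<alpha>. \<bar>c\<bar> * opnorm (F \<alpha> - T \<alpha> f)) \<longlonglongrightarrow> 0"
    using tendsto_mult_left[OF mat_convergesD(3)[OF F], of "\<bar>c\<bar>"] by simp
qed

lemma mat_converges_diff: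
  assumes R: "matrix_regularization k S \<omega> N T h"
    and F: "mat_converges S N T F f" and G: "mat_converges S N T G g"
  shows "mat_converges S N T (\<lambda>\<alpha>. F \<alpha> - G \<alpha>) (\<lambda>p. f p - g p)"
proof -
  have "F \<alpha> + complex_of_real (- 1) \<cdot>\<^sub>m G \<alpha> = F \<alpha> - G \<alpha>" for \<alpha>
    using mat_convergesD(2)[OF F, of \<alpha>] mat_convergesD(2)[OF G, of \<alpha>] by (intro eq_matI) auto
  then show ?thesis
    using mat_converges_add[OF R F mat_converges_scale[OF R G, of "- 1"]] by simp
qed

text \<open>Meant for A = F G, B = T(f) G, C = T(f) T(g), D = T(fg). The last difference keeps the
  sign in which asymptotic multiplicativity is stated.\<close>

lemma minus_mat_telescope:
  fixes A B C D :: "complex Matrix.mat"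
  assumes "A \<in> carrier_mat n m" "B \<in> carrier_mat n m" "C \<in> carrier_mat n m" "D \<in> carrier_mat n m"
  shows "A - D = (A - B) + (B - C) + (- 1) \<cdot>\<^sub>m (D - C)"
  using assms by (intro eq_matI) auto

text \<open>The error telescopes through T(f) G and T(f) T(g): two terms are a vanishing error times
  a bounded norm, the third is asymptotic multiplicativity. Convergent norms of T(f) and T(g) are
  bounded, and the norm of G exceeds that of T(g) by at most \<open>y \<alpha>\<close>.\<close>

lemma mat_converges_mult:
  assumes R: "matrix_regularization k S \<omega> N T h"
    and F: "mat_converges S N T F f" and G: "mat_converges S N T G g"
  shows "mat_converges S N T (\<lambda>\<alpha>. F \<alpha> * G \<alpha>) (\<lambda>p. f p * g p)"
proof -
  note f = mat_convergesD(1)[OF F] and g = mat_convergesD(1)[OF G]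
  have bounded: "\<exists>C. \<forall>\<alpha>. opnorm (T \<alpha> f) \<le> C" if "f \<in> Cinf S" for f
    using convergent_imp_Bseq[OF matrix_regularization_convergent[OF R that]]
    unfolding Bseq_def real_norm_def by (meson abs_ge_self order_trans)
  obtain C where C: "\<And>\<alpha>. opnorm (T \<alpha> f) \<le> C" using bounded[OF f] by blast
  obtain C' where C': "\<And>\<alpha>. opnorm (T \<alpha> g) \<le> C'" using bounded[OF g] by blast
  define x y z where "x \<alpha> = opnorm (F \<alpha> - T \<alpha> f)" and "y \<alpha> = opnorm (G \<alpha> - T \<alpha> g)"
    and "z \<alpha> = opnorm (T \<alpha> (\<lambda>p. f p * g p) - T \<alpha> f * T \<alpha> g)" for \<alpha>
  have lim: "x \<longlonglongrightarrow> 0" "y \<longlonglongrightarrow> 0" "z \<longlonglongrightarrow> 0"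
    using mat_convergesD(3)[OF F] mat_convergesD(3)[OF G] matrix_regularization_mult[OF R f g]
    by (simp_all add: x_def[abs_def] y_def[abs_def] z_def[abs_def])
  show ?thesis
  proof (rule mat_convergesI[OF R Cinf_mult[OF f g]])
    show "F \<alpha> * G \<alpha> \<in> carrier_mat (N \<alpha>) (N \<alpha>)" for \<alpha>
      by (rule mult_carrier_mat[OF mat_convergesD(2)[OF F] mat_convergesD(2)[OF G]])
    show "(\<lambda>\<alpha>. x \<alpha> * (y \<alpha> + C') + C * y \<alpha> + z \<alpha>) \<longlonglongrightarrow> 0"
      using tendsto_add[OF tendsto_add[OF tendsto_mult[OF lim(1) tendsto_add[OF lim(2) tendsto_const]]
            tendsto_mult_left[OF lim(2)]] lim(3)] by simp
    show "opnorm (F \<alpha> * G \<alpha> - T \<alpha> (\<lambda>p. f p * g p)) \<le> x \<alpha> * (y \<alpha> + C') + C * y \<alpha> + z \<alpha>" for \<alpha>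
    proof -
      note c = mat_convergesD(2)[OF F, of \<alpha>] mat_convergesD(2)[OF G, of \<alpha>]
        matrix_regularization_carrier[OF R f, of \<alpha>] matrix_regularization_carrier[OF R g, of \<alpha>]
      note cfg = matrix_regularization_carrier[OF R Cinf_mult[OF f g], of \<alpha>]
      note d = minus_carrier_mat[OF c(3), of "F \<alpha>"] minus_carrier_mat[OF c(4), of "G \<alpha>"]
      have c1: "(F \<alpha> - T \<alpha> f) * G \<alpha> \<in> carrier_mat (N \<alpha>) (N \<alpha>)" by (rule mult_carrier_mat[OF d(1) c(2)])
      have c2: "T \<alpha> f * (G \<alpha> - T \<alpha> g) \<in> carrier_mat (N \<alpha>) (N \<alpha>)" by (rule mult_carrier_mat[OF c(3) d(2)])
      have c34: "T \<alpha> f * T \<alpha> g \<in> carrier_mat (N \<alpha>) (N \<alpha>)" by (rule mult_carrier_mat[OF c(3,4)])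
      have c3: "T \<alpha> (\<lambda>p. f p * g p) - T \<alpha> f * T \<alpha> g \<in> carrier_mat (N \<alpha>) (N \<alpha>)"
        by (rule minus_carrier_mat[OF c34])
      have FG: "F \<alpha> * G \<alpha> \<in> carrier_mat (N \<alpha>) (N \<alpha>)" "T \<alpha> f * G \<alpha> \<in> carrier_mat (N \<alpha>) (N \<alpha>)"
        by (rule mult_carrier_mat[OF c(1,2)], rule mult_carrier_mat[OF c(3,2)])
      have "F \<alpha> * G \<alpha> - T \<alpha> (\<lambda>p. f p * g p) = ((F \<alpha> - T \<alpha> f) * G \<alpha> + T \<alpha> f * (G \<alpha> - T \<alpha> g))
          + (- 1) \<cdot>\<^sub>m (T \<alpha> (\<lambda>p. f p * g p) - T \<alpha> f * T \<alpha> g)"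
        unfolding minus_mult_distrib_mat[OF c(1,3,2)] mult_minus_distrib_mat[OF c(3,2,4)]
        by (rule minus_mat_telescope[OF FG c34 cfg])
      then have "opnorm (F \<alpha> * G \<alpha> - T \<alpha> (\<lambda>p. f p * g p))
          \<le> opnorm ((F \<alpha> - T \<alpha> f) * G \<alpha> + T \<alpha> f * (G \<alpha> - T \<alpha> g))
            + opnorm ((- 1) \<cdot>\<^sub>m (T \<alpha> (\<lambda>p. f p * g p) - T \<alpha> f * T \<alpha> g))"
        using opnorm_add[OF add_carrier_mat[OF c2] smult_carrier_mat[OF c3]] by simp
      moreover have "opnorm ((- 1) \<cdot>\<^sub>m (T \<alpha> (\<lambda>p. f p * g p) - T \<alpha> f * T \<alpha> g)) \<le> z \<alpha>"
        using opnorm_smult[OF c3, of "- 1"] by (simp add: z_def)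
      moreover have "opnorm ((F \<alpha> - T \<alpha> f) * G \<alpha> + T \<alpha> f * (G \<alpha> - T \<alpha> g))
          \<le> opnorm ((F \<alpha> - T \<alpha> f) * G \<alpha>) + opnorm (T \<alpha> f * (G \<alpha> - T \<alpha> g))"
        by (rule opnorm_add[OF c1 c2])
      moreover have "opnorm ((F \<alpha> - T \<alpha> f) * G \<alpha>) \<le> x \<alpha> * (y \<alpha> + C')"
      proof -
        have "G \<alpha> = (G \<alpha> - T \<alpha> g) + T \<alpha> g" using c by (intro eq_matI) auto
        then have "opnorm (G \<alpha>) \<le> y \<alpha> + opnorm (T \<alpha> g)"
          using opnorm_add[OF d(2) c(4)] by (simp add: y_def)
        then have "opnorm (G \<alpha>) \<le> y \<alpha> + C'" using C'[of \<alpha>] by linarith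
        then show ?thesis
          using order_trans[OF opnorm_mult[OF d(1) c(2)] mult_left_mono[OF _ opnorm_nonneg[OF d(1)]]]
          by (simp add: x_def)
      qed
      moreover have "opnorm (T \<alpha> f * (G \<alpha> - T \<alpha> g)) \<le> C * y \<alpha>"
        using order_trans[OF opnorm_mult[OF c(3) d(2)] mult_right_mono[OF C opnorm_nonneg[OF d(2)]]]
        by (simp add: y_def)
      ultimately show ?thesis by linarith
    qed
  qed
qed

text \<open>As \<open>T \<alpha> f\<close> is hermitian, the error of the adjoint is the adjoint of
  the error and has no larger norm. The limit is the same because functions are real.\<close>

lemma mat_converges_adjoint:
  assumes R: "matrix_regularization k S \<omega> N T h" and F: "mat_converges S N T F f"
  shows "mat_converges S N T (\<lambda>\<alpha>. mat_adjoint (F \<alpha>)) f"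
proof (rule mat_convergesI[OF R mat_convergesD(1)[OF F] _ _ mat_convergesD(3)[OF F]])
  note f = mat_convergesD(1)[OF F]
  show "mat_adjoint (F \<alpha>) \<in> carrier_mat (N \<alpha>) (N \<alpha>)" for \<alpha>
    by (rule mat_adjoint_carrier[OF mat_convergesD(2)[OF F]])
  show "opnorm (mat_adjoint (F \<alpha>) - T \<alpha> f) \<le> opnorm (F \<alpha> - T \<alpha> f)" for \<alpha>
    using opnorm_mat_adjoint_le[OF minus_carrier_mat[OF matrix_regularization_carrier[OF R f]], of "F \<alpha>" \<alpha>]
      mat_adjoint_minus[OF mat_convergesD(2)[OF F] matrix_regularization_carrier[OF R f], of \<alpha>]
    by (simp add: matrix_regularization_hermitian[OF R f])
qed

lemma pow_mat_2: "A \<in> carrier_mat n n \<Longrightarrow> A ^\<^sub>m 2 = A * A"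
  by (simp add: numeral_2_eq_2)

lemma mat_converges_power2:
  assumes R: "matrix_regularization k S \<omega> N T h" and F: "mat_converges S N T F f"
  shows "mat_converges S N T (\<lambda>\<alpha>. F \<alpha> ^\<^sub>m 2) (\<lambda>p. (f p)^2)"
  using mat_converges_mult[OF R F F] pow_mat_2[OF mat_convergesD(2)[OF F]]
  by (simp add: power2_eq_square)

lemma mat_sum_carrier: "mat_sum n I F \<in> carrier_mat n n"
  by (simp add: mat_sum_def)

lemma mat_converges_sum:
  assumes R: "matrix_regularization k S \<omega> N T h" and "finite I"
    and "\<And>i. i \<in> I \<Longrightarrow> mat_converges S N T (F i) (f i)"
  shows "mat_converges S N T (\<lambda>\<alpha>. mat_sum (N \<alpha>) I (\<lambda>i. F i \<alpha>)) (\<lambda>p. \<Sum>i\<in>I. f i p)"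
  using assms(2,3)
proof (induction I)
  case empty
  have Z: "(\<lambda>p. 0) \<in> Cinf S" by (rule Cinf_const)
  \<comment> \<open>Homogeneity with factor 0 sends the zero function to the zero matrix, so the
    empty sum has no error.\<close>
  have "T \<alpha> (\<lambda>p. 0) = 0\<^sub>m (N \<alpha>) (N \<alpha>)" for \<alpha>
  proof -
    have "0 \<cdot>\<^sub>m T \<alpha> (\<lambda>p. 0) = 0\<^sub>m (N \<alpha>) (N \<alpha>)"
      using matrix_regularization_carrier[OF R Z, of \<alpha>] by (intro eq_matI) auto
    then show ?thesis using matrix_regularization_scale[OF R Z, of \<alpha> 0] by simp
  qed
  then have eq: "mat_sum (N \<alpha>) {} (\<lambda>i. F i \<alpha>) - T \<alpha> (\<lambda>p. 0) = 0\<^sub>m (N \<alpha>) (N \<alpha>)" for \<alpha>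
    by (intro eq_matI) (auto simp: mat_sum_def)
  have "opnorm (0\<^sub>m n n) \<le> 0" for n
  proof (rule opnorm_least[of _ n n])
    fix v :: "complex Matrix.vec" assume "v \<in> carrier_vec n"
    then have "0\<^sub>m n n *\<^sub>v v = 0\<^sub>v n" by (intro eq_vecI) auto
    then show "vnorm (0\<^sub>m n n *\<^sub>v v) \<le> 0 * vnorm v" by simp
  qed auto
  then have "mat_converges S N T (\<lambda>\<alpha>. mat_sum (N \<alpha>) {} (\<lambda>i. F i \<alpha>)) (\<lambda>p. 0)"
    by (intro mat_convergesI[OF R Z mat_sum_carrier, where y = "\<lambda>_. 0"]) (simp_all add: eq)
  then show ?case by simp
next
  case (insert i I)
  note Fi = insert.prems[of i, simplified]
  have "mat_sum (N \<alpha>) (insert i I) (\<lambda>i. F i \<alpha>) = F i \<alpha> + mat_sum (N \<alpha>) I (\<lambda>i. F i \<alpha>)" for \<alpha>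
    using mat_convergesD(2)[OF Fi, of \<alpha>] insert.hyps
    by (intro eq_matI) (auto simp: mat_sum_def)
  then show ?case
    using mat_converges_add[OF R Fi insert.IH] insert by simp
qed

section \<open>Double commutators as second derivations\<close>

lemma commutator_carrier:
  "A \<in> carrier_mat n n \<Longrightarrow> B \<in> carrier_mat n n \<Longrightarrow> commutator A B \<in> carrier_mat n n"
  unfolding commutator_def by (simp add: minus_carrier_mat)

lemma commutator_smult:
  assumes "A \<in> carrier_mat n n" "B \<in> carrier_mat n n"
  shows "commutator (c \<cdot>\<^sub>m A) B = c \<cdot>\<^sub>m commutator A B"
proof -
  have "(c \<cdot>\<^sub>m A) * B = c \<cdot>\<^sub>m (A * B)" "B * (c \<cdot>\<^sub>m A) = c \<cdot>\<^sub>m (B * A)"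
    using assms by (auto intro: mult_smult_assoc_mat mult_smult_distrib)
  moreover have "c \<cdot>\<^sub>m (A * B) - c \<cdot>\<^sub>m (B * A) = c \<cdot>\<^sub>m (A * B - B * A)"
    using assms by (intro eq_matI) (auto simp: right_diff_distrib)
  ultimately show ?thesis by (simp add: commutator_def)
qed

text \<open>A derivation is a commutator divided by \<open>\<i> * H\<close>, so two of them divide
  by \<open>- (H\<^sup>2)\<close>. The list is reversed because its last function acts
  first.\<close>

lemma mderivs_two:
  assumes A: "A \<in> carrier_mat n n" and f: "t f \<in> carrier_mat n n" and g: "t g \<in> carrier_mat n n"
    and H: "H \<noteq> 0"
  shows "commutator (commutator A (t f)) (t g) = complex_of_real (- (H\<^sup>2)) \<cdot>\<^sub>m mderivs H t [g, f] A"
proof -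
  define c d where "c = 1 / (\<i> * complex_of_real H)" and "d = complex_of_real (- (H\<^sup>2))"
  define K where "K = commutator (commutator A (t f)) (t g)"
  have K: "K \<in> carrier_mat n n"
    unfolding K_def by (rule commutator_carrier[OF commutator_carrier[OF A f] g])
  have "mderivs H t [g, f] A = c \<cdot>\<^sub>m (c \<cdot>\<^sub>m K)"
    by (simp add: mderivs_def commutator_smult[OF commutator_carrier[OF A f] g] c_def K_def)
  moreover have "d * (c * (c * x)) = x" for x
    using H by (simp add: c_def d_def power2_eq_square field_simps)
  then have "d \<cdot>\<^sub>m (c \<cdot>\<^sub>m (c \<cdot>\<^sub>m K)) = K"
    using K by (intro eq_matI) auto
  ultimately show ?thesis by (simp add: K_def d_def)
qed

lemma mat_sum_rescale:
  assumes "c \<noteq> (0 :: complex)"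
    and "\<And>i. i \<in> I \<Longrightarrow> A i \<in> carrier_mat n n" "\<And>i. i \<in> I \<Longrightarrow> B i \<in> carrier_mat n n"
  shows "(1 / c) \<cdot>\<^sub>m mat_sum n I (\<lambda>i. x \<cdot>\<^sub>m (c \<cdot>\<^sub>m A i) - y \<cdot>\<^sub>m (c \<cdot>\<^sub>m B i))
    = mat_sum n I (\<lambda>i. x \<cdot>\<^sub>m A i - y \<cdot>\<^sub>m B i)"
proof (rule eq_matI)
  fix a b assume "a < dim_row (mat_sum n I (\<lambda>i. x \<cdot>\<^sub>m A i - y \<cdot>\<^sub>m B i))"
    "b < dim_col (mat_sum n I (\<lambda>i. x \<cdot>\<^sub>m A i - y \<cdot>\<^sub>m B i))"
  then have ab: "a < n" "b < n" by (simp_all add: mat_sum_def)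
  have "(x \<cdot>\<^sub>m (c \<cdot>\<^sub>m A i) - y \<cdot>\<^sub>m (c \<cdot>\<^sub>m B i)) $$ (a, b) = c * (x \<cdot>\<^sub>m A i - y \<cdot>\<^sub>m B i) $$ (a, b)"
    if "i \<in> I" for i
    using assms(2,3)[OF that] ab by (simp add: algebra_simps)
  then show "((1 / c) \<cdot>\<^sub>m mat_sum n I (\<lambda>i. x \<cdot>\<^sub>m (c \<cdot>\<^sub>m A i) - y \<cdot>\<^sub>m (c \<cdot>\<^sub>m B i))) $$ (a, b)
      = mat_sum n I (\<lambda>i. x \<cdot>\<^sub>m A i - y \<cdot>\<^sub>m B i) $$ (a, b)"
    using ab assms(1) by (simp add: mat_sum_def sum_distrib_left[symmetric])
qed (simp_all add: mat_sum_def)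

lemma sandwich_smult:
  fixes G A B H :: "complex Matrix.mat"
  assumes G: "G \<in> carrier_mat n n" and A: "A \<in> carrier_mat n n" and B: "B \<in> carrier_mat n n"
    and H: "H \<in> carrier_mat n n"
  shows "G * (c \<cdot>\<^sub>m A) * (d \<cdot>\<^sub>m B) * H = (c * d) \<cdot>\<^sub>m (G * A * B * H)"
proof -
  have 1: "G * (c \<cdot>\<^sub>m A) = c \<cdot>\<^sub>m (G * A)" by (rule mult_smult_distrib[OF G A])
  have GA: "G * A \<in> carrier_mat n n" by (rule mult_carrier_mat[OF G A])
  have 2: "c \<cdot>\<^sub>m (G * A) * (d \<cdot>\<^sub>m B) = c \<cdot>\<^sub>m (d \<cdot>\<^sub>m (G * A * B))"
    using mult_smult_assoc_mat[OF GA smult_carrier_mat[OF B]] mult_smult_distrib[OF GA B] by metis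
  have GAB: "G * A * B \<in> carrier_mat n n" by (rule mult_carrier_mat[OF GA B])
  have 3: "c \<cdot>\<^sub>m (d \<cdot>\<^sub>m (G * A * B)) * H = c \<cdot>\<^sub>m (d \<cdot>\<^sub>m (G * A * B * H))"
    using mult_smult_assoc_mat[OF smult_carrier_mat[OF GAB] H] mult_smult_assoc_mat[OF GAB H] by metis
  show ?thesis
    unfolding 1 2 3 by (intro eq_matI) (auto simp: mult.assoc)
qed

text \<open>The derivation axiom for lists of length 2, applied to coordinates. Smoothness of the
  limit is a separate part of \<open>mat_converges\<close> and comes from the smoothness of
  brackets.\<close>

lemma double_commutator_converges:
  fixes S :: "(real^'m) set"
  assumes R: "matrix_regularization 2 S \<omega> N T h" and \<omega>: "symplectic_form S \<omega>"
  shows "mat_converges S N T (\<lambda>\<alpha>. mderivs (h (N \<alpha>)) (T \<alpha>) [\<lambda>x. x $ l, \<lambda>x. x $ k] (T \<alpha> (\<lambda>x. x $ j)))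
    (double_bracket S \<omega> j k l)"
  unfolding mat_converges_def
proof (intro conjI allI)
  show "double_bracket S \<omega> j k l \<in> Cinf S" by (rule Cinf_double_bracket[OF \<omega>])
  note c = matrix_regularization_carrier[OF R Cinf_component]
  show "mderivs (h (N \<alpha>)) (T \<alpha>) [\<lambda>x. x $ l, \<lambda>x. x $ k] (T \<alpha> (\<lambda>x. x $ j)) \<in> carrier_mat (N \<alpha>) (N \<alpha>)" for \<alpha>
    by (simp add: mderivs_def commutator_carrier c)
  have "pderivs S \<omega> [\<lambda>x. x $ l, \<lambda>x. x $ k] (\<lambda>x. x $ j) = double_bracket S \<omega> j k l"
    by (simp add: pderivs_def double_bracket_def)
  then show "(\<lambda>\<alpha>. opnorm (mderivs (h (N \<alpha>)) (T \<alpha>) [\<lambda>x. x $ l, \<lambda>x. x $ k] (T \<alpha> (\<lambda>x. x $ j))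
      - T \<alpha> (double_bracket S \<omega> j k l))) \<longlonglongrightarrow> 0"
    using matrix_regularization_mderivs[OF R Cinf_component, of "[\<lambda>x. x $ l, \<lambda>x. x $ k]" j]
    by (simp add: Cinf_component)
qed

theorem mainTheorem6:
  fixes S :: "(real^'m) set"
    and \<omega> :: "real^'m \<Rightarrow> real^'m \<Rightarrow> real^'m \<Rightarrow> real"
    and N :: "nat \<Rightarrow> nat"
    and T :: "nat \<Rightarrow> (real^'m \<Rightarrow> real) \<Rightarrow> complex Matrix.mat"
    and h :: "nat \<Rightarrow> real"
    and \<gamma> :: "nat \<Rightarrow> complex Matrix.mat"
    and X :: "nat \<Rightarrow> 'm \<Rightarrow> complex Matrix.mat"
  assumes "compact S" and "embedded_surface S"
    and "symplectic_form S \<omega>"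
    and "matrix_regularization 2 S \<omega> N T h"
    and "mat_Ck_converges 2 S \<omega> N T h \<gamma> (gamma_fun S \<omega>)"
    and "\<And>\<alpha>. invertible_mat (\<gamma> \<alpha>)"
    and "mat_converges S N T (\<lambda>\<alpha>. minv (\<gamma> \<alpha>)) (\<lambda>p. 1 / gamma_fun S \<omega> p)"
    and "\<And>\<alpha> i. X \<alpha> i = T \<alpha> (\<lambda>x. x $ i)"
  shows "mat_converges S N T
    (\<lambda>\<alpha>. complex_of_real (1 / h (N \<alpha>) ^ 4) \<cdot>\<^sub>m
       mat_sum (N \<alpha>) (UNIV :: ('m \<times> 'm \<times> 'm) set) (\<lambda>(j, k, l).
         (1/2) \<cdot>\<^sub>m (minv (mat_adjoint (\<gamma> \<alpha>)) ^\<^sub>m 2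
           * commutator (commutator (X \<alpha> j) (X \<alpha> k)) (X \<alpha> k)
           * commutator (commutator (X \<alpha> j) (X \<alpha> l)) (X \<alpha> l)
           * minv (\<gamma> \<alpha>) ^\<^sub>m 2)
         - (1/4) \<cdot>\<^sub>m (minv (mat_adjoint (\<gamma> \<alpha>)) ^\<^sub>m 2
           * commutator (commutator (X \<alpha> j) (X \<alpha> k)) (X \<alpha> l)
           * commutator (commutator (X \<alpha> j) (X \<alpha> k)) (X \<alpha> l)
           * minv (\<gamma> \<alpha>) ^\<^sub>m 2)))
    (gaussian_curvature S)"
proof -
  note \<omega> = assms(3) and R = assms(4) and inv = assms(6) and X = assms(8)
  have \<gamma>: "\<gamma> \<alpha> \<in> carrier_mat (N \<alpha>) (N \<alpha>)" for \<alpha>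
    by (rule mat_convergesD(2)[OF conjunct1[OF assms(5)[unfolded mat_Ck_converges_def]]])
  have right: "mat_converges S N T (\<lambda>\<alpha>. minv (\<gamma> \<alpha>) ^\<^sub>m 2) (\<lambda>p. (1 / gamma_fun S \<omega> p)^2)"
    by (rule mat_converges_power2[OF R assms(7)])
  have left: "mat_converges S N T (\<lambda>\<alpha>. minv (mat_adjoint (\<gamma> \<alpha>)) ^\<^sub>m 2) (\<lambda>p. (1 / gamma_fun S \<omega> p)^2)"
    using mat_converges_power2[OF R mat_converges_adjoint[OF R assms(7)]]
    by (simp add: minv_mat_adjoint[OF \<gamma> inv])
  define M where "M \<alpha> j k l = mderivs (h (N \<alpha>)) (T \<alpha>) [\<lambda>x. x $ l, \<lambda>x. x $ k] (T \<alpha> (\<lambda>x. x $ j))"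
    for \<alpha> j k l
  have M: "mat_converges S N T (\<lambda>\<alpha>. M \<alpha> j k l) (double_bracket S \<omega> j k l)" for j k l
    unfolding M_def by (rule double_commutator_converges[OF R \<omega>])
  define Z where "Z \<alpha> j k l j' k' l' = minv (mat_adjoint (\<gamma> \<alpha>)) ^\<^sub>m 2 * M \<alpha> j k l * M \<alpha> j' k' l' * minv (\<gamma> \<alpha>) ^\<^sub>m 2"
    for \<alpha> j k l j' k' l'
  have Z: "mat_converges S N T (\<lambda>\<alpha>. Z \<alpha> j k l j' k' l') (\<lambda>p. (1 / gamma_fun S \<omega> p)^2
      * double_bracket S \<omega> j k l p * double_bracket S \<omega> j' k' l' p * (1 / gamma_fun S \<omega> p)^2)"
    for j k l j' k' l'
    unfolding Z_def by (intro mat_converges_mult[OF R] left right M)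
  \<comment> \<open>\<open>h\<close> is known to be positive from index 1 on, and the matrix
    dimensions are positive.\<close>
  have hpos: "h (N \<alpha>) \<noteq> 0" for \<alpha>
    using matrix_regularization_hbar[OF R, of "N \<alpha>"] matrix_regularization_dim[OF R, of \<alpha>] by simp
  have K: "commutator (commutator (X \<alpha> j) (X \<alpha> k)) (X \<alpha> l) = complex_of_real (- (h (N \<alpha>))\<^sup>2) \<cdot>\<^sub>m M \<alpha> j k l"
    for \<alpha> j k l
    unfolding X M_def
    by (rule mderivs_two[where t = "T \<alpha>" and n = "N \<alpha>"])
      (simp_all add: matrix_regularization_carrier[OF R Cinf_component] hpos)
  \<comment> \<open>The signs of the two double commutators cancel, leaving the fourth power that
    the prefactor removes.\<close>
  have h4: "complex_of_real (- (h (N \<alpha>))\<^sup>2) * complex_of_real (- (h (N \<alpha>))\<^sup>2) = complex_of_real (h (N \<alpha>) ^ 4)" for \<alpha>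
    by (simp flip: of_real_mult add: power2_eq_square power4_eq_xxxx)
  have "mat_converges S N T
     (\<lambda>\<alpha>. mat_sum (N \<alpha>) UNIV (\<lambda>i. case i of (j, k, l) \<Rightarrow>
        complex_of_real (1/2) \<cdot>\<^sub>m Z \<alpha> j k k j l l - complex_of_real (1/4) \<cdot>\<^sub>m Z \<alpha> j k l j k l))
     (bracket_curvature S \<omega>)"
    unfolding bracket_curvature_def[abs_def]
  proof (rule mat_converges_sum[OF R finite])
    fix i :: "'m \<times> 'm \<times> 'm"
    obtain j k l where "i = (j, k, l)" by (cases i)
    then show "mat_converges S N T
        (\<lambda>\<alpha>. case i of (j, k, l) \<Rightarrow>
          complex_of_real (1/2) \<cdot>\<^sub>m Z \<alpha> j k k j l l - complex_of_real (1/4) \<cdot>\<^sub>m Z \<alpha> j k l j k l)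
        (\<lambda>p. case i of (j, k, l) \<Rightarrow>
          1/2 * ((1 / gamma_fun S \<omega> p)^2 * double_bracket S \<omega> j k k p * double_bracket S \<omega> j l l p
            * (1 / gamma_fun S \<omega> p)^2)
          - 1/4 * ((1 / gamma_fun S \<omega> p)^2 * double_bracket S \<omega> j k l p * double_bracket S \<omega> j k l p
            * (1 / gamma_fun S \<omega> p)^2))"
      by (simp only: prod.case) (rule mat_converges_diff[OF R mat_converges_scale[OF R Z] mat_converges_scale[OF R Z]])
  qed
  then have lim: "mat_converges S N T
     (\<lambda>\<alpha>. mat_sum (N \<alpha>) UNIV (\<lambda>i. case i of (j, k, l) \<Rightarrow>
        complex_of_real (1/2) \<cdot>\<^sub>m Z \<alpha> j k k j l l - complex_of_real (1/4) \<cdot>\<^sub>m Z \<alpha> j k l j k l))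
     (gaussian_curvature S)"
    by (rule mat_converges_cong[OF R])
      (simp add: gaussian_curvature_eq_bracket_curvature[OF assms(2) \<omega>])
  \<comment> \<open>An exact identity of matrices for each \<open>\<alpha>\<close>, so clearing the
    powers of \<open>h (N \<alpha>)\<close> involves no limit.\<close>
  have "complex_of_real (1 / h (N \<alpha>) ^ 4) \<cdot>\<^sub>m
       mat_sum (N \<alpha>) (UNIV :: ('m \<times> 'm \<times> 'm) set) (\<lambda>(j, k, l).
         (1/2) \<cdot>\<^sub>m (minv (mat_adjoint (\<gamma> \<alpha>)) ^\<^sub>m 2
           * commutator (commutator (X \<alpha> j) (X \<alpha> k)) (X \<alpha> k)
           * commutator (commutator (X \<alpha> j) (X \<alpha> l)) (X \<alpha> l)
           * minv (\<gamma> \<alpha>) ^\<^sub>m 2)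
         - (1/4) \<cdot>\<^sub>m (minv (mat_adjoint (\<gamma> \<alpha>)) ^\<^sub>m 2
           * commutator (commutator (X \<alpha> j) (X \<alpha> k)) (X \<alpha> l)
           * commutator (commutator (X \<alpha> j) (X \<alpha> k)) (X \<alpha> l)
           * minv (\<gamma> \<alpha>) ^\<^sub>m 2))
      = mat_sum (N \<alpha>) UNIV (\<lambda>i. case i of (j, k, l) \<Rightarrow>
        complex_of_real (1/2) \<cdot>\<^sub>m Z \<alpha> j k k j l l - complex_of_real (1/4) \<cdot>\<^sub>m Z \<alpha> j k l j k l)" for \<alpha>
  proof -
    define c where "c = complex_of_real (h (N \<alpha>) ^ 4)"
    have c: "c \<noteq> 0" "complex_of_real (1 / h (N \<alpha>) ^ 4) = 1 / c" using hpos by (simp_all add: c_def)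
    have s: "minv (mat_adjoint (\<gamma> \<alpha>)) ^\<^sub>m 2 * (complex_of_real (- (h (N \<alpha>))\<^sup>2) \<cdot>\<^sub>m M \<alpha> j k l)
          * (complex_of_real (- (h (N \<alpha>))\<^sup>2) \<cdot>\<^sub>m M \<alpha> j' k' l') * minv (\<gamma> \<alpha>) ^\<^sub>m 2
        = c \<cdot>\<^sub>m Z \<alpha> j k l j' k' l'" for j k l j' k' l'
      unfolding Z_def c_def h4[symmetric]
      by (rule sandwich_smult[OF mat_convergesD(2)[OF left] mat_convergesD(2)[OF M]
            mat_convergesD(2)[OF M] mat_convergesD(2)[OF right]])
    have half: "complex_of_real (1/2) = 1/2" "complex_of_real (1/4) = 1/4" by simp_all
    show ?thesis
      unfolding K s c(2) half split_def
      by (rule mat_sum_rescale[OF c(1) mat_convergesD(2)[OF Z] mat_convergesD(2)[OF Z]])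
  qed
  then show ?thesis using lim by simp
qed

end
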